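(* Let $T\colon X\to X$ be a continuous transformation of a compact metric space, let $\mathbb{G}$ be a fibre bundle with base $X$ endowed with a distance $d_{\mathbb{G}}$, and let $\mathcal{E}$ be a space of oriented circle subbundles of $\mathbb{G}$ admitting a constant $\alpha>0$ and a family of homeomorphisms $h_{\mathbb{E},\mathbb{F}}$ with properties (i) and (ii) of the context. Fix a path $\phi$ in $Sk^+_{\mathcal{E},T}$ and a measure $\mu\in\mathcal{M}(T)$. The rotation number $\rho(\cdot,\phi)$ is defined $\mu$-almost everywhere, bounded, $T$-invariant, measurable, and only depends on the homotopy class of $\phi$ with fixed extremities. Moreover, $$\rho(\mu,\phi):=\int_X\rho(\cdot,\phi)\,d\mu$$ defines a continuous map $\rho\colon\mathcal{M}(T)\times P_1(Sk^+_{\mathcal{E},T})\to\mathbb{R}$.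
   Context: Rotation number on a fixed bundle. For an oriented circle bundle $\mathbb{E}$ over $X$, $Sk^+_{\mathbb{E},T}$ is the set of continuous maps $f\colon\mathbb{E}\to\mathbb{E}$ that project to $T$ and map each fiber $\mathbb{E}_x$ to $\mathbb{E}_{Tx}$ by an orientation-preserving homeomorphism, with the topology of uniform convergence. Give length $1$ to each circle. For a path $\gamma=(\gamma_t)_{t\in[a,b]}$ in a fiber, $w(\gamma)$ is the algebraic length of $[\widetilde\gamma_a,\widetilde\gamma_b]$ for any lift $\widetilde\gamma$ to the universal cover of the fiber. For a path $\phi=(f_t)$ in $Sk^+_{\mathbb{E},T}$, the rotation number at $x$ is $\rho(x,\phi)=\lim_n\frac1n w\big((f_t^nu)_t\big)$, for any $u\in\mathbb{E}_x$, when the limit exists (this is independent of $u$). If $(f_t)$, $(g_t)$ are paths in $Sk^+_{\mathbb{E},T}$ with $f_t,g_t$ conjugate for each $t$ by an element of $Sk^+_{\mathbb{E},\mathrm{Id}_X}$, they have the same rotation numbers. Varying bundles. For maps $f,g\colon K\to\mathbb{G}$ put $d_{\sup}(f,g)=\sup_{u\in K}d_{\mathbb{G}}(fu,gu)$. $\mathcal{E}$ is a space of oriented circle subbundles of $\mathbb{G}$ (over $X$), with distance $d(\mathbb{E},\mathbb{F})=\inf_h d_{\sup}(\mathrm{Id}_{\mathbb{E}},h)$, the infimum being over (orientation-preserving) homeomorphisms $h\colon\mathbb{E}\to\mathbb{F}$ fibering over $\mathrm{Id}_X$. It is assumed that there exist $\alpha>0$ and (orientation-preserving) homeomorphisms $h_{\mathbb{E},\mathbb{F}}\colon\mathbb{E}\to\mathbb{F}$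 fibering over $\mathrm{Id}_X$, for all pairs in $\mathcal{E}^2$ with $d(\mathbb{E},\mathbb{F})<\alpha$, such that: (i) $(\mathbb{E},\mathbb{F},u)\mapsto h_{\mathbb{E},\mathbb{F}}(u)$ is continuous on its domain; (ii) there is $C>1$ with $C^{-1}d(\mathbb{E},\mathbb{F})<d_{\sup}(\mathrm{Id}_{\mathbb{E}},h_{\mathbb{E},\mathbb{F}})<C\,d(\mathbb{E},\mathbb{F})$ for all $\mathbb{E}\neq\mathbb{F}$ with $d(\mathbb{E},\mathbb{F})<\alpha$. $Sk^+_{\mathcal{E},T}$ is the set of pairs $(\mathbb{E},f)$ with $\mathbb{E}\in\mathcal{E}$, $f\in Sk^+_{\mathbb{E},T}$, with the distance $\mathrm{dist}[(\mathbb{E},f),(\mathbb{F},g)]=\inf_h\big[d_{\sup}(\mathrm{Id}_{\mathbb{E}},h)+d_{\sup}(f,h^{-1}\circ g\circ h)\big]$, infimum over the same $h\colon\mathbb{E}\to\mathbb{F}$. $P_1(Sk^+_{\mathcal{E},T})$ is the set of (continuous) paths in $Sk^+_{\mathcal{E},T}$ with the topology of uniform convergence. $\mathcal{M}(T)$ is the vector space of $T$-invariant finite Borel signed measures on $X$ with the weak-* topology, and $\mathcal{M}(T)\times P_1(Sk^+_{\mathcal{E},T})$ carries the product topology. Rotation number of a path $\phi=(\mathbb{E}_t,f_t)_{t\in[0,1]}$ in $Sk^+_{\mathcal{E},T}$: there is a family of (orientation-preserving) homeomorphisms $h_t\colon\mathbb{E}_0\to\mathbb{E}_t$ fibering over $\mathrm{Id}_X$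 with $(t,u)\mapsto h_tu$ continuous; put $\phi_0=(h_t^{-1}\circ f_t\circ h_t)_{t}$, a path in $Sk^+_{\mathbb{E}_0,T}$, and $\rho(x,\phi):=\rho(x,\phi_0)$. This does not depend on the choice of $(h_t)$.
   Formalization: Joint continuity of ρ on all of M(T)×P_1 fails in general (T=Id on [0,1], ρ(μ,φ)=∫g dμ). Proved instead: continuity along convergent sequences, joint continuity on measures of total variation at most R times P_1 for each R, and continuity in each variable separately. *)

theory Defs
  imports "HOL-Analysis.Analysis"
begin

section \<open>Topologies of extended distances\<close>

text \<open>
  The distances below are infima over sets of homeomorphisms that may be empty, so they take
  values in \<^typ>\<open>ennreal\<close>. The definition mirrors \<^const>\<open>Metric_space.mtopology\<close>: a set is open
  iff it contains a ball around each of its points. It does not presuppose the metric axioms; the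
  distance on skew-products is symmetric and satisfies the triangle inequality only up to a
  constant factor, which is enough for the balls to be neighbourhoods of their centres.
\<close>

definition dist_topology :: "'a set \<Rightarrow> ('a \<Rightarrow> 'a \<Rightarrow> ennreal) \<Rightarrow> 'a topology" where
  "dist_topology S d =
     topology (\<lambda>U. U \<subseteq> S \<and> (\<forall>x\<in>U. \<exists>r>0. \<forall>y\<in>S. d x y < r \<longrightarrow> y \<in> U))"

lemma openin_dist_topology:
  "openin (dist_topology S d) U \<longleftrightarrow>
     U \<subseteq> S \<and> (\<forall>x\<in>U. \<exists>r>0. \<forall>y\<in>S. d x y < r \<longrightarrow> y \<in> U)"
proof -
  have "istopology (\<lambda>U. U \<subseteq> S \<and> (\<forall>x\<in>U. \<exists>r>0. \<forall>y\<in>S. d x y < r \<longrightarrow> y \<in> U))"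
    unfolding istopology_def
  proof (rule conjI; intro allI impI conjI ballI)
    fix A B x
    assume A: "A \<subseteq> S \<and> (\<forall>x\<in>A. \<exists>r>0. \<forall>y\<in>S. d x y < r \<longrightarrow> y \<in> A)"
      and B: "B \<subseteq> S \<and> (\<forall>x\<in>B. \<exists>r>0. \<forall>y\<in>S. d x y < r \<longrightarrow> y \<in> B)"
      and x: "x \<in> A \<inter> B"
    obtain r where r: "r > 0" "\<forall>y\<in>S. d x y < r \<longrightarrow> y \<in> A" using A x by blast
    obtain s where s: "s > 0" "\<forall>y\<in>S. d x y < s \<longrightarrow> y \<in> B" using B x by blast
    show "\<exists>r>0. \<forall>y\<in>S. d x y < r \<longrightarrow> y \<in> A \<inter> B"
      by (rule exI[of _ "min r s"]) (use r s in auto)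
  next
    fix K x
    assume "\<forall>A\<in>K. A \<subseteq> S \<and> (\<forall>x\<in>A. \<exists>r>0. \<forall>y\<in>S. d x y < r \<longrightarrow> y \<in> A)" "x \<in> \<Union>K"
    then show "\<exists>r>0. \<forall>y\<in>S. d x y < r \<longrightarrow> y \<in> \<Union>K" by (metis Union_iff)
  qed auto
  then show ?thesis by (simp add: dist_topology_def)
qed

lemma topspace_dist_topology [simp]: "topspace (dist_topology S d) = S"
proof
  show "topspace (dist_topology S d) \<subseteq> S"
    using openin_topspace[of "dist_topology S d"] unfolding openin_dist_topology by (rule conjunct1)
  have "openin (dist_topology S d) S"
    by (auto simp: openin_dist_topology intro: exI[of _ 1])
  then show "S \<subseteq> topspace (dist_topology S d)" by (rule openin_subset)
qed

definition d_sup :: "'a set \<Rightarrow> ('a \<Rightarrow> 'g::metric_space) \<Rightarrow> ('a \<Rightarrow> 'g) \<Rightarrow> ennreal" where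
  "d_sup K f g = (SUP u\<in>K. ennreal (dist (f u) (g u)))"


section \<open>Fibre bundles and oriented circle subbundles\<close>

definition fibre_bundle ::
  "'f topology \<Rightarrow> ('g::topological_space \<Rightarrow> 'x::topological_space) \<Rightarrow> bool" where
  "fibre_bundle F p \<longleftrightarrow> continuous_on UNIV p \<and>
     (\<forall>x. \<exists>U \<tau>. open U \<and> x \<in> U \<and>
        homeomorphic_map (prod_topology (top_of_set U) F) (top_of_set (p -` U)) \<tau> \<and>
        (\<forall>y\<in>U. \<forall>v\<in>topspace F. p (\<tau> (y, v)) = y))"

abbreviation circle :: "complex set" where
  "circle \<equiv> sphere 0 1"

definition circle_point :: "real \<Rightarrow> complex" where
  "circle_point s = cis (2 * pi * s)"

definition orientation_preserving_circle :: "(complex \<Rightarrow> complex) \<Rightarrow> bool" where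
  "orientation_preserving_circle k \<longleftrightarrow> (\<exists>q. homeomorphism circle circle k q) \<and>
     (\<exists>\<kappa>. continuous_on UNIV \<kappa> \<and> strict_mono \<kappa> \<and>
        (\<forall>s. k (circle_point s) = circle_point (\<kappa> s)))"

text \<open>
  A circle subbundle is a set of points of the ambient bundle. Its orientation is given by the
  set, for each base point, of all positively oriented parametrizations of the fibre by the unit
  circle. That set is a full equivalence class of parametrizations modulo orientation preserving
  homeomorphisms of the circle, so each oriented bundle is represented exactly once.
\<close>

record ('x, 'g) oriented_bundle =
  total :: "'g set"
  orient :: "'x \<Rightarrow> (complex \<Rightarrow> 'g) set"

definition fibre :: "('g \<Rightarrow> 'x) \<Rightarrow> ('x, 'g) oriented_bundle \<Rightarrow> 'x \<Rightarrow> 'g set" where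
  "fibre p E x = {u \<in> total E. p u = x}"

definition circle_parametrization :: "'g::topological_space set \<Rightarrow> (complex \<Rightarrow> 'g) \<Rightarrow> bool" where
  "circle_parametrization A c \<longleftrightarrow> (\<exists>q. homeomorphism circle A c q)"

definition is_orientation :: "'g::topological_space set \<Rightarrow> (complex \<Rightarrow> 'g) set \<Rightarrow> bool" where
  "is_orientation A P \<longleftrightarrow> (\<exists>c. circle_parametrization A c \<and>
     P = {c'. circle_parametrization A c' \<and>
              orientation_preserving_circle (inv_into circle c \<circ> c')})"

definition oriented_circle_subbundle ::
  "('g::topological_space \<Rightarrow> 'x::topological_space) \<Rightarrow> ('x, 'g) oriented_bundle \<Rightarrow> bool" where
  "oriented_circle_subbundle p E \<longleftrightarrow>
     (\<forall>x. is_orientation (fibre p E x) (orient E x)) \<and>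
     (\<forall>x. \<exists>U \<tau>. open U \<and> x \<in> U \<and>
        homeomorphic_map (prod_topology (top_of_set U) (top_of_set circle))
          (top_of_set (total E \<inter> p -` U)) \<tau> \<and>
        (\<forall>y\<in>U. (\<forall>z\<in>circle. p (\<tau> (y, z)) = y) \<and> (\<lambda>z. \<tau> (y, z)) \<in> orient E y))"

definition orientation_preserving_fibre_homeo ::
  "('g::topological_space \<Rightarrow> 'x) \<Rightarrow> ('x, 'g) oriented_bundle \<Rightarrow> 'x \<Rightarrow>
   ('x, 'g) oriented_bundle \<Rightarrow> 'x \<Rightarrow> ('g \<Rightarrow> 'g) \<Rightarrow> bool" where
  "orientation_preserving_fibre_homeo p E x F y k \<longleftrightarrow>
     (\<exists>q. homeomorphism (fibre p E x) (fibre p F y) k q) \<and>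
     (\<forall>c\<in>orient E x. k \<circ> c \<in> orient F y)"

text \<open>Only the values of such a map on the total space of \<open>E\<close> matter.\<close>

definition bundle_homeos ::
  "('g::topological_space \<Rightarrow> 'x) \<Rightarrow> ('x, 'g) oriented_bundle \<Rightarrow> ('x, 'g) oriented_bundle \<Rightarrow>
   ('g \<Rightarrow> 'g) set" where
  "bundle_homeos p E F =
     {h. (\<exists>q. homeomorphism (total E) (total F) h q) \<and>
         (\<forall>u\<in>total E. p (h u) = p u) \<and>
         (\<forall>x. orientation_preserving_fibre_homeo p E x F x h)}"

definition bundle_dist ::
  "('g::metric_space \<Rightarrow> 'x) \<Rightarrow> ('x, 'g) oriented_bundle \<Rightarrow> ('x, 'g) oriented_bundle \<Rightarrow> ennreal"
  where
  "bundle_dist p E F = (INF h\<in>bundle_homeos p E F. d_sup (total E) id h)"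

definition bundle_topology ::
  "('g::metric_space \<Rightarrow> 'x) \<Rightarrow> ('x, 'g) oriented_bundle set \<Rightarrow> ('x, 'g) oriented_bundle topology"
  where
  "bundle_topology p \<E> = dist_topology \<E> (bundle_dist p)"

definition good_homeo_family ::
  "('g::metric_space \<Rightarrow> 'x) \<Rightarrow> ('x, 'g) oriented_bundle set \<Rightarrow> real \<Rightarrow>
   (('x, 'g) oriented_bundle \<Rightarrow> ('x, 'g) oriented_bundle \<Rightarrow> 'g \<Rightarrow> 'g) \<Rightarrow> bool" where
  "good_homeo_family p \<E> \<alpha> H \<longleftrightarrow>
     (\<forall>E\<in>\<E>. \<forall>F\<in>\<E>. bundle_dist p E F < ennreal \<alpha> \<longrightarrow> H E F \<in> bundle_homeos p E F) \<and>
     continuous_map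
       (subtopology
          (prod_topology (prod_topology (bundle_topology p \<E>) (bundle_topology p \<E>)) euclidean)
          {((E, F), u). bundle_dist p E F < ennreal \<alpha> \<and> u \<in> total E})
       euclidean (\<lambda>((E, F), u). H E F u) \<and>
     (\<exists>C>1. \<forall>E\<in>\<E>. \<forall>F\<in>\<E>. E \<noteq> F \<and> bundle_dist p E F < ennreal \<alpha> \<longrightarrow>
        ennreal (inverse C) * bundle_dist p E F < d_sup (total E) id (H E F) \<and>
        d_sup (total E) id (H E F) < ennreal C * bundle_dist p E F)"


section \<open>Skew-products and their paths\<close>

definition Sk_fixed ::
  "('g::topological_space \<Rightarrow> 'x) \<Rightarrow> ('x \<Rightarrow> 'x) \<Rightarrow> ('x, 'g) oriented_bundle \<Rightarrow> ('g \<Rightarrow> 'g) set"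
  where
  "Sk_fixed p T E =
     {f \<in> total E \<rightarrow>\<^sub>E total E. continuous_on (total E) f \<and>
        (\<forall>u\<in>total E. p (f u) = T (p u)) \<and>
        (\<forall>x. orientation_preserving_fibre_homeo p E x E (T x) f)}"

definition Sk ::
  "('g::topological_space \<Rightarrow> 'x) \<Rightarrow> ('x \<Rightarrow> 'x) \<Rightarrow> ('x, 'g) oriented_bundle set \<Rightarrow>
   (('x, 'g) oriented_bundle \<times> ('g \<Rightarrow> 'g)) set" where
  "Sk p T \<E> = (SIGMA E:\<E>. Sk_fixed p T E)"

definition Sk_dist ::
  "('g::metric_space \<Rightarrow> 'x) \<Rightarrow> ('x, 'g) oriented_bundle \<times> ('g \<Rightarrow> 'g) \<Rightarrow>
   ('x, 'g) oriented_bundle \<times> ('g \<Rightarrow> 'g) \<Rightarrow> ennreal" where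
  "Sk_dist p = (\<lambda>(E, f) (F, g). INF h\<in>bundle_homeos p E F.
     d_sup (total E) id h + d_sup (total E) f (inv_into (total E) h \<circ> g \<circ> h))"

definition Sk_topology ::
  "('g::metric_space \<Rightarrow> 'x) \<Rightarrow> ('x \<Rightarrow> 'x) \<Rightarrow> ('x, 'g) oriented_bundle set \<Rightarrow>
   (('x, 'g) oriented_bundle \<times> ('g \<Rightarrow> 'g)) topology" where
  "Sk_topology p T \<E> = dist_topology (Sk p T \<E>) (Sk_dist p)"

type_synonym ('x, 'g) skew_path = "real \<Rightarrow> ('x, 'g) oriented_bundle \<times> ('g \<Rightarrow> 'g)"

definition Sk_paths ::
  "('g::metric_space \<Rightarrow> 'x) \<Rightarrow> ('x \<Rightarrow> 'x) \<Rightarrow> ('x, 'g) oriented_bundle set \<Rightarrow>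
   ('x, 'g) skew_path set" where
  "Sk_paths p T \<E> =
     {\<phi> \<in> extensional {0..1}. continuous_map (top_of_set {0..1}) (Sk_topology p T \<E>) \<phi>}"

definition Sk_paths_topology ::
  "('g::metric_space \<Rightarrow> 'x) \<Rightarrow> ('x \<Rightarrow> 'x) \<Rightarrow> ('x, 'g) oriented_bundle set \<Rightarrow>
   ('x, 'g) skew_path topology" where
  "Sk_paths_topology p T \<E> =
     dist_topology (Sk_paths p T \<E>) (\<lambda>\<phi> \<psi>. SUP t\<in>{0..1}. Sk_dist p (\<phi> t) (\<psi> t))"


section \<open>Rotation numbers\<close>

text \<open>
  Giving length 1 to an oriented circle amounts to choosing a positively oriented (arc length)
  parametrization \<open>c\<close> by the unit circle; the universal cover of the circle is then
  \<open>c \<circ> circle_point\<close>, and the algebraic length of a path is the displacement of a lift.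
\<close>

definition unit_length_structure ::
  "('x, 'g) oriented_bundle set \<Rightarrow> (('x, 'g) oriented_bundle \<Rightarrow> 'x \<Rightarrow> complex \<Rightarrow> 'g) \<Rightarrow> bool"
  where
  "unit_length_structure \<E> l \<longleftrightarrow> (\<forall>E\<in>\<E>. \<forall>x. l E x \<in> orient E x)"

definition algebraic_length :: "(complex \<Rightarrow> 'g) \<Rightarrow> (real \<Rightarrow> 'g) \<Rightarrow> real" where
  "algebraic_length c \<gamma> = (THE w. \<exists>g. continuous_on {0..1} g \<and>
     (\<forall>t\<in>{0..1}. \<gamma> t = c (circle_point (g t))) \<and> w = g 1 - g 0)"

definition has_rotation_number_fixed ::
  "('g \<Rightarrow> 'x) \<Rightarrow> ('x \<Rightarrow> 'x) \<Rightarrow> ('x, 'g) oriented_bundle \<Rightarrow> ('x \<Rightarrow> complex \<Rightarrow> 'g) \<Rightarrow>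
   (real \<Rightarrow> 'g \<Rightarrow> 'g) \<Rightarrow> 'x \<Rightarrow> real \<Rightarrow> bool" where
  "has_rotation_number_fixed p T E c f x r \<longleftrightarrow> (\<forall>u\<in>fibre p E x.
     (\<lambda>n. algebraic_length (c ((T ^^ n) x)) (\<lambda>t. (f t ^^ n) u) / real n) \<longlonglongrightarrow> r)"

definition transport_family ::
  "('g::topological_space \<Rightarrow> 'x) \<Rightarrow> ('x, 'g) skew_path \<Rightarrow> (real \<Rightarrow> 'g \<Rightarrow> 'g) \<Rightarrow> bool" where
  "transport_family p \<phi> h \<longleftrightarrow>
     (\<forall>t\<in>{0..1}. h t \<in> bundle_homeos p (fst (\<phi> 0)) (fst (\<phi> t))) \<and>
     continuous_on ({0..1} \<times> total (fst (\<phi> 0))) (\<lambda>(t, u). h t u)"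

definition pull_back_path ::
  "('x, 'g) skew_path \<Rightarrow> (real \<Rightarrow> 'g \<Rightarrow> 'g) \<Rightarrow> real \<Rightarrow> 'g \<Rightarrow> 'g" where
  "pull_back_path \<phi> h t = restrict
     (inv_into (total (fst (\<phi> 0))) (h t) \<circ> snd (\<phi> t) \<circ> h t) (total (fst (\<phi> 0)))"

text \<open>
  The rotation number is independent of the transport family, hence the universal quantifier;
  the existence clause excludes the vacuous case.
\<close>

definition has_rotation_number ::
  "('g::topological_space \<Rightarrow> 'x) \<Rightarrow> ('x \<Rightarrow> 'x) \<Rightarrow>
   (('x, 'g) oriented_bundle \<Rightarrow> 'x \<Rightarrow> complex \<Rightarrow> 'g) \<Rightarrow>
   ('x, 'g) skew_path \<Rightarrow> 'x \<Rightarrow> real \<Rightarrow> bool" where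
  "has_rotation_number p T l \<phi> x r \<longleftrightarrow> (\<exists>h. transport_family p \<phi> h) \<and>
     (\<forall>h. transport_family p \<phi> h \<longrightarrow>
        has_rotation_number_fixed p T (fst (\<phi> 0)) (l (fst (\<phi> 0))) (pull_back_path \<phi> h) x r)"

definition rotation_domain ::
  "('g::topological_space \<Rightarrow> 'x) \<Rightarrow> ('x \<Rightarrow> 'x) \<Rightarrow>
   (('x, 'g) oriented_bundle \<Rightarrow> 'x \<Rightarrow> complex \<Rightarrow> 'g) \<Rightarrow> ('x, 'g) skew_path \<Rightarrow> 'x set" where
  "rotation_domain p T l \<phi> = {x. \<exists>r. has_rotation_number p T l \<phi> x r}"

text \<open>Set to 0 where undefined, so that it can be integrated.\<close>

definition rotation_number ::
  "('g::topological_space \<Rightarrow> 'x) \<Rightarrow> ('x \<Rightarrow> 'x) \<Rightarrow>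
   (('x, 'g) oriented_bundle \<Rightarrow> 'x \<Rightarrow> complex \<Rightarrow> 'g) \<Rightarrow> ('x, 'g) skew_path \<Rightarrow> 'x \<Rightarrow> real" where
  "rotation_number p T l \<phi> x =
     (if x \<in> rotation_domain p T l \<phi> then THE r. has_rotation_number p T l \<phi> x r else 0)"


section \<open>Finite signed Borel measures\<close>

text \<open>
  Finite signed measures are countably additive real set functions on the Borel sets, extended
  by 0 to all sets. Countable additivity for the constant family \<open>{}\<close> gives \<open>\<nu> {} = 0\<close>.
\<close>

definition signed_measures :: "('x::topological_space set \<Rightarrow> real) set" where
  "signed_measures = {\<nu>. (\<forall>A. A \<notin> sets borel \<longrightarrow> \<nu> A = 0) \<and>
     (\<forall>A :: nat \<Rightarrow> 'x set. range A \<subseteq> sets borel \<and> disjoint_family A \<longrightarrow>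
        (\<lambda>n. \<nu> (A n)) sums \<nu> (\<Union>n. A n))}"

text \<open>The Jordan decomposition; negative values are cut off at 0 by \<^const>\<open>ennreal\<close>.\<close>

definition pos_part :: "('x::topological_space set \<Rightarrow> real) \<Rightarrow> 'x measure" where
  "pos_part \<nu> = measure_of UNIV (sets borel)
     (\<lambda>A. SUP B\<in>{B \<in> sets borel. B \<subseteq> A}. ennreal (\<nu> B))"

definition neg_part :: "('x::topological_space set \<Rightarrow> real) \<Rightarrow> 'x measure" where
  "neg_part \<nu> = pos_part (\<lambda>A. - \<nu> A)"

definition variation :: "('x::topological_space set \<Rightarrow> real) \<Rightarrow> 'x measure" where
  "variation \<nu> = measure_of UNIV (sets borel)
     (\<lambda>A. emeasure (pos_part \<nu>) A + emeasure (neg_part \<nu>) A)"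

definition signed_integral ::
  "('x::topological_space set \<Rightarrow> real) \<Rightarrow> ('x \<Rightarrow> real) \<Rightarrow> real" where
  "signed_integral \<nu> g = integral\<^sup>L (pos_part \<nu>) g - integral\<^sup>L (neg_part \<nu>) g"

definition invariant_measures ::
  "('x::topological_space \<Rightarrow> 'x) \<Rightarrow> ('x set \<Rightarrow> real) set" where
  "invariant_measures T = {\<nu> \<in> signed_measures. \<forall>A\<in>sets borel. \<nu> (T -` A) = \<nu> A}"

definition weak_star_topology ::
  "('x::topological_space \<Rightarrow> 'x) \<Rightarrow> ('x set \<Rightarrow> real) topology" where
  "weak_star_topology T = topology_generated_by
     {{\<nu> \<in> invariant_measures T. signed_integral \<nu> g \<in> V} | g V.
        continuous_on UNIV g \<and> open V}"

text \<open>
  Continuity of this quantity in \<open>(\<nu>, \<phi>)\<close> cannot mean joint continuity for the product of the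
  weak-* topology on all finite signed measures with the topology on paths: for \<open>T = id\<close> on
  \<open>[0, 1]\<close> and the path \<open>f t (x, u) = (x, u + t * g x)\<close> on the trivial bundle it is the duality
  pairing of \<open>\<nu>\<close> and \<open>g\<close>, which is discontinuous at \<open>(0, 0)\<close> because weak-* neighbourhoods of 0
  are unbounded in norm. It holds along sequences, on sets of measures of bounded variation
  times all paths, and in each variable separately.
\<close>

definition mean_rotation_number ::
  "('g::topological_space \<Rightarrow> 'x::topological_space) \<Rightarrow> ('x \<Rightarrow> 'x) \<Rightarrow>
   (('x, 'g) oriented_bundle \<Rightarrow> 'x \<Rightarrow> complex \<Rightarrow> 'g) \<Rightarrow>
   ('x set \<Rightarrow> real) \<Rightarrow> ('x, 'g) skew_path \<Rightarrow> real" where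
  "mean_rotation_number p T l \<nu> \<phi> = signed_integral \<nu> (rotation_number p T l \<phi>)"

end

theory Submission
  imports Defs
begin

text \<open>
  In a circle parametrization of the fibres, a path of fibre maps lifts to a path of homeomorphisms
  of the line commuting with the translation by 1. Such a homeomorphism moves all points by the same
  amount up to an error 1, so the algebraic length of \<open>t \<mapsto> f t ^^ n\<close> along an orbit depends on the
  starting point, on the parametrization and on the splitting \<open>n = k + m\<close> only up to universal
  constants. Averaging with a partition of unity gives continuous functions \<open>a n\<close> on the base with
  \<open>\<bar>a (n + m) - a n - a m \<circ> T ^^ n\<bar> \<le> K\<close>. Correcting \<open>a (2 ^ i) / 2 ^ i\<close> by coboundaries produces a uniformly
  convergent series, hence one continuous function \<open>b\<close> with \<open>a n / n\<close> asymptotic to the Birkhoff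
  averages of \<open>b\<close> at every point. Thus the rotation number is the Birkhoff limit of \<open>b\<close>, and its mean
  is \<open>\<integral> b\<close>, which settles everything about the measure variable. The constants being universal,
  the rotation numbers of two paths whose \<open>m\<close>-th iterates are close differ by \<open>O(1 / m)\<close>, uniformly
  in the base point; this gives continuity in the path. Weak-* convergent sequences of measures are
  bounded by the uniform boundedness principle.
\<close>

section \<open>Lifts of circle maps\<close>

text \<open>The parametrizations \<open>l E x\<close> are only required to be positively oriented:
  they need not vary continuously, or even measurably, with \<open>x\<close>, and a circle bundle
  may admit no continuous section. Hence no length is computed exactly; every estimate has an error
  whose size is irrelevant as long as it does not grow with the iterate \<open>n\<close>. A path of
  bundles is trivialised by composing the maps \<open>H\<close> over short time steps. Two
  trivialisations differ by a family over the identity that conjugates the pulled back families; by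
  compactness its orbits have bounded length, so conjugation changes the length of the
  \<open>n\<close>-th iterate by a bounded amount. This gives independence of the transport. For a
  homotopy, a lift over a square shows that the lengths of two opposite sides differ by those of the
  other two. On these the skew-product is fixed but the transport may still move, so the pulled back
  family is only conjugate to a constant one; again lengths stay bounded in \<open>n\<close>. Signed
  measures are handled through their Jordan parts, each finite and invariant, to which Birkhoff's
  theorem applies.\<close>

definition degree_one :: "(real \<Rightarrow> real) \<Rightarrow> bool" where
  "degree_one \<kappa> \<longleftrightarrow> continuous_on UNIV \<kappa> \<and> strict_mono \<kappa> \<and> (\<forall>s. \<kappa> (s + 1) = \<kappa> s + 1)"

lemma circle_point_in_circle [simp]: "circle_point s \<in> circle"
  by (simp add: circle_point_def)

lemma norm_circle_point [simp]: "norm (circle_point s) = 1"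
  by (simp add: circle_point_def)

lemma circle_point_eq_iff: "circle_point a = circle_point b \<longleftrightarrow> a - b \<in> \<int>"
proof
  assume "circle_point a = circle_point b"
  then have "cis (2 * pi * a - 2 * pi * b) = 1"
    by (simp add: circle_point_def cis_divide[symmetric])
  then have "cos (2 * pi * (a - b)) = 1" by (simp add: complex_eq_iff algebra_simps)
  then obtain n :: int where "2 * pi * (a - b) = of_int n * 2 * pi"
    by (auto simp: cos_one_2pi_int)
  then have "a - b = of_int n" by simp
  then show "a - b \<in> \<int>" by simp
next
  assume "a - b \<in> \<int>"
  then obtain n :: int where n: "a - b = of_int n" by (auto elim: Ints_cases)
  have "a = b + of_int n" using n by simp
  then have "circle_point a = circle_point b * cis (2 * pi * of_int n)"
    by (simp add: circle_point_def cis_mult distrib_left del: cis_multiple_2pi)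
  then show "circle_point a = circle_point b" by (simp add: cis_multiple_2pi)
qed

lemma circle_point_add_1 [simp]: "circle_point (s + 1) = circle_point s"
  by (simp add: circle_point_eq_iff)

lemma circle_point_surj: "z \<in> circle \<Longrightarrow> \<exists>s. z = circle_point s"
proof -
  assume "z \<in> circle"
  then have "z \<noteq> 0" "norm z = 1" by auto
  then have "cis (Arg z) = z" using cis_Arg[of z] by (simp add: sgn_eq)
  then have "z = cis (Arg z)" by (rule sym)
  then show ?thesis unfolding circle_point_def
    by (intro exI[of _ "Arg z / (2 * pi)"]) simp
qed

lemma continuous_on_circle_point [continuous_intros]:
  "continuous_on S f \<Longrightarrow> continuous_on S (\<lambda>x. circle_point (f x))"
  unfolding circle_point_def by (intro continuous_intros)

text \<open>A continuous function without zeros on a contractible set has a continuous logarithm;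
  modulus 1 makes its real part vanish, and the imaginary part divided by \<open>2 * pi\<close> is
  the lift.\<close>

lemma circle_lift_exists:
  fixes f :: "'a::real_normed_vector \<Rightarrow> complex"
  assumes "continuous_on S f" "convex S" "f ` S \<subseteq> circle"
  shows "\<exists>g. continuous_on S g \<and> (\<forall>x\<in>S. f x = circle_point (g x))"
proof -
  have nz: "f z \<noteq> 0" if "z \<in> S" for z using assms(3) that by force
  obtain g where g: "continuous_on S g" "\<And>x. x \<in> S \<Longrightarrow> f x = exp (g x)"
    using continuous_logarithm_on_contractible[OF assms(1) convex_imp_contractible[OF assms(2)] nz]
    by blast
  have "f x = circle_point (Im (g x) / (2 * pi))" if "x \<in> S" for x
  proof -
    have "norm (f x) = 1" using assms(3) that by auto
    then have "exp (Re (g x)) = 1" using g(2)[OF that] by simp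
    then show ?thesis using g(2)[OF that] by (simp add: circle_point_def exp_eq_polar)
  qed
  moreover have "continuous_on S (\<lambda>x. Im (g x) / (2 * pi))"
    using g(1) by (intro continuous_intros) auto
  ultimately show ?thesis by blast
qed

lemma continuous_Ints_constant:
  fixes f :: "'a::topological_space \<Rightarrow> real"
  assumes "connected S" "continuous_on S f" "\<And>x. x \<in> S \<Longrightarrow> f x \<in> \<int>" "a \<in> S" "b \<in> S"
  shows "f a = f b"
proof -
  have "f constant_on S"
  proof (rule continuous_discrete_range_constant[OF assms(1,2)])
    fix x assume x: "x \<in> S"
    show "\<exists>e>0. \<forall>y. y \<in> S \<and> f y \<noteq> f x \<longrightarrow> e \<le> norm (f y - f x)"
    proof (intro exI[of _ 1] conjI allI impI)
      fix y assume y: "y \<in> S \<and> f y \<noteq> f x"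
      have "f y - f x \<in> \<int>" using assms(3) x y by auto
      then show "1 \<le> norm (f y - f x)" using y Ints_nonzero_abs_ge1[of "f y - f x"] by auto
    qed simp
  qed
  then show ?thesis using assms(4,5) by (auto simp: constant_on_def)
qed

text \<open>Two lifts differ by a continuous integer valued function. Only the equality of the two
  differences is kept, since this is what makes displacements well defined.\<close>

lemma circle_lift_unique:
  fixes g g' :: "'a::topological_space \<Rightarrow> real"
  assumes "connected S" "continuous_on S g" "continuous_on S g'"
    "\<And>x. x \<in> S \<Longrightarrow> circle_point (g x) = circle_point (g' x)" "a \<in> S" "b \<in> S"
  shows "g a - g' a = g b - g' b"
proof (rule continuous_Ints_constant[OF assms(1) _ _ assms(5,6)])
  show "continuous_on S (\<lambda>x. g x - g' x)" by (intro continuous_intros assms(2,3))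
  show "g x - g' x \<in> \<int>" if "x \<in> S" for x using assms(4)[OF that] by (simp add: circle_point_eq_iff)
qed

lemma degree_one_shift_nat: "degree_one \<kappa> \<Longrightarrow> \<kappa> (s + of_nat n) = \<kappa> s + of_nat n"
proof (induction n)
  case (Suc n)
  have "\<kappa> (s + of_nat (Suc n)) = \<kappa> ((s + of_nat n) + 1)" by (simp add: algebra_simps)
  then show ?case using Suc by (simp add: degree_one_def)
qed simp

lemma degree_one_shift_int: "degree_one \<kappa> \<Longrightarrow> \<kappa> (s + of_int n) = \<kappa> s + of_int n"
proof (cases "n \<ge> 0")
  case True
  assume "degree_one \<kappa>"
  then show ?thesis using degree_one_shift_nat[of \<kappa> s "nat n"] True by simp
next
  case False
  assume "degree_one \<kappa>"
  then show ?thesis using degree_one_shift_nat[of \<kappa> "s + of_int n" "nat (- n)"] False by simp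
qed

text \<open>Since \<open>\<kappa> s - s\<close> has period 1, \<open>a\<close> may be moved into the
  interval from \<open>b\<close> to \<open>b + 1\<close>, where monotonicity squeezes
  \<open>\<kappa> a\<close> between \<open>\<kappa> b\<close> and \<open>\<kappa> b + 1\<close>. All
  universal constants below that come from comparing fibre maps originate here.\<close>

lemma degree_one_osc:
  assumes "degree_one \<kappa>"
  shows "\<bar>(\<kappa> a - a) - (\<kappa> b - b)\<bar> \<le> 1"
proof -
  define n where "n = \<lfloor>a - b\<rfloor>"
  define a' where "a' = a - of_int n"
  have "b \<le> a'" "a' < b + 1" unfolding a'_def n_def by linarith+
  moreover have mono: "strict_mono \<kappa>" using assms by (simp add: degree_one_def)
  ultimately have "\<kappa> b \<le> \<kappa> a'" "\<kappa> a' < \<kappa> (b + 1)"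
    by (auto simp: strict_mono_less_eq strict_mono_less)
  then have "\<kappa> b \<le> \<kappa> a'" "\<kappa> a' < \<kappa> b + 1" using assms by (auto simp: degree_one_def)
  moreover have "\<kappa> a = \<kappa> a' + of_int n"
    using degree_one_shift_int[OF assms, of a' n] by (simp add: a'_def)
  ultimately show ?thesis using \<open>b \<le> a'\<close> \<open>a' < b + 1\<close> unfolding a'_def by linarith
qed

lemma degree_one_comp: "degree_one \<kappa> \<Longrightarrow> degree_one \<kappa>' \<Longrightarrow> degree_one (\<kappa> \<circ> \<kappa>')"
  unfolding degree_one_def
  by (auto simp: strict_mono_def intro: continuous_on_compose2[of UNIV])

lemma degree_one_surj:
  assumes "degree_one \<kappa>"
  shows "\<exists>s. \<kappa> s = y"
proof -
  define m where "m = \<lfloor>y - \<kappa> 0\<rfloor>"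
  have 1: "\<kappa> (of_int m) \<le> y" "y \<le> \<kappa> (of_int (m + 1))"
    using degree_one_shift_int[OF assms, of 0 m] degree_one_shift_int[OF assms, of 0 "m + 1"]
    unfolding m_def by (auto simp del: of_int_add) linarith+
  have "continuous_on {of_int m..of_int (m + 1)} \<kappa>"
    using assms continuous_on_subset unfolding degree_one_def by blast
  then show ?thesis using IVT'[of \<kappa> "of_int m" y "of_int (m + 1)"] 1 by auto
qed

lemma degree_one_inverse:
  assumes "degree_one \<kappa>"
  shows "\<exists>\<kappa>'. degree_one \<kappa>' \<and> (\<forall>s. \<kappa> (\<kappa>' s) = s) \<and> (\<forall>s. \<kappa>' (\<kappa> s) = s)"
proof -
  define \<kappa>' where "\<kappa>' = inv \<kappa>"
  have mono: "strict_mono \<kappa>" using assms by (simp add: degree_one_def)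
  have inj: "inj \<kappa>" using mono by (rule strict_mono_imp_inj_on)
  have surj: "surj \<kappa>" using degree_one_surj[OF assms] by (metis surjI)
  have 1: "\<kappa> (\<kappa>' s) = s" "\<kappa>' (\<kappa> s) = s" for s
    using inj surj by (auto simp: \<kappa>'_def surj_f_inv_f)
  have m': "strict_mono \<kappa>'"
    unfolding strict_mono_def using strict_mono_less[OF mono] 1 by metis
  \<comment> \<open>A monotone map onto the whole line has no jumps; this is how continuity of the
    inverse is obtained.\<close>
  have "range \<kappa>' = UNIV" using 1(2) by (metis surjI)
  then have "continuous_on UNIV \<kappa>'"
    by (intro continuous_onI_mono) (use m' in \<open>auto simp: strict_mono_less_eq\<close>)
  moreover have "\<kappa>' (s + 1) = \<kappa>' s + 1" for s
    using assms 1 unfolding degree_one_def by metis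
  ultimately show ?thesis using 1 m' unfolding degree_one_def by blast
qed

section \<open>Orientations\<close>

lemma circle_inj_iff:
  "inj_on c circle \<Longrightarrow> c (circle_point a) = c (circle_point b) \<longleftrightarrow> circle_point a = circle_point b"
  by (auto dest: inj_onD simp del: mem_sphere mem_sphere_0)

text \<open>The increment of \<open>\<kappa>\<close> over a period is a positive integer. If it were
  at least 2, the intermediate value theorem would give a point strictly inside the period where
  \<open>\<kappa>\<close> has grown by exactly 1, and \<open>k\<close> would identify two points of
  the circle.\<close>

lemma circle_injective_lift_degree_one:
  assumes inj: "inj_on k circle" and cont: "continuous_on UNIV \<kappa>" and mono: "strict_mono \<kappa>"
    and lift: "\<And>s. k (circle_point s) = circle_point (\<kappa> s)"
  shows "degree_one \<kappa>"
proof -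
  have int: "\<kappa> (s + 1) - \<kappa> s \<in> \<int>" for s
    using lift[of s] lift[of "s + 1"] by (simp add: circle_point_eq_iff[symmetric])
  have "\<kappa> (s + 1) - \<kappa> s = 1" for s
  proof (rule ccontr)
    assume ne: "\<kappa> (s + 1) - \<kappa> s \<noteq> 1"
    obtain n :: int where n: "\<kappa> (s + 1) - \<kappa> s = of_int n" using int Ints_cases by blast
    have "\<kappa> s < \<kappa> (s + 1)" using mono by (simp add: strict_mono_less)
    then have "n > 0" using n by linarith
    then have "n \<ge> 2" using ne n by (cases "n = 1") auto
    then have le: "\<kappa> s \<le> \<kappa> s + 1" "\<kappa> s + 1 \<le> \<kappa> (s + 1)" using n by linarith+
    obtain r where r: "s \<le> r" "r \<le> s + 1" "\<kappa> r = \<kappa> s + 1"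
      using IVT'[of \<kappa> s "\<kappa> s + 1" "s + 1"] le cont continuous_on_subset by fastforce
    have "k (circle_point r) = k (circle_point s)" using lift r(3) by simp
    then have "circle_point r = circle_point s" using circle_inj_iff[OF inj] by simp
    then have "r - s \<in> \<int>" by (simp add: circle_point_eq_iff)
    then obtain m :: int where "r - s = of_int m" using Ints_cases by blast
    moreover have "of_int m \<ge> (0::real)" "of_int m \<le> (1::real)" using r calculation by linarith+
    then have "m = 0 \<or> m = 1" by auto
    ultimately have "r = s \<or> r = s + 1" by auto
    then show False using r(3) n \<open>n \<ge> 2\<close> by auto
  qed
  then show ?thesis using cont mono unfolding degree_one_def by (metis diff_eq_eq add.commute)
qed

text \<open>The definition of \<open>orientation_preserving_circle\<close> asks only for an
  increasing lift; that it commutes with the translation by 1 comes from injectivity.\<close>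

lemma orientation_preserving_circle_lift:
  assumes "orientation_preserving_circle k"
  shows "\<exists>\<kappa>. degree_one \<kappa> \<and> (\<forall>s. k (circle_point s) = circle_point (\<kappa> s))"
proof -
  obtain q \<kappa> where q: "homeomorphism circle circle k q" and "continuous_on UNIV \<kappa>" "strict_mono \<kappa>"
    and lift: "\<forall>s. k (circle_point s) = circle_point (\<kappa> s)"
    using assms unfolding orientation_preserving_circle_def by blast
  moreover have "inj_on k circle" using q homeomorphism_apply1 by (metis inj_on_inverseI)
  ultimately show ?thesis using circle_injective_lift_degree_one by blast
qed

lemma circle_parametrization_inj: "circle_parametrization A c \<Longrightarrow> inj_on c circle"
  unfolding circle_parametrization_def by (metis homeomorphism_apply1 inj_on_inverseI)

lemma circle_parametrization_image: "circle_parametrization A c \<Longrightarrow> c ` circle = A"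
  unfolding circle_parametrization_def by (auto simp: homeomorphism_def)

lemma circle_parametrization_mem: "circle_parametrization A c \<Longrightarrow> c (circle_point s) \<in> A"
  using circle_parametrization_image circle_point_in_circle by (metis imageI)

lemma circle_parametrization_continuous: "circle_parametrization A c \<Longrightarrow> continuous_on circle c"
  unfolding circle_parametrization_def by (auto simp: homeomorphism_def)

lemma circle_parametrization_homeomorphism:
  assumes "circle_parametrization A c"
  shows "homeomorphism circle A c (inv_into circle c)"
proof -
  obtain q where q: "homeomorphism circle A c q"
    using assms unfolding circle_parametrization_def by blast
  have "inv_into circle c v = q v" if "v \<in> A" for v
    using that q circle_parametrization_inj[OF assms]
    by (metis homeomorphism_def imageI inv_into_f_f)
  then show ?thesis using q by (auto intro: homeomorphism_cong)
qed

lemma circle_parametrization_point: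
  assumes "circle_parametrization A c" "v \<in> A"
  shows "\<exists>s. v = c (circle_point s)"
proof -
  have "v \<in> c ` circle" using assms(2) circle_parametrization_image[OF assms(1)] by simp
  then obtain z where "z \<in> circle" "v = c z" by (rule imageE)
  then show ?thesis using circle_point_surj[of z] by auto
qed

lemma orientation_preserving_circleI:
  assumes "circle_parametrization A c" "circle_parametrization A c'" "degree_one \<kappa>"
    "\<And>s. c' (circle_point s) = c (circle_point (\<kappa> s))"
  shows "orientation_preserving_circle (inv_into circle c \<circ> c')"
proof -
  have "homeomorphism circle circle (inv_into circle c \<circ> c') (inv_into circle c' \<circ> c)"
    using homeomorphism_compose circle_parametrization_homeomorphism[OF assms(2)]
      circle_parametrization_homeomorphism[OF assms(1)] homeomorphism_sym by blast
  moreover have "(inv_into circle c \<circ> c') (circle_point s) = circle_point (\<kappa> s)" for s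
    using assms(4) inv_into_f_f[OF circle_parametrization_inj[OF assms(1)] circle_point_in_circle]
    by simp
  ultimately show ?thesis using assms(3)
    unfolding orientation_preserving_circle_def degree_one_def by blast
qed

lemma is_orientation_parametrization:
  "is_orientation A P \<Longrightarrow> c \<in> P \<Longrightarrow> circle_parametrization A c"
  unfolding is_orientation_def by auto

lemma is_orientation_nonempty:
  assumes "is_orientation A P" shows "P \<noteq> {}"
proof -
  obtain c where c: "circle_parametrization A c"
    and P: "P = {c'. circle_parametrization A c' \<and>
      orientation_preserving_circle (inv_into circle c \<circ> c')}"
    using assms unfolding is_orientation_def by blast
  have "degree_one id" by (auto simp: degree_one_def strict_mono_def)
  then have "orientation_preserving_circle (inv_into circle c \<circ> c)"
    using orientation_preserving_circleI[OF c c] by simp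
  then show ?thesis using c P by blast
qed

lemma orientation_preserving_lift:
  assumes "circle_parametrization A c" "circle_parametrization A c'"
    "orientation_preserving_circle (inv_into circle c \<circ> c')"
  shows "\<exists>\<kappa>. degree_one \<kappa> \<and> (\<forall>s. c' (circle_point s) = c (circle_point (\<kappa> s)))"
proof -
  obtain \<kappa> where \<kappa>: "degree_one \<kappa>"
    "\<And>s. (inv_into circle c \<circ> c') (circle_point s) = circle_point (\<kappa> s)"
    using orientation_preserving_circle_lift[OF assms(3)] by blast
  have "c' (circle_point s) = c (circle_point (\<kappa> s))" for s
  proof -
    have "c' (circle_point s) \<in> c ` circle"
      using circle_parametrization_image[OF assms(1)] circle_parametrization_mem[OF assms(2)] by simp
    then show ?thesis using \<kappa>(2)[of s] by (metis comp_apply f_inv_into_f)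
  qed
  then show ?thesis using \<kappa>(1) by blast
qed

text \<open>Both parametrizations are compared with the reference one hidden in
  \<open>is_orientation\<close>; inverting one of the two lifts eliminates it.\<close>

lemma is_orientation_transition:
  assumes "is_orientation A P" "c1 \<in> P" "c2 \<in> P"
  shows "\<exists>\<kappa>. degree_one \<kappa> \<and> (\<forall>s. c2 (circle_point s) = c1 (circle_point (\<kappa> s)))"
proof -
  obtain c where c: "circle_parametrization A c"
    and P: "P = {c'. circle_parametrization A c' \<and>
      orientation_preserving_circle (inv_into circle c \<circ> c')}"
    using assms(1) unfolding is_orientation_def by blast
  obtain \<kappa>1 where 1: "degree_one \<kappa>1" "\<And>s. c1 (circle_point s) = c (circle_point (\<kappa>1 s))"
    using orientation_preserving_lift[OF c] assms(2) P by auto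
  obtain \<kappa>2 where 2: "degree_one \<kappa>2" "\<And>s. c2 (circle_point s) = c (circle_point (\<kappa>2 s))"
    using orientation_preserving_lift[OF c] assms(3) P by auto
  obtain \<kappa>' where k: "degree_one \<kappa>'" "\<And>s. \<kappa>1 (\<kappa>' s) = s"
    using degree_one_inverse[OF 1(1)] by blast
  have "c2 (circle_point s) = c1 (circle_point ((\<kappa>' \<circ> \<kappa>2) s))" for s
    using 1(2) 2(2) k(2) by simp
  then show ?thesis using degree_one_comp[OF k(1) 2(1)] by blast
qed

text \<open>Converse of the previous statement. It serves to show that the inverse of a bundle
  homeomorphism respects orientations.\<close>

lemma is_orientation_memI:
  assumes "is_orientation A P" "c1 \<in> P" "circle_parametrization A c2" "degree_one \<kappa>"
    "\<And>s. c2 (circle_point s) = c1 (circle_point (\<kappa> s))"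
  shows "c2 \<in> P"
proof -
  obtain c where c: "circle_parametrization A c"
    and P: "P = {c'. circle_parametrization A c' \<and>
      orientation_preserving_circle (inv_into circle c \<circ> c')}"
    using assms(1) unfolding is_orientation_def by blast
  obtain \<kappa>1 where 1: "degree_one \<kappa>1" "\<And>s. c1 (circle_point s) = c (circle_point (\<kappa>1 s))"
    using orientation_preserving_lift[OF c] assms(2) P by auto
  have "orientation_preserving_circle (inv_into circle c \<circ> c2)"
    by (rule orientation_preserving_circleI[OF c assms(3) degree_one_comp[OF 1(1) assms(4)]])
      (use assms(5) 1(2) in simp)
  then show ?thesis using P assms(3) by simp
qed

section \<open>Algebraic lengths\<close>

definition path_lift :: "(complex \<Rightarrow> 'g) \<Rightarrow> (real \<Rightarrow> 'g) \<Rightarrow> (real \<Rightarrow> real) \<Rightarrow> bool" where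
  "path_lift c \<gamma> g \<longleftrightarrow> continuous_on {0..1} g \<and> (\<forall>t\<in>{0..1}. \<gamma> t = c (circle_point (g t)))"

text \<open>Resolves the definite description in \<open>algebraic_length\<close>: lifts of the same
  path have the same displacement, so any one of them computes the length.\<close>

lemma algebraic_length_eq:
  assumes inj: "inj_on c circle" and g: "path_lift c \<gamma> g"
  shows "algebraic_length c \<gamma> = g 1 - g 0"
  unfolding algebraic_length_def
proof (rule the_equality)
  show "\<exists>g'. continuous_on {0..1} g' \<and> (\<forall>t\<in>{0..1}. \<gamma> t = c (circle_point (g' t))) \<and>
      g 1 - g 0 = g' 1 - g' 0"
    using g unfolding path_lift_def by blast
next
  fix w
  assume "\<exists>g'. continuous_on {0..1} g' \<and> (\<forall>t\<in>{0..1}. \<gamma> t = c (circle_point (g' t))) \<and> w = g' 1 - g' 0"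
  then obtain g' where g': "continuous_on {0..1} g'"
    "\<And>t. t \<in> {0..1} \<Longrightarrow> \<gamma> t = c (circle_point (g' t))" "w = g' 1 - g' 0" by blast
  have "circle_point (g t) = circle_point (g' t)" if "t \<in> {0..1}" for t
  proof -
    have "c (circle_point (g t)) = c (circle_point (g' t))"
      using g g'(2)[OF that] that unfolding path_lift_def by metis
    then show ?thesis using circle_inj_iff[OF inj] by simp
  qed
  then have "g 1 - g' 1 = g 0 - g' 0"
    by (intro circle_lift_unique[of "{0..1}"]) (use g g' in \<open>auto simp: path_lift_def\<close>)
  then show "w = g 1 - g 0" using g'(3) by simp
qed

text \<open>Stated for convex domains because it is applied to an interval (a path), to the strip
  \<open>{0..1} \<times> UNIV\<close> (a family of fibre maps) and to a square (a homotopy).\<close>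

lemma circle_parametrization_lift:
  fixes f :: "'a::real_normed_vector \<Rightarrow> 'g::topological_space"
  assumes c: "circle_parametrization A c" and f: "continuous_on S f" "f ` S \<subseteq> A" and S: "convex S"
  shows "\<exists>g. continuous_on S g \<and> (\<forall>x\<in>S. f x = c (circle_point (g x)))"
proof -
  have h: "homeomorphism circle A c (inv_into circle c)"
    by (rule circle_parametrization_homeomorphism[OF c])
  have "continuous_on S (\<lambda>x. inv_into circle c (f x))"
    using h f continuous_on_compose2[of A "inv_into circle c" S f] by (auto simp: homeomorphism_def)
  moreover have "(\<lambda>x. inv_into circle c (f x)) ` S \<subseteq> circle"
    using h f(2) by (auto simp: homeomorphism_def image_subset_iff)
  ultimately obtain g where g: "continuous_on S g"
    "\<And>x. x \<in> S \<Longrightarrow> inv_into circle c (f x) = circle_point (g x)"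
    using circle_lift_exists[OF _ S] by blast
  have "f x = c (circle_point (g x))" if "x \<in> S" for x
    using g(2)[OF that] h f(2) that by (metis homeomorphism_apply2 image_subset_iff)
  then show ?thesis using g(1) by blast
qed

lemma path_lift_exists:
  fixes \<gamma> :: "real \<Rightarrow> 'g::topological_space"
  assumes "circle_parametrization A c" "continuous_on {0..1} \<gamma>" "\<gamma> ` {0..1} \<subseteq> A"
  shows "\<exists>g. path_lift c \<gamma> g"
  using circle_parametrization_lift[OF assms] by (auto simp: path_lift_def)

lemma algebraic_length_cong:
  "(\<And>t. t \<in> {0..1} \<Longrightarrow> \<gamma> t = \<gamma>' t) \<Longrightarrow> algebraic_length c \<gamma> = algebraic_length c \<gamma>'"
  unfolding algebraic_length_def by simp

lemma algebraic_length_const: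
  assumes "circle_parametrization A c" "v \<in> A" "\<And>t. t \<in> {0..1} \<Longrightarrow> \<gamma> t = v"
  shows "algebraic_length c \<gamma> = 0"
proof -
  obtain s where "v = c (circle_point s)" using circle_parametrization_point assms(1,2) by blast
  then have "path_lift c \<gamma> (\<lambda>_. s)" using assms(3) by (simp add: path_lift_def)
  then show ?thesis using algebraic_length_eq circle_parametrization_inj assms(1) by fastforce
qed

text \<open>The given lifts for the single \<open>t\<close> are unrelated to each other, so a joint
  lift is taken over the strip. For fixed \<open>t\<close> it differs from the given degree one lift
  by an additive constant and thus has degree one too.\<close>

lemma family_lift:
  fixes g :: "real \<Rightarrow> 'g::topological_space \<Rightarrow> 'g"
  assumes c: "circle_parametrization A c" and c': "circle_parametrization B c'"
    and cont: "continuous_on ({0..1} \<times> A) (\<lambda>(t, u). g t u)"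
    and lift: "\<And>t. t \<in> {0..1} \<Longrightarrow>
      \<exists>\<kappa>. degree_one \<kappa> \<and> (\<forall>s. g t (c (circle_point s)) = c' (circle_point (\<kappa> s)))"
  shows "\<exists>G. continuous_on ({0..1} \<times> UNIV) (\<lambda>(t, s). G t s) \<and> (\<forall>t\<in>{0..1}. degree_one (G t)) \<and>
    (\<forall>t\<in>{0..1}. \<forall>s. g t (c (circle_point s)) = c' (circle_point (G t s)))"
proof -
  let ?S = "{0..1::real} \<times> (UNIV :: real set)"
  let ?f = "\<lambda>x. g (fst x) (c (circle_point (snd x)))"
  have A: "c (circle_point s) \<in> A" for s by (rule circle_parametrization_mem[OF c])
  have "continuous_on ?S (\<lambda>x. c (circle_point (snd x)))"
    by (rule continuous_on_compose2[OF circle_parametrization_continuous[OF c]])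
      (auto intro!: continuous_intros)
  then have "continuous_on ?S (\<lambda>x. (fst x, c (circle_point (snd x))))"
    by (intro continuous_intros)
  then have cf: "continuous_on ?S ?f"
    using continuous_on_compose2[OF cont, of ?S "\<lambda>x. (fst x, c (circle_point (snd x)))"] A
    by (simp add: image_subset_iff)
  have "?f x \<in> B" if "x \<in> ?S" for x
  proof -
    have "fst x \<in> {0..1}" using that by auto
    then obtain \<kappa> where "\<forall>s. g (fst x) (c (circle_point s)) = c' (circle_point (\<kappa> s))"
      using lift by blast
    then show ?thesis using circle_parametrization_mem[OF c'] by simp
  qed
  then have im: "?f ` ?S \<subseteq> B" by (rule image_subsetI)
  have "convex ?S" by (intro convex_Times convex_real_interval convex_UNIV)
  then obtain G where G: "continuous_on ?S G" "\<And>x. x \<in> ?S \<Longrightarrow> ?f x = c' (circle_point (G x))"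
    using circle_parametrization_lift[OF c' cf im] by blast
  have "degree_one (\<lambda>s. G (t, s))" if t: "t \<in> {0..1}" for t
  proof -
    obtain \<kappa> where \<kappa>: "degree_one \<kappa>" "\<And>s. g t (c (circle_point s)) = c' (circle_point (\<kappa> s))"
      using lift[OF t] by blast
    have "c' (circle_point (G (t, s))) = c' (circle_point (\<kappa> s))" for s
      using \<kappa>(2)[of s] G(2)[of "(t, s)"] t by simp
    then have eq: "circle_point (G (t, s)) = circle_point (\<kappa> s)" for s
      using circle_inj_iff[OF circle_parametrization_inj[OF c']] by simp
    have cG: "continuous_on UNIV (\<lambda>s. G (t, s))"
      by (rule continuous_on_compose2[OF G(1)]) (use t in \<open>auto intro!: continuous_intros\<close>)
    have d: "G (t, s) - \<kappa> s = G (t, 0) - \<kappa> 0" for s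
      by (rule circle_lift_unique[of UNIV "\<lambda>s. G (t, s)" \<kappa>])
        (use cG \<kappa>(1) eq in \<open>auto simp: degree_one_def\<close>)
    define r where "r = G (t, 0) - \<kappa> 0"
    have "G (t, s) = \<kappa> s + r" for s using d[of s] unfolding r_def by linarith
    then show ?thesis using \<kappa>(1) cG unfolding degree_one_def strict_mono_def by simp
  qed
  moreover have "g t (c (circle_point s)) = c' (circle_point (G (t, s)))" if "t \<in> {0..1}" for t s
    using G(2)[of "(t, s)"] that by simp
  ultimately show ?thesis using G(1)
    by (intro exI[of _ "\<lambda>t s. G (t, s)"]) (simp add: case_prod_unfold)
qed

text \<open>With a joint lift \<open>G\<close> and lifts \<open>d\<close> of \<open>\<delta>\<close>
  and \<open>s\<close> of \<open>u\<close>, the expression is the difference of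
  \<open>(G t (d t) - d t) - (G t s - s)\<close> at \<open>t = 1\<close> and at
  \<open>t = 0\<close>. By \<open>degree_one_osc\<close> each of these is at most 1 in absolute
  value, whence the 2.\<close>

lemma algebraic_length_family:
  fixes g :: "real \<Rightarrow> 'g::topological_space \<Rightarrow> 'g"
  assumes c: "circle_parametrization A c" and c': "circle_parametrization B c'"
    and cont: "continuous_on ({0..1} \<times> A) (\<lambda>(t, u). g t u)"
    and lift: "\<And>t. t \<in> {0..1} \<Longrightarrow>
      \<exists>\<kappa>. degree_one \<kappa> \<and> (\<forall>s. g t (c (circle_point s)) = c' (circle_point (\<kappa> s)))"
    and \<delta>: "continuous_on {0..1} \<delta>" "\<delta> ` {0..1} \<subseteq> A" and u: "u \<in> A"
  shows "\<bar>algebraic_length c' (\<lambda>t. g t (\<delta> t)) - algebraic_length c' (\<lambda>t. g t u)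
    - algebraic_length c \<delta>\<bar> \<le> 2"
proof -
  obtain G where G: "continuous_on ({0..1} \<times> UNIV) (\<lambda>(t, s). G t s)"
    "\<And>t. t \<in> {0..1} \<Longrightarrow> degree_one (G t)"
    "\<And>t s. t \<in> {0..1} \<Longrightarrow> g t (c (circle_point s)) = c' (circle_point (G t s))"
    using family_lift[OF c c' cont lift] by blast
  have L: "algebraic_length c' (\<lambda>t. g t (\<epsilon> t)) = G 1 (e 1) - G 0 (e 0)" if e: "path_lift c \<epsilon> e" for \<epsilon> e
  proof -
    have "continuous_on {0..1} (\<lambda>t. G t (e t))"
      using continuous_on_compose2[OF G(1), of "{0..1}" "\<lambda>t. (t, e t)"] e
      by (simp add: path_lift_def continuous_on_Pair image_subset_iff)
    then have "path_lift c' (\<lambda>t. g t (\<epsilon> t)) (\<lambda>t. G t (e t))"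
      using e G(3) unfolding path_lift_def by auto
    then show ?thesis by (rule algebraic_length_eq[OF circle_parametrization_inj[OF c']])
  qed
  obtain d where d: "path_lift c \<delta> d" using path_lift_exists[OF c \<delta>] by blast
  obtain s where "u = c (circle_point s)" using circle_parametrization_point[OF c u] by blast
  then have s: "path_lift c (\<lambda>_. u) (\<lambda>_. s)" by (simp add: path_lift_def)
  have "algebraic_length c \<delta> = d 1 - d 0"
    by (rule algebraic_length_eq[OF circle_parametrization_inj[OF c] d])
  then show ?thesis
    using L[OF d] L[OF s] degree_one_osc[OF G(2)[of 0], of "d 0" s]
      degree_one_osc[OF G(2)[of 1], of "d 1" s]
    by auto
qed

text \<open>Points of the circle at distance less than 1 are never antipodal, so the difference of
  the two lifts avoids all half-integers and by connectedness stays between two consecutive ones.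
  Only circle coordinates are compared, which is why \<open>c\<close> and \<open>c'\<close> may
  parametrize different fibres.\<close>

lemma algebraic_length_close:
  fixes \<zeta> \<zeta>' :: "real \<Rightarrow> complex"
  assumes c: "inj_on c circle" and c': "inj_on c' circle"
    and \<zeta>: "continuous_on {0..1} \<zeta>" "\<zeta> ` {0..1} \<subseteq> circle"
    and \<zeta>': "continuous_on {0..1} \<zeta>'" "\<zeta>' ` {0..1} \<subseteq> circle"
    and close: "\<And>t. t \<in> {0..1} \<Longrightarrow> dist (\<zeta> t) (\<zeta>' t) < 1"
  shows "\<bar>algebraic_length c (\<lambda>t. c (\<zeta> t)) - algebraic_length c' (\<lambda>t. c' (\<zeta>' t))\<bar> \<le> 1"
proof -
  obtain g where g: "continuous_on {0..1} g" "\<And>t. t \<in> {0..1} \<Longrightarrow> \<zeta> t = circle_point (g t)"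
    using circle_lift_exists[OF \<zeta>(1) _ \<zeta>(2)] by auto
  obtain g' where g': "continuous_on {0..1} g'" "\<And>t. t \<in> {0..1} \<Longrightarrow> \<zeta>' t = circle_point (g' t)"
    using circle_lift_exists[OF \<zeta>'(1) _ \<zeta>'(2)] by auto
  have 1: "algebraic_length c (\<lambda>t. c (\<zeta> t)) = g 1 - g 0"
    by (rule algebraic_length_eq[OF c]) (use g in \<open>auto simp: path_lift_def\<close>)
  have 2: "algebraic_length c' (\<lambda>t. c' (\<zeta>' t)) = g' 1 - g' 0"
    by (rule algebraic_length_eq[OF c']) (use g' in \<open>auto simp: path_lift_def\<close>)
  define h where "h = (\<lambda>t. g t - g' t - (g 0 - g' 0))"
  have half: "g t - g' t - 1/2 \<notin> \<int>" if "t \<in> {0..1}" for t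
  proof
    assume "g t - g' t - 1/2 \<in> \<int>"
    then have "circle_point (g t) = circle_point (g' t + 1/2)"
      by (simp add: circle_point_eq_iff algebra_simps)
    also have "\<dots> = - circle_point (g' t)"
      by (simp add: circle_point_def distrib_left cis_mult[symmetric])
    finally have "dist (\<zeta> t) (\<zeta>' t) = norm (- (circle_point (g' t) + circle_point (g' t)))"
      using g(2) g'(2) that by (simp add: dist_norm)
    also have "\<dots> = 2" by (simp only: norm_minus_cancel mult_2[symmetric] norm_mult) (simp add: circle_point_def)
    finally show False using close[OF that] by simp
  qed
  have "\<bar>(g 1 - g' 1) - (g 0 - g' 0)\<bar> \<le> 1"
  proof (rule ccontr)
    assume n: "\<not> ?thesis"
    let ?d = "\<lambda>t. g t - g' t - 1/2"
    have cd: "continuous_on {0..1} ?d" using g(1) g'(1) by (intro continuous_intros)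
    have conn: "connected (?d ` {0..1})" using cd by (intro connected_continuous_image) auto
    \<comment> \<open>The integer \<open>\<lfloor>?m\<rfloor> + 1\<close> lies between the two end
      values of \<open>?d\<close> as soon as these are more than 1 apart.\<close>
    let ?m = "min (?d 0) (?d 1)"
    have "\<exists>t\<in>{0..1}. ?d t = of_int (\<lfloor>?m\<rfloor> + 1)"
    proof -
      have le: "?m \<le> of_int (\<lfloor>?m\<rfloor> + 1)" "of_int (\<lfloor>?m\<rfloor> + 1) \<le> max (?d 0) (?d 1)"
        using n by linarith+
      have mem: "?m \<in> ?d ` {0..1}" "max (?d 0) (?d 1) \<in> ?d ` {0..1}"
        by (auto simp: min_def max_def)
      have "of_int (\<lfloor>?m\<rfloor> + 1) \<in> ?d ` {0..1}"
        using connectedD_interval[OF conn mem le] .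
      then show ?thesis by (metis (mono_tags, lifting) imageE)
    qed
    then obtain t where "t \<in> {0..1}" "?d t = of_int (\<lfloor>?m\<rfloor> + 1)" by blast
    then show False using half[of t] by (metis Ints_of_int)
  qed
  then show ?thesis using 1 2 by linarith
qed

section \<open>Quasi-cocycles\<close>

lemma compact_UNIV_bounded:
  fixes f :: "'x::topological_space \<Rightarrow> real"
  assumes "compact (UNIV :: 'x set)" "continuous_on UNIV f"
  shows "\<exists>C\<ge>0. \<forall>x. \<bar>f x\<bar> \<le> C"
proof -
  have "bounded (range f)" using compact_continuous_image[OF assms(2,1)] compact_imp_bounded by blast
  then obtain C where "\<forall>x. norm (f x) \<le> C" by (auto simp: bounded_iff)
  moreover from this have "C \<ge> 0" using norm_ge_zero order_trans by blast
  ultimately show ?thesis by auto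
qed

text \<open>Sample values of \<open>A\<close> are averaged with a finite partition of unity. A
  weight is nonzero at \<open>x\<close> only if \<open>x\<close> lies in the corresponding
  neighbourhood, where the sample value is within \<open>K\<close> of \<open>A x\<close>; so a
  convex combination is within \<open>K\<close> as well, although \<open>A\<close> itself may be
  discontinuous.\<close>

lemma continuous_approximation_of_locally_bounded_oscillation:
  fixes A :: "'x::metric_space \<Rightarrow> real"
  assumes cpt: "compact (UNIV :: 'x set)"
    and osc: "\<And>x. eventually (\<lambda>y. \<bar>A y - A x\<bar> \<le> K) (nhds x)"
  shows "\<exists>a. continuous_on UNIV a \<and> (\<forall>x. \<bar>a x - A x\<bar> \<le> K)"
proof -
  have "\<exists>U. open U \<and> x \<in> U \<and> (\<forall>y\<in>U. \<bar>A y - A x\<bar> \<le> K)" for x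
    using osc[of x] unfolding eventually_nhds by blast
  then obtain U where U: "\<And>x. open (U x)" "\<And>x. x \<in> U x" "\<And>x y. y \<in> U x \<Longrightarrow> \<bar>A y - A x\<bar> \<le> K"
    by metis
  obtain D where D: "finite D" "UNIV \<subseteq> (\<Union>x\<in>D. U x)"
  proof (rule compactE_image[OF cpt, of UNIV U])
    show "open (U x)" for x by (rule U)
    show "UNIV \<subseteq> (\<Union>x\<in>UNIV. U x)" using U(2) by auto
  qed
  define \<C> where "\<C> = U ` D"
  have fin: "finite \<C>" using D by (simp add: \<C>_def)
  obtain F :: "'x set \<Rightarrow> 'x \<Rightarrow> real" where
    F1: "\<And>V. V \<in> \<C> \<Longrightarrow> continuous_on UNIV (F V) \<and> (\<forall>x\<in>UNIV. 0 \<le> F V x)" and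
    F2: "\<And>x V. V \<in> \<C> \<Longrightarrow> x \<in> UNIV \<Longrightarrow> x \<notin> V \<Longrightarrow> F V x = 0" and
    F3: "\<And>x. x \<in> UNIV \<Longrightarrow> supp_sum (\<lambda>W. F W x) \<C> = 1"
  proof (rule subordinate_partition_of_unity[of UNIV \<C>])
    show "UNIV \<subseteq> \<Union>\<C>" using D by (simp add: \<C>_def)
    show "open V" if "V \<in> \<C>" for V using that U by (auto simp: \<C>_def)
    show "\<exists>V. open V \<and> x \<in> V \<and> finite {W \<in> \<C>. W \<inter> V \<noteq> {}}" for x
      using fin by (intro exI[of _ UNIV]) auto
  qed (rule that, assumption+)
  have sum1: "(\<Sum>V\<in>\<C>. F V x) = 1" for x
  proof -
    have "(\<Sum>V\<in>\<C>. F V x) = (\<Sum>V\<in>{V\<in>\<C>. F V x \<noteq> 0}. F V x)"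
      using fin by (intro sum.mono_neutral_right) auto
    then show ?thesis using F3[of x] by (simp add: supp_sum_def support_on_def)
  qed
  have "\<forall>V\<in>\<C>. \<exists>z. \<forall>y\<in>V. \<bar>A y - A z\<bar> \<le> K" using U(3) unfolding \<C>_def by blast
  then obtain z where z: "\<And>V y. V \<in> \<C> \<Longrightarrow> y \<in> V \<Longrightarrow> \<bar>A y - A (z V)\<bar> \<le> K" by metis
  define a where "a = (\<lambda>x. \<Sum>V\<in>\<C>. F V x * A (z V))"
  have "continuous_on UNIV a" unfolding a_def using F1 by (intro continuous_intros) auto
  moreover have "\<bar>a x - A x\<bar> \<le> K" for x
  proof -
    have "a x - A x = (\<Sum>V\<in>\<C>. F V x * A (z V)) - (\<Sum>V\<in>\<C>. F V x) * A x"
      by (simp add: a_def sum1)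
    also have "\<dots> = (\<Sum>V\<in>\<C>. F V x * (A (z V) - A x))"
      by (simp add: sum_distrib_right sum_subtractf right_diff_distrib)
    finally have "\<bar>a x - A x\<bar> \<le> (\<Sum>V\<in>\<C>. \<bar>F V x * (A (z V) - A x)\<bar>)"
      by (simp add: sum_abs)
    also have "\<dots> \<le> (\<Sum>V\<in>\<C>. F V x * K)"
    proof (rule sum_mono)
      fix V assume V: "V \<in> \<C>"
      show "\<bar>F V x * (A (z V) - A x)\<bar> \<le> F V x * K"
      proof (cases "x \<in> V")
        case True
        have "\<bar>A (z V) - A x\<bar> \<le> K" using z[OF V True] by linarith
        then show ?thesis using F1[OF V] by (simp add: abs_mult mult_left_mono)
      next
        case False
        then show ?thesis using F2[OF V] by simp
      qed
    qed
    also have "\<dots> = K" by (simp add: sum_distrib_right[symmetric] sum1)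
    finally show ?thesis .
  qed
  ultimately show ?thesis by blast
qed

lemma divide_le_self: "0 \<le> x \<Longrightarrow> 1 \<le> y \<Longrightarrow> x / y \<le> (x::real)"
  using divide_left_mono[of 1 y x] by simp

lemma bounded_difference_averages:
  fixes f g :: "nat \<Rightarrow> real"
  assumes "\<And>n. \<bar>f n - g n\<bar> \<le> M"
  shows "(\<lambda>n. f n / real n - g n / real n) \<longlonglongrightarrow> 0"
    and "(\<lambda>n. f n / real n) \<longlonglongrightarrow> r \<longleftrightarrow> (\<lambda>n. g n / real n) \<longlonglongrightarrow> r"
proof -
  show d: "(\<lambda>n. f n / real n - g n / real n) \<longlonglongrightarrow> 0"
  proof (rule Lim_null_comparison)
    show "(\<lambda>n. M / real n) \<longlonglongrightarrow> 0" by (rule lim_const_over_n)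
    show "\<forall>\<^sub>F n in sequentially. norm (f n / real n - g n / real n) \<le> M / real n"
      using assms by (intro always_eventually allI)
        (simp add: diff_divide_distrib[symmetric] divide_right_mono)
  qed
  show "(\<lambda>n. f n / real n) \<longlonglongrightarrow> r \<longleftrightarrow> (\<lambda>n. g n / real n) \<longlonglongrightarrow> r"
    using tendsto_diff[OF _ d, of "\<lambda>n. f n / real n" r] tendsto_add[OF d, of "\<lambda>n. g n / real n" r]
    by auto
qed

section \<open>Birkhoff sums and quasi-additive sequences of functions\<close>

definition birkhoff_sum :: "('x \<Rightarrow> 'x) \<Rightarrow> ('x \<Rightarrow> real) \<Rightarrow> nat \<Rightarrow> 'x \<Rightarrow> real" where
  "birkhoff_sum T f n x = (\<Sum>i<n. f ((T ^^ i) x))"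

lemma birkhoff_sum_Suc: "birkhoff_sum T f (Suc n) x = f x + birkhoff_sum T f n (T x)"
  unfolding birkhoff_sum_def by (subst sum.lessThan_Suc_shift) (simp add: funpow_swap1)

text \<open>With \<open>S k\<close> the sum of the first \<open>k\<close> values, both sides equal
  \<open>S (n + m) - S n - S m\<close>. The point is to trade a sum of length \<open>n\<close> for
  one of fixed length \<open>m\<close>.\<close>

lemma sum_shift_telescope:
  fixes g :: "nat \<Rightarrow> real"
  shows "(\<Sum>i<n. g (i + m) - g i) = (\<Sum>j<m. g (n + j) - g j)"
proof (induction m)
  case (Suc m)
  have "(\<Sum>i<n. g (i + Suc m) - g i) = (\<Sum>i<n. g (Suc (i + m)) - g (i + m)) + (\<Sum>i<n. g (i + m) - g i)"
    by (simp add: sum.distrib[symmetric])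
  also have "(\<Sum>i<n. g (Suc (i + m)) - g (i + m)) = g (n + m) - g m"
    using sum_lessThan_telescope[of "\<lambda>i. g (i + m)" n] by simp
  finally show ?case using Suc by simp
qed simp

text \<open>The difference of \<open>f\<close> and its composite with \<open>T ^^ m\<close> is a
  coboundary: after the exchange of \<open>n\<close> and \<open>m\<close> only \<open>m\<close>
  terms remain, so the bound is uniform in \<open>n\<close>.\<close>

lemma birkhoff_sum_shift_bound:
  assumes "\<And>x. \<bar>f x\<bar> \<le> C"
  shows "\<bar>birkhoff_sum T (\<lambda>x. f ((T ^^ m) x)) n x - birkhoff_sum T f n x\<bar> \<le> real m * (2 * C)"
proof -
  have "birkhoff_sum T (\<lambda>x. f ((T ^^ m) x)) n x - birkhoff_sum T f n x
    = (\<Sum>i<n. f ((T ^^ (i + m)) x) - f ((T ^^ i) x))"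
    unfolding birkhoff_sum_def sum_subtractf
    by (simp add: funpow_add add.commute[of _ m])
  also have "\<dots> = (\<Sum>j<m. f ((T ^^ (n + j)) x) - f ((T ^^ j) x))"
    by (rule sum_shift_telescope)
  also have "\<bar>\<dots>\<bar> \<le> (\<Sum>j<m. 2 * C)"
  proof (rule order_trans[OF sum_abs], rule sum_mono)
    show "\<bar>f ((T ^^ (n + j)) x) - f ((T ^^ j) x)\<bar> \<le> 2 * C" for j
      using assms[of "(T ^^ (n + j)) x"] assms[of "(T ^^ j) x"] by linarith
  qed
  finally show ?thesis by simp
qed

text \<open>
  The correction terms \<open>e i\<close> are bounded by the defect, so halving them makes the series converge;
  the remaining difference between consecutive stages is a coboundary.
\<close>

lemma quasi_cocycle_birkhoff_sums:
  fixes a :: "nat \<Rightarrow> 'x::topological_space \<Rightarrow> real"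
  assumes cpt: "compact (UNIV :: 'x set)" and T: "continuous_on UNIV T"
    and a: "\<And>n. continuous_on UNIV (a n)"
    and K: "\<And>n m x. \<bar>a (n + m) x - a n x - a m ((T ^^ n) x)\<bar> \<le> K"
  shows "\<exists>b. continuous_on UNIV b \<and>
    (\<forall>x. (\<lambda>n. a n x / real n - birkhoff_sum T b n x / real n) \<longlonglongrightarrow> 0)"
proof -
  have K0: "K \<ge> 0" using K[of 0 0 undefined] by linarith
  have Tn: "continuous_on UNIV (T ^^ n)" for n
    by (induction n) (auto intro: continuous_on_compose2[OF T] simp: id_def)
  obtain C where C0: "\<And>n. C n \<ge> 0" and C: "\<And>n x. \<bar>a n x\<bar> \<le> C n"
    using compact_UNIV_bounded[OF cpt a] by metis
  \<comment> \<open>Along the orbit, \<open>a m ((T ^^ i) x)\<close> is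
    \<open>a (i + m) x - a i x\<close> up to \<open>K\<close>, so the sum over \<open>i < n\<close>
    telescopes up to \<open>n * K\<close>. Exchanging \<open>n\<close> and \<open>m\<close> leaves
    \<open>m\<close> differences \<open>a (n + j) x - a j x\<close>, each equal to
    \<open>a n x\<close> up to a bound free of \<open>n\<close>.\<close>
  have step1: "\<bar>birkhoff_sum T (a m) n x - real m * a n x\<bar> \<le> real n * K + (\<Sum>j<m. K + 2 * C j)" for m n x
  proof -
    have "birkhoff_sum T (a m) n x - (\<Sum>i<n. a (i + m) x - a i x)
      = (\<Sum>i<n. - (a (i + m) x - a i x - a m ((T ^^ i) x)))"
      unfolding birkhoff_sum_def sum_subtractf[symmetric] by (rule sum.cong) auto
    also have "\<bar>\<dots>\<bar> \<le> (\<Sum>i<n. K)"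
      by (rule order_trans[OF sum_abs], rule sum_mono) (simp only: abs_minus_cancel K)
    finally have 1: "\<bar>birkhoff_sum T (a m) n x - (\<Sum>i<n. a (i + m) x - a i x)\<bar> \<le> real n * K" by simp
    have "(\<Sum>j<m. a (n + j) x - a j x) - real m * a n x = (\<Sum>j<m. a (n + j) x - a j x - a n x)"
      by (simp add: sum_subtractf)
    also have "\<bar>\<dots>\<bar> \<le> (\<Sum>j<m. K + 2 * C j)"
    proof (rule order_trans[OF sum_abs], rule sum_mono)
      show "\<bar>a (n + j) x - a j x - a n x\<bar> \<le> K + 2 * C j" for j
        using K[of n j x] C[of j x] C[of j "(T ^^ n) x"] by linarith
    qed
    finally show ?thesis using 1 sum_shift_telescope[of "\<lambda>i. a i x" m n] by linarith
  qed
  define e where "e = (\<lambda>i x. a (2 ^ i + 2 ^ i) x - a (2 ^ i) x - a (2 ^ i) ((T ^^ (2 ^ i)) x))"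
  have e_cont: "continuous_on UNIV (e i)" for i
    unfolding e_def by (intro continuous_intros a continuous_on_compose2[OF a Tn]) auto
  have e_bd: "\<bar>e i x\<bar> \<le> K" for i x unfolding e_def by (rule K)
  \<comment> \<open>\<open>\<beta> j\<close> is built to be cohomologous to
    \<open>a (2 ^ j) / 2 ^ j\<close>: by definition of \<open>e\<close>,
    \<open>a (2 ^ Suc j)\<close> is \<open>e j\<close> plus \<open>a (2 ^ j)\<close> plus its
    composite with \<open>T ^^ (2 ^ j)\<close>, and up to a coboundary the last two terms are twice
    \<open>a (2 ^ j)\<close>.\<close>
  define \<beta> where "\<beta> = (\<lambda>j x. a 1 x + (\<Sum>i<j. e i x / 2 ^ Suc i))"
  define b where "b = (\<lambda>x. a 1 x + (\<Sum>i. e i x / 2 ^ Suc i))"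
  have geo: "(\<lambda>i. K / 2 ^ Suc i) sums K"
  proof -
    have "(\<lambda>i. K / 2 ^ Suc i) = (\<lambda>i. K * (1 / 2) ^ Suc i)"
      by (simp add: power_one_over del: power_Suc)
    then show ?thesis using sums_mult[OF power_half_series, of K] by simp
  qed
  have term_bd: "norm (e i x / 2 ^ Suc i) \<le> K / 2 ^ Suc i" for i x
    using e_bd[of i x] by (simp add: divide_right_mono)
  have summ: "summable (\<lambda>i. e i x / 2 ^ Suc i)" for x
    by (rule summable_comparison_test'[OF sums_summable[OF geo], of 0]) (rule term_bd)
  have b\<beta>: "\<bar>b x - \<beta> j x\<bar> \<le> K / 2 ^ j" for x j
  proof -
    have "b x - \<beta> j x = (\<Sum>i. e (i + j) x / 2 ^ Suc (i + j))"
      unfolding b_def \<beta>_def using suminf_minus_initial_segment[OF summ[of x], of j] by simp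
    also have "norm \<dots> \<le> (\<Sum>i. K / 2 ^ Suc (i + j))"
      using summ[of x] sums_summable[OF geo] term_bd
      by (intro norm_suminf_le) (auto simp del: power_Suc intro: summable_ignore_initial_segment)
    also have "(\<Sum>i. K / 2 ^ Suc (i + j)) = K / 2 ^ j"
      using sums_unique[OF sums_divide[OF geo, of "2 ^ j"]] by (simp add: power_add field_simps)
    finally show ?thesis by simp
  qed
  have b_cont: "continuous_on UNIV b"
  proof -
    have "uniform_limit UNIV (\<lambda>n x. \<Sum>i<n. e i x / 2 ^ Suc i) (\<lambda>x. \<Sum>i. e i x / 2 ^ Suc i) sequentially"
      by (rule Weierstrass_m_test[OF term_bd sums_summable[OF geo]])
    then have "continuous_on UNIV (\<lambda>x. \<Sum>i. e i x / 2 ^ Suc i)"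
      by (rule uniform_limit_theorem[rotated])
        (auto intro!: always_eventually continuous_on_sum continuous_on_divide e_cont continuous_on_const)
    then show ?thesis unfolding b_def by (intro continuous_intros a)
  qed
  \<comment> \<open>One step from \<open>j\<close> to \<open>Suc j\<close> replaces a shifted
    Birkhoff sum by the unshifted one, at a cost that grows with \<open>j\<close> but does not
    depend on \<open>n\<close>; hence a constant for each \<open>j\<close> suffices.\<close>
  have step2: "\<exists>c\<ge>0. \<forall>n x. \<bar>birkhoff_sum T (\<beta> j) n x - birkhoff_sum T (a (2 ^ j)) n x / 2 ^ j\<bar> \<le> c" for j
  proof (induction j)
    case 0
    show ?case by (intro exI[of _ 0]) (simp add: \<beta>_def)
  next
    case (Suc j)
    then obtain c where c: "c \<ge> 0"
      "\<And>n x. \<bar>birkhoff_sum T (\<beta> j) n x - birkhoff_sum T (a (2 ^ j)) n x / 2 ^ j\<bar> \<le> c" by blast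
    have "\<bar>birkhoff_sum T (\<beta> (Suc j)) n x - birkhoff_sum T (a (2 ^ Suc j)) n x / 2 ^ Suc j\<bar>
      \<le> c + 2 ^ j * (2 * C (2 ^ j))" for n x
    proof -
      let ?s = "birkhoff_sum T (\<lambda>x. a (2 ^ j) ((T ^^ (2 ^ j)) x)) n x"
      have "birkhoff_sum T (\<beta> (Suc j)) n x = birkhoff_sum T (\<beta> j) n x + birkhoff_sum T (e j) n x / 2 ^ Suc j"
        by (simp add: birkhoff_sum_def \<beta>_def sum.distrib sum_divide_distrib)
      moreover have "birkhoff_sum T (e j) n x
        = birkhoff_sum T (a (2 ^ Suc j)) n x - birkhoff_sum T (a (2 ^ j)) n x - ?s"
        by (simp add: birkhoff_sum_def e_def sum_subtractf mult_2)
      moreover have "birkhoff_sum T (a (2 ^ j)) n x / 2 ^ j = 2 * (birkhoff_sum T (a (2 ^ j)) n x / 2 ^ Suc j)"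
        by simp
      ultimately have "birkhoff_sum T (\<beta> (Suc j)) n x - birkhoff_sum T (a (2 ^ Suc j)) n x / 2 ^ Suc j
        = (birkhoff_sum T (\<beta> j) n x - birkhoff_sum T (a (2 ^ j)) n x / 2 ^ j)
          - (?s - birkhoff_sum T (a (2 ^ j)) n x) / 2 ^ Suc j"
        unfolding diff_divide_distrib by (smt (verit) diff_divide_distrib)
      moreover have "\<bar>(?s - birkhoff_sum T (a (2 ^ j)) n x) / 2 ^ Suc j\<bar> \<le> 2 ^ j * (2 * C (2 ^ j))"
      proof -
        have "\<bar>?s - birkhoff_sum T (a (2 ^ j)) n x\<bar> \<le> 2 ^ j * (2 * C (2 ^ j))"
          using birkhoff_sum_shift_bound[of "a (2 ^ j)" "C (2 ^ j)" T "2 ^ j" n x] C by simp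
        moreover have "\<bar>?s - birkhoff_sum T (a (2 ^ j)) n x\<bar> / 2 ^ Suc j \<le> \<bar>?s - birkhoff_sum T (a (2 ^ j)) n x\<bar>"
          by (intro divide_le_self one_le_power) auto
        ultimately show ?thesis by (simp add: abs_divide)
      qed
      ultimately show ?thesis using c(2)[where n = n and x = x] by linarith
    qed
    then show ?case using c(1) C0[of "2 ^ j"] by (intro exI[of _ "c + 2 ^ j * (2 * C (2 ^ j))"]) auto
  qed
  have "(\<lambda>n. a n x / real n - birkhoff_sum T b n x / real n) \<longlonglongrightarrow> 0" for x
  proof (rule LIMSEQ_I)
    fix r :: real assume r: "r > 0"
    \<comment> \<open>Half of the slope \<open>2 * K * (1 / 2) ^ j\<close> comes from replacing
      \<open>b\<close> by \<open>\<beta> j\<close>, the other half from \<open>step1\<close> divided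
      by \<open>2 ^ j\<close>. First \<open>j\<close> is fixed to make the slope small; the
      remaining error \<open>d\<close> depends on \<open>j\<close> only and disappears after
      division by a large \<open>n\<close>.\<close>
    have "(\<lambda>j. 2 * K * (1 / 2) ^ j) \<longlonglongrightarrow> 2 * K * 0"
      by (intro tendsto_intros LIMSEQ_power_zero) auto
    then have "eventually (\<lambda>j. 2 * K * (1 / 2) ^ j < r / 2) sequentially"
      using r by (intro order_tendstoD(2)) auto
    then obtain j where j: "2 * K * (1 / 2) ^ j < r / 2" by (auto dest: eventually_happens)
    obtain c where c: "c \<ge> 0"
      "\<And>n x. \<bar>birkhoff_sum T (\<beta> j) n x - birkhoff_sum T (a (2 ^ j)) n x / 2 ^ j\<bar> \<le> c"
      using step2 by blast
    define d where "d = c + (\<Sum>i<2 ^ j. K + 2 * C i)"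
    have d0: "d \<ge> 0" unfolding d_def using c(1) K0 C0 by (intro add_nonneg_nonneg sum_nonneg) auto
    obtain N :: nat where N: "N > 2 * d / r" using reals_Archimedean2 by blast
    have bound: "\<bar>a n x - birkhoff_sum T b n x\<bar> \<le> real n * (2 * K * (1 / 2) ^ j) + d" for n
    proof -
      have "birkhoff_sum T b n x - birkhoff_sum T (\<beta> j) n x = (\<Sum>i<n. b ((T ^^ i) x) - \<beta> j ((T ^^ i) x))"
        by (simp add: birkhoff_sum_def sum_subtractf)
      also have "\<bar>\<dots>\<bar> \<le> (\<Sum>i<n. K / 2 ^ j)"
        by (rule order_trans[OF sum_abs], rule sum_mono) (rule b\<beta>)
      finally have 1: "\<bar>birkhoff_sum T b n x - birkhoff_sum T (\<beta> j) n x\<bar> \<le> real n * (K * (1 / 2) ^ j)"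
        by (simp add: power_one_over divide_simps)
      have "\<bar>birkhoff_sum T (a (2 ^ j)) n x / 2 ^ j - a n x\<bar>
        = \<bar>birkhoff_sum T (a (2 ^ j)) n x - real (2 ^ j) * a n x\<bar> / 2 ^ j"
      proof -
        have "birkhoff_sum T (a (2 ^ j)) n x / 2 ^ j - a n x
          = (birkhoff_sum T (a (2 ^ j)) n x - real (2 ^ j) * a n x) / 2 ^ j"
          by (simp add: diff_divide_distrib)
        then show ?thesis by (simp only: abs_divide) simp
      qed
      also have "\<dots> \<le> (real n * K + (\<Sum>i<2 ^ j. K + 2 * C i)) / 2 ^ j"
        by (intro divide_right_mono step1) auto
      also have "\<dots> = real n * (K * (1 / 2) ^ j) + (\<Sum>i<2 ^ j. K + 2 * C i) / 2 ^ j"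
        by (simp add: add_divide_distrib power_one_over)
      also have "(\<Sum>i<2 ^ j. K + 2 * C i) / 2 ^ j \<le> (\<Sum>i<2 ^ j. K + 2 * C i)"
      proof -
        have "0 \<le> (\<Sum>i<2 ^ j. K + 2 * C i)" using K0 C0 by (intro sum_nonneg) auto
        moreover have "(1::real) \<le> 2 ^ j" by simp
        ultimately show ?thesis by (rule divide_le_self)
      qed
      finally show ?thesis using 1 c(2)[of n x] unfolding d_def by (simp add: algebra_simps)
    qed
    show "\<exists>no. \<forall>n\<ge>no. norm (a n x / real n - birkhoff_sum T b n x / real n - 0) < r"
    proof (intro exI[of _ "Suc N"] allI impI)
      fix n assume n: "n \<ge> Suc N"
      then have n0: "real n > 0" by simp
      have "2 * d / r < real n" using N n by linarith
      then have "d / real n < r / 2" using r n0 by (simp add: field_simps)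
      moreover have "\<bar>a n x - birkhoff_sum T b n x\<bar> / real n \<le> 2 * K * (1 / 2) ^ j + d / real n"
        using divide_right_mono[OF bound[of n], of "real n"] n0 by (simp add: add_divide_distrib)
      ultimately have "\<bar>a n x - birkhoff_sum T b n x\<bar> / real n < r" using j by linarith
      then show "norm (a n x / real n - birkhoff_sum T b n x / real n - 0) < r"
        using n0 by (simp add: diff_divide_distrib[symmetric])
    qed
  qed
  then show ?thesis using b_cont by blast
qed

section \<open>Birkhoff's theorem for bounded functions\<close>

definition birkhoff_converges :: "('x \<Rightarrow> 'x) \<Rightarrow> ('x \<Rightarrow> real) \<Rightarrow> 'x \<Rightarrow> bool" where
  "birkhoff_converges T f x \<longleftrightarrow> convergent (\<lambda>n. birkhoff_sum T f n x / real n)"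

text \<open>The default 0 is that of \<open>rotation_number\<close>, so that the two functions agree
  everywhere and not merely where the limit exists.\<close>

definition birkhoff_limit :: "('x \<Rightarrow> 'x) \<Rightarrow> ('x \<Rightarrow> real) \<Rightarrow> 'x \<Rightarrow> real" where
  "birkhoff_limit T f x =
    (if birkhoff_converges T f x then lim (\<lambda>n. birkhoff_sum T f n x / real n) else 0)"

lemma birkhoff_sum_bound:
  assumes "\<And>x. \<bar>f x\<bar> \<le> B"
  shows "\<bar>birkhoff_sum T f n x\<bar> \<le> real n * B"
proof -
  have "\<bar>birkhoff_sum T f n x\<bar> \<le> (\<Sum>i<n. B)"
    unfolding birkhoff_sum_def by (rule order_trans[OF sum_abs], rule sum_mono) (rule assms)
  then show ?thesis by simp
qed

lemma birkhoff_average_bound: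
  assumes "\<And>x. \<bar>f x\<bar> \<le> B" "B \<ge> 0"
  shows "\<bar>birkhoff_sum T f n x / real n\<bar> \<le> B"
  using birkhoff_sum_bound[of f B T n x] assms by (cases "n = 0") (auto simp: field_simps)

lemma birkhoff_sum_shift_difference:
  assumes "\<And>x. \<bar>f x\<bar> \<le> B"
  shows "\<bar>birkhoff_sum T f n (T x) - birkhoff_sum T f n x\<bar> \<le> 2 * B"
  using birkhoff_sum_shift_bound[of f B T 1 n x] assms by (simp add: birkhoff_sum_def funpow_swap1)

text \<open>Starting one step later changes a Birkhoff sum by two boundary terms only, which vanish
  in the average; so even the set of convergence is invariant.\<close>

lemma birkhoff_limit_invariant:
  assumes "\<And>x. \<bar>f x\<bar> \<le> B"
  shows "birkhoff_converges T f (T x) \<longleftrightarrow> birkhoff_converges T f x"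
    and "birkhoff_limit T f (T x) = birkhoff_limit T f x"
proof -
  have "(\<lambda>n. birkhoff_sum T f n (T x) / real n) \<longlonglongrightarrow> r \<longleftrightarrow> (\<lambda>n. birkhoff_sum T f n x / real n) \<longlonglongrightarrow> r" for r
    by (rule bounded_difference_averages(2)[OF birkhoff_sum_shift_difference[OF assms]])
  then show "birkhoff_converges T f (T x) \<longleftrightarrow> birkhoff_converges T f x"
    "birkhoff_limit T f (T x) = birkhoff_limit T f x"
    unfolding birkhoff_converges_def birkhoff_limit_def convergent_def lim_def by auto
qed

lemma birkhoff_limit_bound:
  assumes "\<And>x. \<bar>f x\<bar> \<le> B" "B \<ge> 0"
  shows "\<bar>birkhoff_limit T f x\<bar> \<le> B"
proof (cases "birkhoff_converges T f x")
  case True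
  then have "(\<lambda>n. birkhoff_sum T f n x / real n) \<longlonglongrightarrow> birkhoff_limit T f x"
    by (simp add: birkhoff_converges_def birkhoff_limit_def convergent_LIMSEQ_iff)
  then show ?thesis
    using tendsto_rabs LIMSEQ_le_const2 birkhoff_average_bound[of f B T _ x] assms by blast
qed (use assms in \<open>simp add: birkhoff_limit_def\<close>)

locale borel_dynamics =
  fixes T :: "'x::topological_space \<Rightarrow> 'x"
  assumes T_measurable: "T \<in> borel_measurable borel"
begin

lemma T_funpow_measurable: "T ^^ n \<in> borel_measurable borel"
  using measurable_compose_n[OF T_measurable] .

lemma birkhoff_sum_measurable:
  "f \<in> borel_measurable borel \<Longrightarrow> birkhoff_sum T f n \<in> borel_measurable borel"
  unfolding birkhoff_sum_def[abs_def]
  by (intro borel_measurable_sum measurable_compose[OF T_funpow_measurable])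

lemma birkhoff_average_measurable:
  "f \<in> borel_measurable borel \<Longrightarrow> (\<lambda>x. birkhoff_sum T f n x / real n) \<in> borel_measurable borel"
  using birkhoff_sum_measurable[of f n] by (intro borel_measurable_divide) auto

lemma birkhoff_converges_sets:
  assumes "f \<in> borel_measurable borel"
  shows "{x. birkhoff_converges T f x} \<in> sets borel"
proof -
  have "{x \<in> space borel. Cauchy (\<lambda>n. birkhoff_sum T f n x / real n)} \<in> sets borel"
    by (rule sets_Collect_Cauchy) (rule birkhoff_average_measurable[OF assms])
  then show ?thesis by (simp add: birkhoff_converges_def Cauchy_convergent_iff)
qed

lemma birkhoff_limit_measurable:
  assumes "f \<in> borel_measurable borel"
  shows "birkhoff_limit T f \<in> borel_measurable borel"
  unfolding birkhoff_limit_def[abs_def]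
  by (intro measurable_If borel_measurable_lim_metric borel_measurable_const
      birkhoff_average_measurable[OF assms])
    (use birkhoff_converges_sets[OF assms] in simp)

end

text \<open>The total mass is arbitrary, possibly 0, because the locale is instantiated with both
  Jordan parts of a signed measure.\<close>

locale invariant_finite_measure = borel_dynamics T + finite_measure M
  for T :: "'x::topological_space \<Rightarrow> 'x" and M :: "'x measure" +
  assumes sets_M: "sets M = sets borel"
    and invariant: "\<And>A. A \<in> sets borel \<Longrightarrow> emeasure M (T -` A) = emeasure M A"
begin

lemma space_M: "space M = UNIV"
  using sets_eq_imp_space_eq[OF sets_M] by simp

lemma measurable_M: "f \<in> borel_measurable borel \<Longrightarrow> f \<in> borel_measurable M"
  using measurable_cong_sets[OF sets_M refl] by blast

lemma bounded_integrable:
  fixes f :: "'x \<Rightarrow> real"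
  assumes "f \<in> borel_measurable borel" "\<And>x. \<bar>f x\<bar> \<le> B"
  shows "integrable M f"
  by (rule integrable_const_bound[of _ B]) (use assms measurable_M in auto)

lemma distr_T: "distr M borel T = M"
proof (rule measure_eqI)
  show "sets (distr M borel T) = sets M" by (simp add: sets_M)
  fix A assume "A \<in> sets (distr M borel T)"
  then have A: "A \<in> sets borel" by simp
  have "T \<in> measurable M borel" using T_measurable measurable_cong_sets[OF sets_M refl] by blast
  then show "emeasure (distr M borel T) A = emeasure M A"
    using A invariant[OF A] by (simp add: emeasure_distr space_M)
qed

lemma integral_T:
  fixes f :: "'x \<Rightarrow> real"
  assumes "f \<in> borel_measurable borel"
  shows "(LINT x|M. f (T x)) = (LINT x|M. f x)"
proof -
  have "T \<in> measurable M borel" using T_measurable measurable_cong_sets[OF sets_M refl] by blast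
  then have "integral\<^sup>L (distr M borel T) f = (LINT x|M. f (T x))"
    by (rule integral_distr) (rule assms)
  then show ?thesis by (simp add: distr_T)
qed

lemma integral_birkhoff_sum:
  fixes f :: "'x \<Rightarrow> real"
  assumes f: "f \<in> borel_measurable borel" and B: "\<And>x. \<bar>f x\<bar> \<le> B"
  shows "(LINT x|M. birkhoff_sum T f n x) = real n * (LINT x|M. f x)"
proof (induction n)
  case 0
  then show ?case by (simp add: birkhoff_sum_def)
next
  case (Suc n)
  have m: "(\<lambda>x. birkhoff_sum T f n (T x)) \<in> borel_measurable borel"
    using measurable_compose[OF T_measurable birkhoff_sum_measurable[OF f]] .
  have "(LINT x|M. birkhoff_sum T f (Suc n) x) = (LINT x|M. f x + birkhoff_sum T f n (T x))"
    by (simp add: birkhoff_sum_Suc)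
  also have "\<dots> = (LINT x|M. f x) + (LINT x|M. birkhoff_sum T f n (T x))"
    by (intro Bochner_Integration.integral_add bounded_integrable[OF f B]
        bounded_integrable[OF m birkhoff_sum_bound[OF B]])
  also have "(LINT x|M. birkhoff_sum T f n (T x)) = (LINT x|M. birkhoff_sum T f n x)"
    by (rule integral_T[OF birkhoff_sum_measurable[OF f]])
  finally show ?case using Suc by (simp add: algebra_simps)
qed

text \<open>Garsia's argument. Where \<open>m n\<close> is positive,
  \<open>m n x \<le> f x + m n (T x)\<close>; elsewhere \<open>m n x = 0 \<le> m n (T x)\<close>.
  Integrating, the two integrals of \<open>m n\<close> cancel by invariance and the integral of
  \<open>f\<close> over \<open>{x. m n x > 0}\<close> is nonnegative. These sets increase to the set
  of the statement.\<close>

lemma maximal_ergodic: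
  fixes f :: "'x \<Rightarrow> real"
  assumes f: "f \<in> borel_measurable borel" and B: "\<And>x. \<bar>f x\<bar> \<le> B"
  shows "0 \<le> (LINT x|M. f x * indicator {x. \<exists>k. birkhoff_sum T f k x > 0} x)"
proof -
  \<comment> \<open>\<open>m n x\<close> is the largest of the sums
    \<open>birkhoff_sum T f k x\<close> with \<open>k \<le> n\<close>, where \<open>k = 0\<close>
    contributes 0. The recursive form gives measurability and the key inequality at once.\<close>
  define m where "m = rec_nat (\<lambda>_. 0) (\<lambda>_ g x. max 0 (f x + g (T x)) :: real)"
  have m0: "m 0 x = 0" and mS: "m (Suc n) x = max 0 (f x + m n (T x))" for n x
    by (simp_all add: m_def)
  have m_meas: "m n \<in> borel_measurable borel" for n
  proof (induction n)
    case (Suc n)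
    have "(\<lambda>x. max 0 (f x + m n (T x))) \<in> borel_measurable borel"
      using f measurable_compose[OF T_measurable Suc] by measurable
    then show ?case by (simp add: mS[abs_def])
  qed (simp add: m0[abs_def])
  have m_nonneg: "m n x \<ge> 0" for n x by (cases n) (auto simp: m0 mS)
  have B0: "B \<ge> 0" using B[of undefined] by linarith
  have m_bd: "\<bar>m n x\<bar> \<le> real n * B" for n x
  proof (induction n arbitrary: x)
    case (Suc n)
    have "\<bar>m n (T x)\<bar> \<le> real n * B" by (rule Suc)
    moreover have "0 \<le> real n * B" using B0 by simp
    moreover have "real (Suc n) * B = real n * B + B" by (simp add: algebra_simps)
    ultimately show ?case unfolding mS using B[of x] B0 by linarith
  qed (simp add: m0)
  have m_mono: "m n x \<le> m (Suc n) x" for n x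
  proof (induction n arbitrary: x)
    case (Suc n)
    show ?case unfolding mS[of "Suc n" x] mS[of n x] by (intro max.mono add_left_mono Suc order_refl)
  qed (simp add: m0 mS)
  have m_mono': "k \<le> n \<Longrightarrow> m k x \<le> m n x" for k n x
    by (rule lift_Suc_mono_le[of "\<lambda>n. m n x"]) (use m_mono in auto)
  have m_ge: "birkhoff_sum T f k x \<le> m n x" if "k \<le> n" for k n x
    using that
  proof (induction n arbitrary: k x)
    case (Suc n)
    then show ?case
    proof (cases k)
      case (Suc j)
      then have "birkhoff_sum T f j (T x) \<le> m n (T x)" using Suc.IH Suc.prems by simp
      then show ?thesis by (simp add: Suc birkhoff_sum_Suc mS max_def)
    qed (simp add: birkhoff_sum_def m_nonneg)
  qed (simp add: birkhoff_sum_def m0)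
  have m_attained: "\<exists>k\<le>n. m n x = birkhoff_sum T f k x" for n x
  proof (induction n arbitrary: x)
    case (Suc n)
    show ?case
    proof (cases "f x + m n (T x) \<ge> 0")
      case True
      obtain k where "k \<le> n" "m n (T x) = birkhoff_sum T f k (T x)" using Suc by blast
      then show ?thesis using True by (intro exI[of _ "Suc k"]) (simp add: mS birkhoff_sum_Suc max_def)
    next
      case False
      then show ?thesis by (intro exI[of _ 0]) (simp add: mS birkhoff_sum_def max_def)
    qed
  qed (simp add: m0 birkhoff_sum_def)
  define E where "E = (\<lambda>n. {x. m n x > 0})"
  have E_sets: "E n \<in> sets borel" for n
    unfolding E_def using borel_measurable_less[OF borel_measurable_const m_meas[of n], of 0] by simp
  have nonneg: "0 \<le> (LINT x|M. f x * indicator (E n) x)" for n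
  proof (cases n)
    case 0
    then show ?thesis by (simp add: E_def m0)
  next
    case (Suc j)
    have mT: "(\<lambda>x. m n (T x)) \<in> borel_measurable borel"
      by (rule measurable_compose[OF T_measurable m_meas])
    have "0 = (LINT x|M. m n x) - (LINT x|M. m n (T x))"
      using integral_T[OF m_meas[of n]] by simp
    also have "\<dots> = (LINT x|M. m n x - m n (T x))"
      by (rule Bochner_Integration.integral_diff[symmetric])
        (rule bounded_integrable[OF m_meas m_bd], rule bounded_integrable[OF mT m_bd])
    also have "\<dots> \<le> (LINT x|M. f x * indicator (E n) x)"
    proof (rule integral_mono)
      have "(\<lambda>x. f x * indicator (E n) x) \<in> borel_measurable borel"
        using f E_sets by measurable
      then show "integrable M (\<lambda>x. f x * indicator (E n) x)"
        by (rule bounded_integrable[of _ B]) (use B B0 in \<open>auto simp: indicator_def\<close>)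
      show "integrable M (\<lambda>x. m n x - m n (T x))"
        by (intro Bochner_Integration.integrable_diff bounded_integrable[OF m_meas m_bd]
            bounded_integrable[OF mT m_bd])
      show "m n x - m n (T x) \<le> f x * indicator (E n) x" for x
      proof (cases "m n x > 0")
        case True
        then have "m n x = f x + m j (T x)" by (simp add: Suc mS max_def split: if_splits)
        then show ?thesis using True m_mono[of j "T x"] by (simp add: E_def Suc)
      next
        case False
        then show ?thesis using m_nonneg[of n "T x"] by (simp add: E_def)
      qed
    qed
    finally show ?thesis .
  qed
  define F where "F = {x. \<exists>k. birkhoff_sum T f k x > 0}"
  have F_eq: "F = (\<Union>n. E n)"
  proof (intro set_eqI iffI)
    fix x assume "x \<in> F"
    then obtain k where "birkhoff_sum T f k x > 0" by (auto simp: F_def)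
    then have "x \<in> E k" using m_ge[of k k x] by (simp add: E_def)
    then show "x \<in> (\<Union>n. E n)" by blast
  next
    fix x assume "x \<in> (\<Union>n. E n)"
    then obtain n where "m n x > 0" by (auto simp: E_def)
    then show "x \<in> F" using m_attained[of n x] by (auto simp: F_def)
  qed
  have "(\<lambda>n. LINT x|M. f x * indicator (E n) x) \<longlonglongrightarrow> (LINT x|M. f x * indicator F x)"
  proof (rule integral_dominated_convergence[where w = "\<lambda>_. B"])
    have "F \<in> sets borel" unfolding F_eq using E_sets by auto
    then have "(\<lambda>x. f x * indicator F x) \<in> borel_measurable borel" using f by measurable
    then show "(\<lambda>x. f x * indicator F x) \<in> borel_measurable M" by (rule measurable_M)
    have "(\<lambda>x. f x * indicator (E n) x) \<in> borel_measurable borel" for n using f E_sets by measurable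
    then show "(\<lambda>x. f x * indicator (E n) x) \<in> borel_measurable M" for n by (rule measurable_M)
    show "integrable M (\<lambda>_. B)" by simp
    show "AE x in M. norm (f x * indicator (E n) x) \<le> B" for n
      using B B0 by (auto simp: indicator_def)
    have "incseq E" unfolding E_def incseq_def using m_mono' by (auto intro: less_le_trans)
    then have "(\<lambda>n. indicator (E n) x :: real) \<longlonglongrightarrow> indicator F x" for x
      unfolding F_eq by (rule LIMSEQ_indicator_incseq)
    then show "AE x in M. (\<lambda>n. f x * indicator (E n) x) \<longlonglongrightarrow> f x * indicator F x"
      by (intro AE_I2 tendsto_mult tendsto_const)
  qed
  then show ?thesis unfolding F_def[symmetric] using LIMSEQ_le_const nonneg by blast
qed

text \<open>On an invariant set the Birkhoff sums of \<open>f * indicator A\<close> are those of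
  \<open>f\<close>, and off it they vanish. So the set of positivity in the maximal inequality is
  exactly \<open>A\<close>.\<close>

lemma ergodic_inequality:
  fixes f :: "'x \<Rightarrow> real"
  assumes f: "f \<in> borel_measurable borel" and B: "\<And>x. \<bar>f x\<bar> \<le> B"
    and A: "A \<in> sets borel" "\<And>x. T x \<in> A \<longleftrightarrow> x \<in> A"
    and gt: "\<And>x. x \<in> A \<Longrightarrow> \<exists>k. birkhoff_sum T f k x > 0"
  shows "0 \<le> (LINT x|M. f x * indicator A x)"
proof -
  let ?g = "\<lambda>x. f x * indicator A x"
  have An: "(T ^^ i) x \<in> A \<longleftrightarrow> x \<in> A" for i x by (induction i) (auto simp: A(2))
  have sum: "birkhoff_sum T ?g k x = birkhoff_sum T f k x * indicator A x" for k x
    by (simp add: birkhoff_sum_def sum_distrib_right An indicator_def)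
  have "{x. \<exists>k. birkhoff_sum T ?g k x > 0} = A"
    unfolding sum using gt by (auto simp: indicator_def split: if_splits)
  moreover have "?g \<in> borel_measurable borel" using f A(1) by measurable
  moreover have "\<bar>?g x\<bar> \<le> B" for x using B[of x] by (auto simp: indicator_def)
  ultimately have "0 \<le> (LINT x|M. ?g x * indicator A x)" using maximal_ergodic[of ?g B] by simp
  moreover have "?g x * indicator A x = ?g x" for x by (simp add: indicator_def)
  ultimately show ?thesis by simp
qed

text \<open>For \<open>\<alpha> < \<beta>\<close> the set where the lower limit is below
  \<open>\<alpha>\<close> and the upper limit above \<open>\<beta>\<close> is invariant. The maximal
  inequality for \<open>f - \<beta>\<close> and for \<open>\<alpha> - f\<close> on it adds up to
  \<open>(\<alpha> - \<beta>) * measure M A \<ge> 0\<close>, so it is null. Rational pairs exhaust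
  the points of divergence.\<close>

lemma birkhoff_converges_AE:
  fixes f :: "'x \<Rightarrow> real"
  assumes f: "f \<in> borel_measurable borel" and B: "\<And>x. \<bar>f x\<bar> \<le> B"
  shows "AE x in M. birkhoff_converges T f x"
proof -
  define u where "u = (\<lambda>n x. ereal (birkhoff_sum T f n x / real n))"
  define lo where "lo = (\<lambda>x. liminf (\<lambda>n. u n x))"
  define hi where "hi = (\<lambda>x. limsup (\<lambda>n. u n x))"
  have B0: "B \<ge> 0" using B[of undefined] by linarith
  have u_meas: "u n \<in> borel_measurable borel" for n
    unfolding u_def using birkhoff_average_measurable[OF f] by measurable
  have meas: "lo \<in> borel_measurable borel" "hi \<in> borel_measurable borel"
    unfolding lo_def hi_def using u_meas by measurable
  have inv: "lo (T x) = lo x" "hi (T x) = hi x" for x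
  proof -
    let ?d = "\<lambda>n. ereal (birkhoff_sum T f n (T x) / real n - birkhoff_sum T f n x / real n)"
    have d: "?d \<longlonglongrightarrow> 0" using bounded_difference_averages(1)[OF birkhoff_sum_shift_difference[where T = T and x = x, OF B]]
      by (simp add: zero_ereal_def)
    have eq: "u n (T x) = ?d n + u n x" for n by (simp add: u_def)
    show "lo (T x) = lo x" unfolding lo_def eq using ereal_liminf_lim_add[OF d] by simp
    show "hi (T x) = hi x" unfolding hi_def eq using ereal_limsup_lim_add[OF d] by simp
  qed
  have null: "AE x in M. \<not> (lo x < ereal \<alpha> \<and> ereal \<beta> < hi x)" if "\<alpha> < \<beta>" for \<alpha> \<beta>
  proof -
    define A where "A = {x. lo x < ereal \<alpha> \<and> ereal \<beta> < hi x}"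
    have A: "A \<in> sets borel" unfolding A_def using meas by measurable
    have Ainv: "T x \<in> A \<longleftrightarrow> x \<in> A" for x by (simp add: A_def inv)
    have sum_const: "birkhoff_sum T (\<lambda>x. f x - c) k x = birkhoff_sum T f k x - real k * c"
      "birkhoff_sum T (\<lambda>x. c - f x) k x = real k * c - birkhoff_sum T f k x" for c k x
      by (simp_all add: birkhoff_sum_def sum_subtractf)
    have upper: "\<exists>k. birkhoff_sum T (\<lambda>x. f x - \<beta>) k x > 0" if "x \<in> A" for x
    proof -
      have "\<exists>\<^sub>F k in sequentially. ereal \<beta> < u k x"
      proof (rule ccontr)
        assume "\<not> ?thesis"
        then have "\<forall>\<^sub>F k in sequentially. u k x \<le> ereal \<beta>" by (simp add: not_frequently not_less)
        then have "hi x \<le> ereal \<beta>" unfolding hi_def by (rule Limsup_bounded)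
        then show False using that leD by (auto simp: A_def)
      qed
      \<comment> \<open>The index 0 must be excluded: there the average is 0 only by division by
        zero and carries no information on the sum.\<close>
      then have "\<exists>\<^sub>F k in sequentially. ereal \<beta> < u k x \<and> k > 0"
        by (rule frequently_eventually_frequently) (rule eventually_gt_at_top)
      then obtain k where "ereal \<beta> < u k x" "k > 0" using frequently_ex by blast
      then show ?thesis by (intro exI[of _ k]) (simp add: sum_const u_def field_simps)
    qed
    have lower: "\<exists>k. birkhoff_sum T (\<lambda>x. \<alpha> - f x) k x > 0" if "x \<in> A" for x
    proof -
      have "\<exists>\<^sub>F k in sequentially. u k x < ereal \<alpha>"
      proof (rule ccontr)
        assume "\<not> ?thesis"
        then have "\<forall>\<^sub>F k in sequentially. ereal \<alpha> \<le> u k x" by (simp add: not_frequently not_less)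
        then have "ereal \<alpha> \<le> lo x" unfolding lo_def by (rule Liminf_bounded)
        then show False using that leD by (auto simp: A_def)
      qed
      then have "\<exists>\<^sub>F k in sequentially. u k x < ereal \<alpha> \<and> k > 0"
        by (rule frequently_eventually_frequently) (rule eventually_gt_at_top)
      then obtain k where "u k x < ereal \<alpha>" "k > 0" using frequently_ex by blast
      then show ?thesis by (intro exI[of _ k]) (simp add: sum_const u_def field_simps)
    qed
    have m1: "(\<lambda>x. f x - \<beta>) \<in> borel_measurable borel" "(\<lambda>x. \<alpha> - f x) \<in> borel_measurable borel"
      using f by measurable
    have b1: "\<bar>f x - \<beta>\<bar> \<le> B + \<bar>\<beta>\<bar>" "\<bar>\<alpha> - f x\<bar> \<le> B + \<bar>\<alpha>\<bar>" for x using B[of x] by linarith+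
    have i1: "0 \<le> (LINT x|M. (f x - \<beta>) * indicator A x)"
      by (rule ergodic_inequality[OF m1(1) b1(1) A Ainv upper])
    have i2: "0 \<le> (LINT x|M. (\<alpha> - f x) * indicator A x)"
      by (rule ergodic_inequality[OF m1(2) b1(2) A Ainv lower])
    have int: "integrable M (\<lambda>x. (f x - \<beta>) * indicator A x)" "integrable M (\<lambda>x. (\<alpha> - f x) * indicator A x)"
    proof -
      have "(\<lambda>x. (f x - \<beta>) * indicator A x) \<in> borel_measurable borel" using m1 A by measurable
      then show "integrable M (\<lambda>x. (f x - \<beta>) * indicator A x)"
        by (rule bounded_integrable[of _ "B + \<bar>\<beta>\<bar>"])
          (use b1 B0 in \<open>auto simp: indicator_def\<close>)
      have "(\<lambda>x. (\<alpha> - f x) * indicator A x) \<in> borel_measurable borel" using m1 A by measurable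
      then show "integrable M (\<lambda>x. (\<alpha> - f x) * indicator A x)"
        by (rule bounded_integrable[of _ "B + \<bar>\<alpha>\<bar>"])
          (use b1 B0 in \<open>auto simp: indicator_def\<close>)
    qed
    have "0 \<le> (LINT x|M. (f x - \<beta>) * indicator A x + (\<alpha> - f x) * indicator A x)"
      using i1 i2 Bochner_Integration.integral_add[OF int] by simp
    also have "\<dots> = (LINT x|M. (\<alpha> - \<beta>) * indicator A x)"
      by (rule Bochner_Integration.integral_cong) (auto simp: algebra_simps)
    also have "\<dots> = (\<alpha> - \<beta>) * measure M A" using A by (simp add: sets_M space_M)
    finally have "measure M A = 0" using \<open>\<alpha> < \<beta>\<close>
      by (metis diff_less_0_iff_less measure_le_0_iff not_less zero_le_mult_iff)
    then have "A \<in> null_sets M" using A by (simp add: null_sets_def emeasure_eq_measure sets_M)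
    then show ?thesis by (rule AE_I') (auto simp: A_def)
  qed
  have "AE x in M. \<forall>a b::rat. a < b \<longrightarrow>
      \<not> (lo x < ereal (real_of_rat a) \<and> ereal (real_of_rat b) < hi x)"
    using null by (auto simp: AE_all_countable of_rat_less)
  then show ?thesis
  proof (eventually_elim)
    case (elim x)
    have le: "lo x \<le> hi x" unfolding lo_def hi_def by (rule Liminf_le_Limsup) simp
    have "\<not> lo x < hi x"
    proof
      assume "lo x < hi x"
      then obtain a :: rat where a: "lo x < ereal (real_of_rat a)" "ereal (real_of_rat a) < hi x"
        using ereal_dense3 by blast
      then obtain b :: rat where b: "ereal (real_of_rat a) < ereal (real_of_rat b)"
        "ereal (real_of_rat b) < hi x" using ereal_dense3 by blast
      then have "a < b" by (simp add: of_rat_less)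
      then show False using elim a b by blast
    qed
    then have eq: "lo x = hi x" using le by simp
    \<comment> \<open>Boundedness of the averages is what keeps the common value of
      \<open>lo\<close> and \<open>hi\<close> finite.\<close>
    have bd: "- ereal B \<le> u n x" "u n x \<le> ereal B" for n
      using birkhoff_average_bound[of f B T n x] B B0 unfolding u_def abs_le_iff[of "_ / _"] by auto
    have "- ereal B \<le> lo x" "hi x \<le> ereal B" unfolding lo_def hi_def
      by (auto intro!: Liminf_bounded Limsup_bounded always_eventually bd simp del: uminus_ereal.simps)
    then obtain r where r: "lo x = ereal r" unfolding eq by (cases "hi x") auto
    have "(\<lambda>n. u n x) \<longlonglongrightarrow> ereal r"
      using r eq tendsto_iff_Liminf_eq_Limsup[of sequentially "\<lambda>n. u n x" "ereal r"]
      by (simp add: lo_def hi_def)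
    then have "(\<lambda>n. birkhoff_sum T f n x / real n) \<longlonglongrightarrow> r" by (simp add: u_def)
    then show ?case by (auto simp: birkhoff_converges_def convergent_def)
  qed
qed

lemma integral_birkhoff_limit:
  fixes f :: "'x \<Rightarrow> real"
  assumes f: "f \<in> borel_measurable borel" and B: "\<And>x. \<bar>f x\<bar> \<le> B"
  shows "(LINT x|M. birkhoff_limit T f x) = (LINT x|M. f x)"
proof -
  have B0: "B \<ge> 0" using B[of undefined] by linarith
  have "(\<lambda>n. LINT x|M. birkhoff_sum T f n x / real n) \<longlonglongrightarrow> (LINT x|M. birkhoff_limit T f x)"
  proof (rule integral_dominated_convergence[where w = "\<lambda>_. B"])
    show "AE x in M. (\<lambda>n. birkhoff_sum T f n x / real n) \<longlonglongrightarrow> birkhoff_limit T f x"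
      using birkhoff_converges_AE[OF f B]
      by eventually_elim (simp add: birkhoff_converges_def birkhoff_limit_def convergent_LIMSEQ_iff)
    show "AE x in M. norm (birkhoff_sum T f n x / real n) \<le> B" for n
      using birkhoff_average_bound[of f B T n] B B0 by simp
  qed (simp_all add: measurable_M birkhoff_limit_measurable birkhoff_average_measurable f)
  moreover have "(\<lambda>n. LINT x|M. birkhoff_sum T f n x / real n) \<longlonglongrightarrow> (LINT x|M. f x)"
  \<comment> \<open>By invariance the integral of the average is constant in \<open>n\<close>,
    except at \<open>n = 0\<close>, where the quotient is 0.\<close>
  proof (rule tendsto_eventually, rule eventually_sequentiallyI[of 1])
    show "(LINT x|M. birkhoff_sum T f n x / real n) = (LINT x|M. f x)" if "n \<ge> 1" for n
      using that integral_birkhoff_sum[OF f B, of n] by simp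
  qed
  ultimately show ?thesis by (rule LIMSEQ_unique)
qed

end

section \<open>The Jordan decomposition\<close>

lemma signed_measure_sums:
  fixes A :: "nat \<Rightarrow> 'x::topological_space set"
  assumes "\<nu> \<in> signed_measures" "range A \<subseteq> sets borel" "disjoint_family A"
  shows "(\<lambda>n. \<nu> (A n)) sums \<nu> (\<Union>n. A n)"
  using assms unfolding signed_measures_def by blast

lemma signed_measure_empty:
  assumes "\<nu> \<in> signed_measures" shows "\<nu> {} = 0"
proof -
  have "(\<lambda>n::nat. \<nu> {}) sums \<nu> {}"
    using signed_measure_sums[OF assms, of "\<lambda>_. {}"] by (simp add: disjoint_family_on_def)
  then have "(\<lambda>n::nat. \<nu> {}) \<longlonglongrightarrow> 0" by (intro summable_LIMSEQ_zero sums_summable)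
  then show ?thesis by (simp add: LIMSEQ_const_iff)
qed

lemma signed_measure_Un:
  assumes \<nu>: "\<nu> \<in> signed_measures" and A: "A \<in> sets borel" "B \<in> sets borel" "A \<inter> B = {}"
  shows "\<nu> (A \<union> B) = \<nu> A + \<nu> B"
proof -
  let ?A = "\<lambda>n::nat. if n = 0 then A else if n = 1 then B else {}"
  have "(\<lambda>n. \<nu> (?A n)) sums \<nu> (\<Union>n. ?A n)"
    by (rule signed_measure_sums[OF \<nu>]) (use A in \<open>auto simp: disjoint_family_on_def\<close>)
  moreover have "(\<Union>n. ?A n) = A \<union> B" by (auto split: if_splits)
  moreover have "(\<lambda>n. \<nu> (?A n)) sums (\<Sum>n\<in>{0, 1}. \<nu> (?A n))"
    by (rule sums_finite) (auto simp: signed_measure_empty[OF \<nu>])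
  ultimately show ?thesis using sums_unique2 by fastforce
qed

lemma signed_measure_Diff:
  assumes \<nu>: "\<nu> \<in> signed_measures" and A: "A \<in> sets borel" "B \<in> sets borel" "B \<subseteq> A"
  shows "\<nu> (A - B) = \<nu> A - \<nu> B"
proof -
  have "\<nu> (B \<union> (A - B)) = \<nu> B + \<nu> (A - B)" using A by (intro signed_measure_Un[OF \<nu>]) auto
  moreover have "B \<union> (A - B) = A" using A by auto
  ultimately show ?thesis by simp
qed

lemma signed_measure_uminus:
  "\<nu> \<in> signed_measures \<Longrightarrow> (\<lambda>A. - \<nu> A) \<in> signed_measures"
  unfolding signed_measures_def by (auto intro: sums_minus)

text \<open>
  If \<open>\<nu>\<close> were unbounded, one could split off disjoint pieces of measure at least 1 in absolute
  value while keeping an unbounded remainder.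
\<close>

lemma signed_measure_bounded:
  assumes \<nu>: "(\<nu> :: 'x::topological_space set \<Rightarrow> real) \<in> signed_measures"
  shows "\<exists>C. \<forall>A\<in>sets borel. \<bar>\<nu> A\<bar> \<le> C"
proof (rule ccontr)
  assume unb: "\<not> ?thesis"
  define bad where "bad = (\<lambda>A. A \<in> sets borel \<and> (\<forall>C. \<exists>B\<in>sets borel. B \<subseteq> A \<and> \<bar>\<nu> B\<bar> > C))"
  have bad0: "bad UNIV" using unb unfolding bad_def by (auto simp: not_le)
  have not_bad: "\<exists>C. \<forall>E\<in>sets borel. E \<subseteq> D \<longrightarrow> \<bar>\<nu> E\<bar> \<le> C" if "D \<in> sets borel" "\<not> bad D" for D
    using that unfolding bad_def by (auto simp: not_less)
  \<comment> \<open>Choosing \<open>B\<close> with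
    \<open>\<bar>\<nu> B\<bar> > \<bar>\<nu> A\<bar> + 1\<close> makes both \<open>B\<close> and
    \<open>A - B\<close> have measure larger than 1 in absolute value. One of them is again bad and
    is kept, and the other is the piece split off, whichever way it turns out.\<close>
  have step: "\<exists>A'. bad A' \<and> A' \<subseteq> A \<and> \<bar>\<nu> (A - A')\<bar> \<ge> 1" if A: "bad A" for A
  proof -
    obtain B where B: "B \<in> sets borel" "B \<subseteq> A" "\<bar>\<nu> B\<bar> > \<bar>\<nu> A\<bar> + 1" using A unfolding bad_def by blast
    have As: "A \<in> sets borel" using A by (simp add: bad_def)
    have d: "\<nu> (A - B) = \<nu> A - \<nu> B" by (rule signed_measure_Diff[OF \<nu> As B(1,2)])
    have "bad B \<or> bad (A - B)"
    proof (rule ccontr)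
      assume "\<not> ?thesis"
      then have nb: "\<not> bad B" "\<not> bad (A - B)" by auto
      obtain C where C: "\<And>D. D \<in> sets borel \<Longrightarrow> D \<subseteq> B \<Longrightarrow> \<bar>\<nu> D\<bar> \<le> C"
        using not_bad[OF B(1) nb(1)] by blast
      have "A - B \<in> sets borel" using As B(1) by auto
      then obtain C' where C': "\<And>D. D \<in> sets borel \<Longrightarrow> D \<subseteq> A - B \<Longrightarrow> \<bar>\<nu> D\<bar> \<le> C'"
        using not_bad[OF _ nb(2)] by blast
      have "\<bar>\<nu> D\<bar> \<le> C + C'" if D: "D \<in> sets borel" "D \<subseteq> A" for D
      proof -
        have "\<nu> ((D \<inter> B) \<union> (D - B)) = \<nu> (D \<inter> B) + \<nu> (D - B)"
          using D B by (intro signed_measure_Un[OF \<nu>]) auto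
        moreover have "(D \<inter> B) \<union> (D - B) = D" by auto
        moreover have "\<bar>\<nu> (D \<inter> B)\<bar> \<le> C" using D B by (intro C) auto
        moreover have "\<bar>\<nu> (D - B)\<bar> \<le> C'" using D B by (intro C') auto
        ultimately show ?thesis by simp
      qed
      then show False using A unfolding bad_def by (meson not_less)
    qed
    then show ?thesis
    proof
      assume "bad B"
      then show ?thesis using B d by (intro exI[of _ B]) auto
    next
      assume "bad (A - B)"
      moreover have "A - (A - B) = B" using B by auto
      ultimately show ?thesis using B by (intro exI[of _ "A - B"]) auto
    qed
  qed
  obtain f where f: "\<And>A. bad A \<Longrightarrow> bad (f A) \<and> f A \<subseteq> A \<and> \<bar>\<nu> (A - f A)\<bar> \<ge> 1" using step by metis
  define A where "A = (\<lambda>n. (f ^^ n) UNIV)"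
  have badA: "bad (A n)" for n by (induction n) (auto simp: A_def bad0 f)
  have A_Suc: "A (Suc n) = f (A n)" for n by (simp add: A_def)
  have dec: "m \<le> n \<Longrightarrow> A n \<subseteq> A m" for m n
    by (rule lift_Suc_antimono_le[of A]) (use A_Suc f badA in auto)
  define D where "D = (\<lambda>n. A n - A (Suc n))"
  have "disjoint_family D"
    unfolding disjoint_family_on_def
  proof (intro ballI impI)
    fix m n :: nat assume "m \<noteq> n"
    then show "D m \<inter> D n = {}"
      using dec[of "Suc m" n] dec[of "Suc n" m] unfolding D_def by (cases m n rule: linorder_cases) auto
  qed
  moreover have "range D \<subseteq> sets borel" using badA by (auto simp: D_def bad_def)
  ultimately have "(\<lambda>n. \<nu> (D n)) \<longlonglongrightarrow> 0"
    using signed_measure_sums[OF \<nu>] summable_LIMSEQ_zero sums_summable by blast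
  then have "eventually (\<lambda>n. norm (\<nu> (D n) - 0) < 1) sequentially"
    by (simp add: LIMSEQ_iff eventually_sequentially)
  then obtain n where "\<bar>\<nu> (D n)\<bar> < 1" by (auto dest: eventually_happens)
  then show False using f[OF badA[of n]] by (simp add: D_def A_Suc)
qed

text \<open>Real counterpart of the \<open>ennreal\<close> supremum in \<open>pos_part\<close>. It
  is a genuine supremum by boundedness of signed measures, and nonnegative because \<open>{}\<close>
  is among the competitors.\<close>

definition upper_variation :: "('x::topological_space set \<Rightarrow> real) \<Rightarrow> 'x set \<Rightarrow> real" where
  "upper_variation \<nu> A = (SUP B\<in>{B \<in> sets borel. B \<subseteq> A}. \<nu> B)"

lemma upper_variation_upper:
  assumes "\<nu> \<in> signed_measures" "B \<in> sets borel" "B \<subseteq> A"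
  shows "\<nu> B \<le> upper_variation \<nu> A"
proof -
  obtain C where "\<forall>A\<in>sets borel. \<bar>\<nu> A\<bar> \<le> C" using signed_measure_bounded assms(1) by blast
  then have "bdd_above (\<nu> ` {B \<in> sets borel. B \<subseteq> A})" by (intro bdd_aboveI[of _ C]) auto
  then show ?thesis unfolding upper_variation_def by (intro cSUP_upper) (use assms in auto)
qed

lemma upper_variation_least:
  "(\<And>B. B \<in> sets borel \<Longrightarrow> B \<subseteq> A \<Longrightarrow> \<nu> B \<le> c) \<Longrightarrow> upper_variation \<nu> A \<le> c"
  unfolding upper_variation_def by (intro cSUP_least) auto

lemma upper_variation_nonneg: "\<nu> \<in> signed_measures \<Longrightarrow> 0 \<le> upper_variation \<nu> A"
  using upper_variation_upper[of \<nu> "{}" A] signed_measure_empty[of \<nu>] by simp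

lemma upper_variation_mono: "\<nu> \<in> signed_measures \<Longrightarrow> A \<subseteq> B \<Longrightarrow> upper_variation \<nu> A \<le> upper_variation \<nu> B"
  by (rule upper_variation_least) (auto intro: upper_variation_upper)

lemma upper_variation_superadditive:
  assumes \<nu>: "\<nu> \<in> signed_measures" and "A \<inter> B = {}"
  shows "upper_variation \<nu> A + upper_variation \<nu> B \<le> upper_variation \<nu> (A \<union> B)"
proof -
  have "upper_variation \<nu> A \<le> upper_variation \<nu> (A \<union> B) - upper_variation \<nu> B"
  proof (rule upper_variation_least)
    fix C assume C: "C \<in> sets borel" "C \<subseteq> A"
    have "upper_variation \<nu> B \<le> upper_variation \<nu> (A \<union> B) - \<nu> C"
    proof (rule upper_variation_least)
      fix D assume D: "D \<in> sets borel" "D \<subseteq> B"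
      have "\<nu> C + \<nu> D = \<nu> (C \<union> D)" using C D assms by (intro signed_measure_Un[symmetric]) auto
      also have "\<dots> \<le> upper_variation \<nu> (A \<union> B)" using C D by (intro upper_variation_upper[OF \<nu>]) auto
      finally show "\<nu> D \<le> upper_variation \<nu> (A \<union> B) - \<nu> C" by simp
    qed
    then show "\<nu> C \<le> upper_variation \<nu> (A \<union> B) - upper_variation \<nu> B" by simp
  qed
  then show ?thesis by simp
qed

text \<open>One inequality is finite superadditivity together with monotonicity; for the other, a
  measurable subset of the union is cut into its traces on the pieces.\<close>

lemma upper_variation_sums:
  fixes A :: "nat \<Rightarrow> 'x::topological_space set"
  assumes \<nu>: "\<nu> \<in> signed_measures" and A: "range A \<subseteq> sets borel" "disjoint_family A"
  shows "(\<lambda>n. upper_variation \<nu> (A n)) sums upper_variation \<nu> (\<Union>n. A n)"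
proof -
  let ?p = "upper_variation \<nu>"
  have partial: "(\<Sum>n<N. ?p (A n)) \<le> ?p (\<Union>n<N. A n)" for N
  proof (induction N)
    case (Suc N)
    have "(\<Union>n<N. A n) \<inter> A N = {}" using A(2)
      by (auto simp: disjoint_family_on_def) (metis disjoint_iff less_irrefl)
    then have "?p (\<Union>n<N. A n) + ?p (A N) \<le> ?p ((\<Union>n<N. A n) \<union> A N)"
      by (rule upper_variation_superadditive[OF \<nu>])
    then show ?case using Suc by (simp add: lessThan_Suc Un_commute)
  qed (simp add: upper_variation_nonneg[OF \<nu>])
  have le: "(\<Sum>n<N. ?p (A n)) \<le> ?p (\<Union>n. A n)" for N
    by (rule order_trans[OF partial upper_variation_mono[OF \<nu>]]) auto
  have summ: "summable (\<lambda>n. ?p (A n))"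
    by (rule summableI_nonneg_bounded[of _ "?p (\<Union>n. A n)"]) (use le upper_variation_nonneg[OF \<nu>] in auto)
  have "?p (\<Union>n. A n) \<le> (\<Sum>n. ?p (A n))"
  proof (rule upper_variation_least)
    fix B assume B: "B \<in> sets borel" "B \<subseteq> (\<Union>n. A n)"
    have s: "(\<lambda>n. \<nu> (B \<inter> A n)) sums \<nu> (\<Union>n. B \<inter> A n)"
      by (rule signed_measure_sums[OF \<nu>]) (use A B in \<open>auto simp: disjoint_family_on_def\<close>)
    have "(\<Union>n. B \<inter> A n) = B" using B by auto
    then have "\<nu> B = (\<Sum>n. \<nu> (B \<inter> A n))" using sums_unique[OF s] by simp
    also have "\<dots> \<le> (\<Sum>n. ?p (A n))"
      by (rule suminf_le[OF _ sums_summable[OF s] summ])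
        (use A B in \<open>auto intro!: upper_variation_upper[OF \<nu>]\<close>)
    finally show "\<nu> B \<le> (\<Sum>n. ?p (A n))" .
  qed
  moreover have "(\<Sum>n. ?p (A n)) \<le> ?p (\<Union>n. A n)" by (rule suminf_le_const[OF summ le])
  ultimately have "(\<Sum>n. ?p (A n)) = ?p (\<Union>n. A n)" by (rule antisym[rotated])
  then show ?thesis using summable_sums[OF summ] by simp
qed

lemma upper_variation_Un:
  assumes "\<nu> \<in> signed_measures" "A \<in> sets borel" "B \<in> sets borel" "A \<inter> B = {}"
  shows "upper_variation \<nu> (A \<union> B) = upper_variation \<nu> A + upper_variation \<nu> B"
proof (rule antisym[OF _ upper_variation_superadditive[OF assms(1,4)]], rule upper_variation_least)
  fix C assume C: "C \<in> sets borel" "C \<subseteq> A \<union> B"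
  have "\<nu> ((C \<inter> A) \<union> (C \<inter> B)) = \<nu> (C \<inter> A) + \<nu> (C \<inter> B)"
    using assms C by (intro signed_measure_Un) auto
  moreover have "(C \<inter> A) \<union> (C \<inter> B) = C" using C by auto
  moreover have "\<nu> (C \<inter> A) \<le> upper_variation \<nu> A" "\<nu> (C \<inter> B) \<le> upper_variation \<nu> B"
    using assms C by (auto intro!: upper_variation_upper)
  ultimately show "\<nu> C \<le> upper_variation \<nu> A + upper_variation \<nu> B" by simp
qed

lemma sets_pos_part [simp]: "sets (pos_part \<nu>) = sets borel"
  using sigma_algebra.sigma_sets_eq[OF sets.sigma_algebra_axioms, of "borel"]
  by (simp add: pos_part_def sets_measure_of_conv)

lemma space_pos_part [simp]: "space (pos_part \<nu>) = UNIV"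
  by (simp add: pos_part_def space_measure_of_conv)

lemma borel_sigma_algebra: "sigma_algebra UNIV (sets borel)"
  using sets.sigma_algebra_axioms[of borel] by simp

lemma countably_additive_borelI:
  assumes "\<And>A :: nat \<Rightarrow> 'x::topological_space set. range A \<subseteq> sets borel \<Longrightarrow> disjoint_family A \<Longrightarrow>
    (\<lambda>n. p (A n)) sums p (\<Union>n. A n)" "\<And>A. 0 \<le> p A"
  shows "countably_additive (sets borel) (\<lambda>A. ennreal (p A))"
proof (rule countably_additiveI)
  fix A :: "nat \<Rightarrow> 'x set" assume A: "range A \<subseteq> sets borel" "disjoint_family A"
  note s = assms(1)[OF A]
  have "(\<Sum>n. ennreal (p (A n))) = ennreal (\<Sum>n. p (A n))"
    by (rule suminf_ennreal2) (use assms(2) sums_summable[OF s] in auto)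
  then show "(\<Sum>n. ennreal (p (A n))) = ennreal (p (\<Union>n. A n))" using sums_unique[OF s] by simp
qed

text \<open>Cutting negative values off at 0 does not change the supremum, which is nonnegative
  anyway; so the set function handed to \<open>measure_of\<close> is countably additive and is not
  replaced by the default measure.\<close>

lemma emeasure_pos_part:
  assumes \<nu>: "\<nu> \<in> signed_measures" and A: "A \<in> sets borel"
  shows "emeasure (pos_part \<nu>) A = ennreal (upper_variation \<nu> A)"
proof -
  have eq: "(SUP B\<in>{B \<in> sets borel. B \<subseteq> A}. ennreal (\<nu> B)) = ennreal (upper_variation \<nu> A)" for A
  proof (rule antisym)
    show le: "(SUP B\<in>{B \<in> sets borel. B \<subseteq> A}. ennreal (\<nu> B)) \<le> ennreal (upper_variation \<nu> A)"
      by (rule SUP_least) (auto intro!: ennreal_leI upper_variation_upper[OF \<nu>])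
    have fin: "(SUP B\<in>{B \<in> sets borel. B \<subseteq> A}. ennreal (\<nu> B)) \<noteq> top"
      by (rule neq_top_trans[OF ennreal_neq_top le])
    have "upper_variation \<nu> A \<le> enn2real (SUP B\<in>{B \<in> sets borel. B \<subseteq> A}. ennreal (\<nu> B))"
    proof (rule upper_variation_least)
      fix B :: "'a set" assume B: "B \<in> sets borel" "B \<subseteq> A"
      have "ennreal (\<nu> B) \<le> (SUP B\<in>{B \<in> sets borel. B \<subseteq> A}. ennreal (\<nu> B))"
        by (rule SUP_upper) (use B in auto)
      also have "\<dots> = ennreal (enn2real (SUP B\<in>{B \<in> sets borel. B \<subseteq> A}. ennreal (\<nu> B)))"
        by (rule ennreal_enn2real[symmetric], rule less_top[THEN iffD1], rule fin)
      finally show "\<nu> B \<le> enn2real (SUP B\<in>{B \<in> sets borel. B \<subseteq> A}. ennreal (\<nu> B))"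
        by (simp add: ennreal_le_iff)
    qed
    then have "ennreal (upper_variation \<nu> A)
      \<le> ennreal (enn2real (SUP B\<in>{B \<in> sets borel. B \<subseteq> A}. ennreal (\<nu> B)))" by (rule ennreal_leI)
    also have "\<dots> = (SUP B\<in>{B \<in> sets borel. B \<subseteq> A}. ennreal (\<nu> B))"
      by (rule ennreal_enn2real, rule less_top[THEN iffD1], rule fin)
    finally show "ennreal (upper_variation \<nu> A) \<le> (SUP B\<in>{B \<in> sets borel. B \<subseteq> A}. ennreal (\<nu> B))" .
  qed
  show ?thesis unfolding pos_part_def eq
  proof (rule emeasure_measure_of_sigma[OF borel_sigma_algebra])
    show "positive (sets borel) (\<lambda>A. ennreal (upper_variation \<nu> A))"
    proof -
      have "upper_variation \<nu> {} \<le> 0" by (rule upper_variation_least) (simp add: signed_measure_empty[OF \<nu>])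
      then show ?thesis by (simp add: positive_def ennreal_neg)
    qed
    show "countably_additive (sets borel) (\<lambda>A. ennreal (upper_variation \<nu> A))"
      by (rule countably_additive_borelI)
        (auto intro: upper_variation_sums[OF \<nu>] upper_variation_nonneg[OF \<nu>])
  qed (rule A)
qed

lemma finite_measure_pos_part: "\<nu> \<in> signed_measures \<Longrightarrow> finite_measure (pos_part \<nu>)"
  by (rule finite_measureI) (simp add: emeasure_pos_part)

lemma sets_neg_part [simp]: "sets (neg_part \<nu>) = sets borel"
  by (simp add: neg_part_def)

lemma space_neg_part [simp]: "space (neg_part \<nu>) = UNIV"
  by (simp add: neg_part_def)

lemma finite_measure_neg_part: "\<nu> \<in> signed_measures \<Longrightarrow> finite_measure (neg_part \<nu>)"
  unfolding neg_part_def by (intro finite_measure_pos_part signed_measure_uminus)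

lemma sets_variation [simp]: "sets (variation \<nu>) = sets borel"
  using sigma_algebra.sigma_sets_eq[OF borel_sigma_algebra]
  by (simp add: variation_def sets_measure_of_conv)

lemma space_variation [simp]: "space (variation \<nu>) = UNIV"
  by (simp add: variation_def space_measure_of_conv)

lemma emeasure_variation:
  assumes "A \<in> sets borel"
  shows "emeasure (variation \<nu>) A = emeasure (pos_part \<nu>) A + emeasure (neg_part \<nu>) A"
  unfolding variation_def
proof (rule emeasure_measure_of_sigma[OF borel_sigma_algebra _ _ assms])
  show "positive (sets borel) (\<lambda>A. emeasure (pos_part \<nu>) A + emeasure (neg_part \<nu>) A)"
    by (simp add: positive_def)
  show "countably_additive (sets borel) (\<lambda>A. emeasure (pos_part \<nu>) A + emeasure (neg_part \<nu>) A)"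
    by (rule countably_additiveI) (simp add: suminf_add[symmetric] suminf_emeasure)
qed

lemma finite_measure_variation:
  assumes "\<nu> \<in> signed_measures" shows "finite_measure (variation \<nu>)"
  using finite_measure.emeasure_finite[OF finite_measure_pos_part[OF assms]]
    finite_measure.emeasure_finite[OF finite_measure_neg_part[OF assms]]
  by (intro finite_measureI) (simp add: emeasure_variation)

lemma AE_variation:
  assumes "AE x in pos_part \<nu>. Q x" "AE x in neg_part \<nu>. Q x" "{x. Q x} \<in> sets borel"
  shows "AE x in variation \<nu>. Q x"
proof (rule AE_I')
  have s: "{x. \<not> Q x} \<in> sets borel" using assms(3) by (simp add: Collect_neg_eq)
  have "emeasure (pos_part \<nu>) {x. \<not> Q x} = 0" "emeasure (neg_part \<nu>) {x. \<not> Q x} = 0"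
    using assms s AE_iff_measurable[of "{x. \<not> Q x}" "pos_part \<nu>" Q]
      AE_iff_measurable[of "{x. \<not> Q x}" "neg_part \<nu>" Q] by auto
  then show "{x. \<not> Q x} \<in> null_sets (variation \<nu>)" using s by (simp add: null_sets_def emeasure_variation)
qed auto

lemma pos_part_invariant:
  assumes T: "T \<in> borel_measurable borel" and \<nu>: "\<nu> \<in> invariant_measures T"
  shows "invariant_finite_measure T (pos_part \<nu>)"
proof -
  have s: "\<nu> \<in> signed_measures" using \<nu> by (simp add: invariant_measures_def)
  interpret finite_measure "pos_part \<nu>" by (rule finite_measure_pos_part[OF s])
  let ?p = "upper_variation \<nu>"
  have pre: "T -` A \<in> sets borel" if "A \<in> sets borel" for A using measurable_sets[OF T that] by simp
  have le: "?p A \<le> ?p (T -` A)" if "A \<in> sets borel" for A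
  proof (rule upper_variation_least)
    fix B :: "'a set" assume B: "B \<in> sets borel" "B \<subseteq> A"
    have "\<nu> B = \<nu> (T -` B)" using \<nu> B by (simp add: invariant_measures_def)
    also have "\<dots> \<le> ?p (T -` A)" by (rule upper_variation_upper[OF s]) (use pre B in auto)
    finally show "\<nu> B \<le> ?p (T -` A)" .
  qed
  have eq: "?p (T -` A) = ?p A" if A: "A \<in> sets borel" for A
  proof -
    have "?p (A \<union> - A) = ?p A + ?p (- A)" using A by (intro upper_variation_Un[OF s]) auto
    moreover have "?p (T -` A \<union> T -` (- A)) = ?p (T -` A) + ?p (T -` (- A))"
      using A pre by (intro upper_variation_Un[OF s]) auto
    moreover have "T -` A \<union> T -` (- A) = A \<union> - A" by auto
    ultimately show ?thesis using le[OF A] le[of "- A"] A by auto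
  qed
  show ?thesis
    by unfold_locales (use T eq pre in \<open>auto simp: emeasure_pos_part[OF s]\<close>)
qed

lemma neg_part_invariant:
  assumes "T \<in> borel_measurable borel" "\<nu> \<in> invariant_measures T"
  shows "invariant_finite_measure T (neg_part \<nu>)"
  unfolding neg_part_def
  by (rule pos_part_invariant[OF assms(1)])
    (use assms(2) signed_measure_uminus in \<open>auto simp: invariant_measures_def\<close>)

section \<open>Boundedness of weak-* convergent sequences\<close>

text \<open>Sets that can be squeezed between a closed and an open set of nearly equal measure are
  stable under complements and countable unions, and contain the closed sets: a closed
  \<open>F\<close> is the decreasing intersection of its open neighbourhoods
  \<open>infdist x F < 1 / real (Suc n)\<close>.\<close>

lemma borel_regular:
  fixes M :: "'x::metric_space measure"
  assumes fin: "finite_measure M" and sets: "sets M = sets borel" and A: "A \<in> sets borel"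
  shows "\<forall>e>0. \<exists>K U. closed K \<and> open U \<and> K \<subseteq> A \<and> A \<subseteq> U \<and> measure M (U - K) < e"
proof -
  interpret finite_measure M by fact
  have space: "space M = UNIV" using sets_eq_imp_space_eq[OF sets] by simp
  note [measurable] = sets
  have b: "X \<in> sets M" if "closed X \<or> open X" for X using that by (auto simp: sets)
  let ?R = "\<lambda>A. \<forall>e>0. \<exists>K U. closed K \<and> open U \<and> K \<subseteq> A \<and> A \<subseteq> U \<and> measure M (U - K) < e"
  have "A \<in> sigma_sets UNIV {S. closed S}" using A by (simp add: borel_eq_closed sets_measure_of_conv)
  then show ?thesis
  proof (induction rule: sigma_sets.induct)
    case (Basic F)
    then have F: "closed F" by simp
    show ?case
    proof (cases "F = {}")
      case True
      then show ?thesis by (auto intro!: exI[of _ "{}"])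
    next
      case False
      define U where "U = (\<lambda>n::nat. {x. infdist x F < 1 / real (Suc n)})"
      have op: "open (U n)" for n unfolding U_def
        by (intro open_Collect_less continuous_intros)
      have dec: "decseq (\<lambda>n. U n - F)"
        unfolding decseq_def U_def
      proof (intro allI impI subsetI, safe)
        fix m n :: nat and x assume "m \<le> n" "infdist x F < 1 / real (Suc n)"
        moreover have "1 / real (Suc n) \<le> 1 / real (Suc m)" using \<open>m \<le> n\<close> by (intro divide_left_mono) auto
        ultimately show "infdist x F < 1 / real (Suc m)" by linarith
      qed
      have "(\<Inter>n. U n - F) = {}"
      proof (rule ccontr)
        assume "(\<Inter>n. U n - F) \<noteq> {}"
        then obtain x where x: "x \<notin> F" "\<And>n. infdist x F < 1 / real (Suc n)" by (auto simp: U_def)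
        have "infdist x F > 0" using x(1) F False in_closed_iff_infdist_zero[of F x] infdist_nonneg[of x F]
          by (auto simp: less_le)
        then obtain n where "1 / real (Suc n) < infdist x F"
          by (metis inverse_eq_divide reals_Archimedean)
        then show False using x(2)[of n] by simp
      qed
      moreover have "(\<lambda>n. measure M (U n - F)) \<longlonglongrightarrow> measure M (\<Inter>n. U n - F)"
        using op F by (intro finite_Lim_measure_decseq dec) (auto intro!: sets.Diff b)
      ultimately have lim: "(\<lambda>n. measure M (U n - F)) \<longlonglongrightarrow> 0" by (simp only: measure_empty)
      show ?thesis
      proof (intro allI impI)
        fix e :: real assume "e > 0"
        then obtain n where "measure M (U n - F) < e"
          using order_tendstoD(2)[OF lim, of e] by (auto dest: eventually_happens)
        moreover have "F \<subseteq> U n" by (auto simp: U_def)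
        ultimately show "\<exists>K U. closed K \<and> open U \<and> K \<subseteq> F \<and> F \<subseteq> U \<and> measure M (U - K) < e"
          using F op by blast
      qed
    qed
  next
    case Empty
    show ?case by (auto intro!: exI[of _ "{}"])
  next
    case (Compl a)
    show ?case
    proof (intro allI impI)
      fix e :: real assume "e > 0"
      then obtain K U where KU: "closed K" "open U" "K \<subseteq> a" "a \<subseteq> U" "measure M (U - K) < e"
        using Compl(2)[rule_format, OF \<open>e > 0\<close>] by blast
      have "(- K) - (- U) = U - K" by auto
      then show "\<exists>K U. closed K \<and> open U \<and> K \<subseteq> UNIV - a \<and> UNIV - a \<subseteq> U \<and> measure M (U - K) < e"
        using KU by (metis (no_types, opaque_lifting) Compl_eq_Diff_UNIV Compl_subset_Compl_iff closed_Compl open_Compl)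
    qed
  next
    case (Union a)
    show ?case
    proof (intro allI impI)
      fix e :: real assume e: "e > 0"
      \<comment> \<open>These weights add up to \<open>e / 2\<close>. The other half pays for
        keeping only finitely many of the closed sets, as a countable union of closed sets need not
        be closed.\<close>
      have "\<exists>K U. closed K \<and> open U \<and> K \<subseteq> a i \<and> a i \<subseteq> U \<and> measure M (U - K) < e / 4 * (1 / 2) ^ i" for i
        by (rule Union(2)[rule_format]) (use e in simp)
      then obtain K U where KU: "\<And>i. closed (K i)" "\<And>i. open (U i)" "\<And>i. K i \<subseteq> a i" "\<And>i. a i \<subseteq> U i"
        "\<And>i. measure M (U i - K i) < e / 4 * (1 / 2) ^ i" by metis
      have sm: "(\<lambda>i. e / 4 * (1 / 2) ^ i) sums (e / 2)"
        using sums_mult[OF geometric_sums[of "1/2::real"], of "e / 4"] by simp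
      have UK: "U i - K i \<in> sets M" for i using KU b by blast
      let ?U = "\<Union>i. U i"
      have summ: "summable (\<lambda>i. measure M (U i - K i))"
        by (rule summable_comparison_test'[OF sums_summable[OF sm], of 0])
          (use KU(5) in \<open>auto intro: less_imp_le\<close>)
      have "measure M (\<Union>i. U i - K i) \<le> (\<Sum>i. measure M (U i - K i))"
        by (rule finite_measure_subadditive_countably) (use UK summ in auto)
      also have "\<dots> \<le> (\<Sum>i. e / 4 * (1 / 2) ^ i)"
        by (rule suminf_le[OF _ summ sums_summable[OF sm]]) (use KU(5) in \<open>auto intro: less_imp_le\<close>)
      also have "\<dots> = e / 2" using sums_unique[OF sm] by simp
      finally have m1: "measure M (\<Union>i. U i - K i) \<le> e / 2" .
      have "(\<lambda>n. measure M (?U - (\<Union>i\<le>n. K i))) \<longlonglongrightarrow> measure M (\<Inter>n. ?U - (\<Union>i\<le>n. K i))"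
        by (rule finite_Lim_measure_decseq)
          (use KU b in \<open>auto simp: decseq_def intro!: sets.Diff sets.countable_UN sets.finite_UN\<close>)
      moreover have "measure M (\<Inter>n. ?U - (\<Union>i\<le>n. K i)) < e"
      proof -
        have "measure M (\<Inter>n. ?U - (\<Union>i\<le>n. K i)) \<le> measure M (\<Union>i. U i - K i)"
          by (rule finite_measure_mono) (use UK in auto)
        then show ?thesis using m1 e by linarith
      qed
      ultimately obtain n where n: "measure M (?U - (\<Union>i\<le>n. K i)) < e"
        using order_tendstoD(2) by (force dest: eventually_happens)
      show "\<exists>K U. closed K \<and> open U \<and> K \<subseteq> (\<Union>i. a i) \<and> (\<Union>i. a i) \<subseteq> U \<and> measure M (U - K) < e"
      proof (rule exI[of _ "\<Union>i\<le>n. K i"], rule exI[of _ "?U"], intro conjI)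
        show "closed (\<Union>i\<le>n. K i)" by (intro closed_UN finite_atMost ballI KU(1))
        show "open ?U" by (intro open_UN ballI KU(2))
        show "(\<Union>i\<le>n. K i) \<subseteq> (\<Union>i. a i)" using KU(3) by (meson UN_mono subset_UNIV)
        show "(\<Union>i. a i) \<subseteq> ?U" using KU(4) by (meson UN_mono subset_refl)
        show "measure M (?U - (\<Union>i\<le>n. K i)) < e" by (rule n)
      qed
    qed
  qed
qed

lemma measure_variation:
  assumes \<nu>: "\<nu> \<in> signed_measures" and A: "A \<in> sets borel"
  shows "measure (variation \<nu>) A = measure (pos_part \<nu>) A + measure (neg_part \<nu>) A"
proof -
  interpret P: finite_measure "pos_part \<nu>" by (rule finite_measure_pos_part[OF \<nu>])
  interpret N: finite_measure "neg_part \<nu>" by (rule finite_measure_neg_part[OF \<nu>])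
  have "emeasure (variation \<nu>) A = ennreal (measure (pos_part \<nu>) A) + ennreal (measure (neg_part \<nu>) A)"
    by (simp only: emeasure_variation[OF A] P.emeasure_eq_measure N.emeasure_eq_measure)
  also have "\<dots> = ennreal (measure (pos_part \<nu>) A + measure (neg_part \<nu>) A)"
    by (rule ennreal_plus[symmetric]) auto
  finally show ?thesis by (rule measure_eq_emeasure_eq_ennreal[rotated]) auto
qed

text \<open>
  A set on which \<open>\<nu>\<close> nearly attains its supremum is nearly null for the negative part and nearly
  full for the positive part, so the exact Hahn decomposition is not needed.
\<close>

lemma signed_measure_norm_attained:
  fixes \<nu> :: "'x::metric_space set \<Rightarrow> real"
  assumes \<nu>: "\<nu> \<in> signed_measures" and e: "e > 0"
  shows "\<exists>g. continuous_on UNIV g \<and> (\<forall>x. \<bar>g x\<bar> \<le> 1) \<and>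
    measure (variation \<nu>) UNIV - e \<le> signed_integral \<nu> g"
proof -
  let ?P = "pos_part \<nu>" and ?N = "neg_part \<nu>" and ?V = "variation \<nu>"
  let ?p = "upper_variation \<nu>" and ?q = "upper_variation (\<lambda>A. - \<nu> A)"
  note \<nu>' = signed_measure_uminus[OF \<nu>]
  interpret P: finite_measure ?P by (rule finite_measure_pos_part[OF \<nu>])
  interpret N: finite_measure ?N by (rule finite_measure_neg_part[OF \<nu>])
  interpret V: finite_measure ?V by (rule finite_measure_variation[OF \<nu>])
  have mP: "measure ?P A = ?p A" if "A \<in> sets borel" for A
    using that by (simp add: measure_def emeasure_pos_part[OF \<nu>] upper_variation_nonneg[OF \<nu>])
  have mN: "measure ?N A = ?q A" if "A \<in> sets borel" for A
    using that by (simp add: measure_def neg_part_def emeasure_pos_part[OF \<nu>'] upper_variation_nonneg[OF \<nu>'])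
  have mV: "measure ?V A = measure ?P A + measure ?N A" if "A \<in> sets borel" for A
    using measure_variation[OF \<nu> that] .
  \<comment> \<open>Four defects of size at most \<open>d\<close> occur: the negative mass of
    \<open>B\<close>, the positive mass of its complement, and the loss in passing to closed subsets
    of each. Each enters twice, so \<open>8 * d\<close>, half of \<open>e\<close>, is lost.\<close>
  define d where "d = e / 16"
  have d: "d > 0" using e by (simp add: d_def)
  have "\<exists>B\<in>sets borel. \<nu> B > ?p UNIV - d"
  proof (rule ccontr)
    assume "\<not> ?thesis"
    then have "?p UNIV \<le> ?p UNIV - d" by (intro upper_variation_least) (simp add: not_less)
    then show False using d by simp
  qed
  then obtain B where B: "B \<in> sets borel" "\<nu> B > ?p UNIV - d" by blast
  have cB: "- B \<in> sets borel" using B by auto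
  have qB: "?q B \<le> d"
  proof (rule upper_variation_least)
    fix C :: "'x set" assume C: "C \<in> sets borel" "C \<subseteq> B"
    have "\<nu> (B - C) = \<nu> B - \<nu> C" by (rule signed_measure_Diff[OF \<nu> B(1) C])
    moreover have "\<nu> (B - C) \<le> ?p UNIV" by (rule upper_variation_upper[OF \<nu>]) (use B C in auto)
    ultimately show "- \<nu> C \<le> d" using B by linarith
  qed
  have pB: "?p (- B) \<le> d"
  proof -
    have "?p (B \<union> - B) = ?p B + ?p (- B)" by (rule upper_variation_Un[OF \<nu> B(1) cB]) auto
    moreover have "\<nu> B \<le> ?p B" by (rule upper_variation_upper[OF \<nu> B(1)]) auto
    ultimately show ?thesis using B by simp
  qed
  obtain K where K: "closed K" "K \<subseteq> B" "measure ?V (B - K) < d"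
  proof -
    obtain K U where KU: "closed K" "open U" "K \<subseteq> B" "B \<subseteq> U" "measure ?V (U - K) < d"
      using borel_regular[OF V.finite_measure_axioms sets_variation B(1), rule_format, OF d] by blast
    have "measure ?V (B - K) \<le> measure ?V (U - K)"
      by (rule V.finite_measure_mono) (use KU in auto)
    then show thesis using that[OF KU(1,3)] KU(5) by simp
  qed
  obtain L where L: "closed L" "L \<subseteq> - B" "measure ?V (- B - L) < d"
  proof -
    obtain K U where KU: "closed K" "open U" "K \<subseteq> - B" "- B \<subseteq> U" "measure ?V (U - K) < d"
      using borel_regular[OF V.finite_measure_axioms sets_variation cB, rule_format, OF d] by blast
    have "measure ?V (- B - K) \<le> measure ?V (U - K)"
      by (rule V.finite_measure_mono) (use KU in auto)
    then show thesis using that[OF KU(1,3)] KU(5) by simp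
  qed
  have sK: "K \<in> sets borel" "L \<in> sets borel" using K L by auto
  have "closedin (euclidean :: 'x topology) L" "closedin (euclidean :: 'x topology) K" "disjnt L K"
    using K L by (auto simp: disjnt_def)
  \<comment> \<open>A continuous substitute for the sign of \<open>\<nu>\<close>: 1 on the closed
    core of \<open>B\<close>, -1 on that of the complement, and bounded by 1 on the small
    rest.\<close>
  then obtain g where g': "continuous_map euclidean (top_of_set {- 1..1::real}) g" "g ` L \<subseteq> {- 1}" "g ` K \<subseteq> {1}"
    using Urysohn_lemma[OF metrizable_imp_normal_space[OF metrizable_space_euclidean], of L K "- 1" 1]
    by auto
  have g: "continuous_on UNIV g" "\<And>x. x \<in> K \<Longrightarrow> g x = 1" "\<And>x. x \<in> L \<Longrightarrow> g x = - 1"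
    using g' by (auto simp: continuous_map_in_subtopology)
  have g1: "- 1 \<le> g x" "g x \<le> 1" for x using g'(1) by (auto simp: continuous_map_in_subtopology image_subset_iff)
  have g_meas: "g \<in> borel_measurable borel" by (rule borel_measurable_continuous_onI[OF g(1)])
  have gP: "g \<in> borel_measurable ?P" "g \<in> borel_measurable ?N"
    using g_meas by (simp_all cong: measurable_cong_sets)
  have intg: "integrable ?P g" "integrable ?N g"
    using P.integrable_const_bound[of g 1] N.integrable_const_bound[of g 1] gP g1
    by (auto simp: abs_le_iff minus_le_iff)
  have iK: "integrable ?P (\<lambda>x. 2 * indicator K x - 1 :: real)"
    by (intro Bochner_Integration.integrable_diff integrable_mult_right integrable_real_indicator P.integrable_const)
      (use sK P.emeasure_finite in \<open>auto simp: less_top[symmetric]\<close>)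
  have iL: "integrable ?N (\<lambda>x. 1 - 2 * indicator L x :: real)"
    by (intro Bochner_Integration.integrable_diff integrable_mult_right integrable_real_indicator N.integrable_const)
      (use sK N.emeasure_finite in \<open>auto simp: less_top[symmetric]\<close>)
  have "2 * measure ?P K - measure ?P UNIV = (LINT x|?P. 2 * indicator K x - 1)"
    using sK integrable_real_indicator[of K ?P] P.emeasure_finite[of K]
    by (subst Bochner_Integration.integral_diff) (auto simp: less_top[symmetric])
  also have "\<dots> \<le> (LINT x|?P. g x)"
    by (rule integral_mono[OF iK intg(1)]) (use g1 g(2) in \<open>auto simp: indicator_def\<close>)
  finally have 1: "2 * measure ?P K - measure ?P UNIV \<le> (LINT x|?P. g x)" .
  have "(LINT x|?N. g x) \<le> (LINT x|?N. 1 - 2 * indicator L x)"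
    by (rule integral_mono[OF intg(2) iL]) (use g1 g(3) in \<open>auto simp: indicator_def\<close>)
  also have "\<dots> = measure ?N UNIV - 2 * measure ?N L"
    using sK integrable_real_indicator[of L ?N] N.emeasure_finite[of L]
    by (subst Bochner_Integration.integral_diff) (auto simp: less_top[symmetric])
  finally have 2: "(LINT x|?N. g x) \<le> measure ?N UNIV - 2 * measure ?N L" .
  have splitP: "measure ?P UNIV = measure ?P K + measure ?P (B - K) + measure ?P (- B)"
  proof -
    have "measure ?P (K \<union> (B - K)) = measure ?P K + measure ?P (B - K)"
      by (rule P.finite_measure_Union) (use sK B in auto)
    moreover have "measure ?P (B \<union> - B) = measure ?P B + measure ?P (- B)"
      by (rule P.finite_measure_Union) (use B in auto)
    moreover have "K \<union> (B - K) = B" "B \<union> - B = UNIV" using K(2) by auto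
    ultimately show ?thesis by simp
  qed
  have splitN: "measure ?N UNIV = measure ?N L + measure ?N (- B - L) + measure ?N B"
  proof -
    have "measure ?N (L \<union> (- B - L)) = measure ?N L + measure ?N (- B - L)"
      by (rule N.finite_measure_Union) (use sK B in auto)
    moreover have "measure ?N (B \<union> - B) = measure ?N B + measure ?N (- B)"
      by (rule N.finite_measure_Union) (use B in auto)
    moreover have "L \<union> (- B - L) = - B" "B \<union> - B = UNIV" using L(2) by auto
    ultimately show ?thesis by simp
  qed
  have "measure ?P (B - K) < d" "measure ?N (- B - L) < d"
  proof -
    have "B - K \<in> sets borel" "- B - L \<in> sets borel" using sK B by auto
    from this[THEN mV] show "measure ?P (B - K) < d" "measure ?N (- B - L) < d"
      using K(3) L(3) measure_nonneg[of ?N "B - K"] measure_nonneg[of ?P "- B - L"] by linarith+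
  qed
  moreover have "measure ?P (- B) \<le> d" "measure ?N B \<le> d" using pB qB mP[OF cB] mN[OF B(1)] by auto
  ultimately have "measure ?V UNIV - e \<le> signed_integral \<nu> g"
    using 1 2 splitP splitN mV[of UNIV] d unfolding signed_integral_def d_def by simp
  moreover have "\<bar>g x\<bar> \<le> 1" for x using g1[of x] by (simp add: abs_le_iff)
  ultimately show ?thesis using g(1) by blast
qed

lemma pos_part_integrable:
  fixes f :: "'x::topological_space \<Rightarrow> real"
  assumes "\<nu> \<in> signed_measures" "f \<in> borel_measurable borel" "AE x in pos_part \<nu>. \<bar>f x\<bar> \<le> A"
  shows "integrable (pos_part \<nu>) f"
proof (rule finite_measure.integrable_const_bound[OF finite_measure_pos_part[OF assms(1)]])
  show "AE x in pos_part \<nu>. norm (f x) \<le> A" using assms(3) by simp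
  show "f \<in> borel_measurable (pos_part \<nu>)"
    by (subst measurable_cong_sets[OF sets_pos_part refl]) (rule assms(2))
qed

lemma neg_part_integrable:
  fixes f :: "'x::topological_space \<Rightarrow> real"
  assumes "\<nu> \<in> signed_measures" "f \<in> borel_measurable borel" "AE x in neg_part \<nu>. \<bar>f x\<bar> \<le> A"
  shows "integrable (neg_part \<nu>) f"
  using assms(3) unfolding neg_part_def
  by (rule pos_part_integrable[OF signed_measure_uminus[OF assms(1)] assms(2)])

lemma signed_integral_diff:
  fixes f g :: "'x::topological_space \<Rightarrow> real"
  assumes \<nu>: "\<nu> \<in> signed_measures"
    and f: "f \<in> borel_measurable borel" "\<And>x. \<bar>f x\<bar> \<le> A"
    and g: "g \<in> borel_measurable borel" "\<And>x. \<bar>g x\<bar> \<le> B"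
  shows "signed_integral \<nu> (\<lambda>x. f x - g x) = signed_integral \<nu> f - signed_integral \<nu> g"
  unfolding signed_integral_def
  using pos_part_integrable[OF \<nu> f(1) AE_I2[OF f(2)]] neg_part_integrable[OF \<nu> f(1) AE_I2[OF f(2)]]
    pos_part_integrable[OF \<nu> g(1) AE_I2[OF g(2)]] neg_part_integrable[OF \<nu> g(1) AE_I2[OF g(2)]]
  by simp

lemma signed_integral_bound:
  fixes f :: "'x::topological_space \<Rightarrow> real"
  assumes \<nu>: "\<nu> \<in> signed_measures"
    and f: "f \<in> borel_measurable borel" "AE x in pos_part \<nu>. \<bar>f x\<bar> \<le> A" "AE x in neg_part \<nu>. \<bar>f x\<bar> \<le> A"
  shows "\<bar>signed_integral \<nu> f\<bar> \<le> A * measure (variation \<nu>) UNIV"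
proof -
  interpret P: finite_measure "pos_part \<nu>" by (rule finite_measure_pos_part[OF \<nu>])
  interpret N: finite_measure "neg_part \<nu>" by (rule finite_measure_neg_part[OF \<nu>])
  note i = pos_part_integrable[OF \<nu> f(1,2)] neg_part_integrable[OF \<nu> f(1,3)]
  have "\<bar>integral\<^sup>L (pos_part \<nu>) f\<bar> \<le> (LINT x|pos_part \<nu>. \<bar>f x\<bar>)" by (rule integral_abs_bound)
  also have "\<dots> \<le> (LINT x|pos_part \<nu>. A)"
    by (rule integral_mono_AE[OF integrable_abs[OF i(1)] P.integrable_const f(2)])
  finally have 1: "\<bar>integral\<^sup>L (pos_part \<nu>) f\<bar> \<le> A * measure (pos_part \<nu>) UNIV" by (simp add: mult.commute)
  have "\<bar>integral\<^sup>L (neg_part \<nu>) f\<bar> \<le> (LINT x|neg_part \<nu>. \<bar>f x\<bar>)" by (rule integral_abs_bound)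
  also have "\<dots> \<le> (LINT x|neg_part \<nu>. A)"
    by (rule integral_mono_AE[OF integrable_abs[OF i(2)] N.integrable_const f(3)])
  finally have 2: "\<bar>integral\<^sup>L (neg_part \<nu>) f\<bar> \<le> A * measure (neg_part \<nu>) UNIV" by (simp add: mult.commute)
  have "measure (variation \<nu>) UNIV = measure (pos_part \<nu>) UNIV + measure (neg_part \<nu>) UNIV"
    by (rule measure_variation[OF \<nu>]) simp
  then have "A * measure (variation \<nu>) UNIV = A * measure (pos_part \<nu>) UNIV + A * measure (neg_part \<nu>) UNIV"
    by (simp add: distrib_left)
  then show ?thesis using 1 2 unfolding signed_integral_def by linarith
qed

text \<open>Uniform boundedness by Baire category: the closed sets \<open>F m\<close> exhaust the
  complete space of bounded continuous functions, so some \<open>F m\<close> contains a ball. This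
  bounds all functionals on the unit ball, and a test function that nearly attains the total
  variation turns the bound into one for the measures.\<close>

lemma weak_star_bounded:
  fixes \<nu> :: "nat \<Rightarrow> 'x::metric_space set \<Rightarrow> real"
  assumes cpt: "compact (UNIV :: 'x set)" and \<nu>: "\<And>k. \<nu> k \<in> signed_measures"
    and bdd: "\<And>g. continuous_on UNIV g \<Longrightarrow> \<exists>C. \<forall>k. \<bar>signed_integral (\<nu> k) g\<bar> \<le> C"
  shows "\<exists>R. \<forall>k. measure (variation (\<nu> k)) UNIV \<le> R"
proof -
  let ?I = "\<lambda>k (g :: 'x \<Rightarrow>\<^sub>C real). signed_integral (\<nu> k) (apply_bcontfun g)"
  let ?V = "\<lambda>k. measure (variation (\<nu> k)) UNIV"
  define F where "F = (\<lambda>m::nat. {g :: 'x \<Rightarrow>\<^sub>C real. \<forall>k. \<bar>?I k g\<bar> \<le> real m})"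
  have meas: "apply_bcontfun g \<in> borel_measurable borel" for g :: "'x \<Rightarrow>\<^sub>C real"
    by (rule borel_measurable_continuous_onI) (rule continuous_on_apply_bcontfun)
  have bd: "\<bar>apply_bcontfun g x\<bar> \<le> norm g" for g :: "'x \<Rightarrow>\<^sub>C real" and x
    using norm_bounded[of g x] by simp
  have diff: "?I k (g - h) = ?I k g - ?I k h" for k g h
  proof -
    have "apply_bcontfun (g - h) = (\<lambda>x. apply_bcontfun g x - apply_bcontfun h x)" by (simp add: fun_eq_iff)
    then show ?thesis using signed_integral_diff[OF \<nu> meas bd meas bd] by simp
  qed
  have bnd: "\<bar>?I k g\<bar> \<le> norm g * ?V k" for k g
    by (rule signed_integral_bound[OF \<nu> meas]) (simp_all add: bd)
  have cont: "continuous_on UNIV (?I k)" for k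
  proof (rule continuous_onI)
    fix g and e :: real assume e: "e > 0"
    have V0: "?V k \<ge> 0" by simp
    show "\<exists>d>0. \<forall>h\<in>UNIV. dist h g < d \<longrightarrow> dist (?I k h) (?I k g) \<le> e"
    proof (intro exI[of _ "e / (?V k + 1)"] conjI ballI impI)
      fix h assume "dist h g < e / (?V k + 1)"
      then have "norm (h - g) * (?V k + 1) \<le> e" using V0 by (simp add: dist_norm field_simps)
      moreover have "norm (h - g) * ?V k \<le> norm (h - g) * (?V k + 1)" by (intro mult_left_mono) auto
      ultimately show "dist (?I k h) (?I k g) \<le> e" using bnd[of k "h - g"] unfolding dist_real_def diff by linarith
    qed (rule divide_pos_pos, use V0 e in linarith, use V0 e in linarith)
  qed
  have closedF: "closed (F m)" for m
  proof -
    have "F m = (\<Inter>k. {g. \<bar>?I k g\<bar> \<le> real m})" by (auto simp: F_def)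
    moreover have "closed {g. \<bar>?I k g\<bar> \<le> real m}" for k
      by (intro closed_Collect_le continuous_intros cont)
    ultimately show ?thesis by auto
  qed
  have UN: "(\<Union>m. F m) = UNIV"
  proof -
    have "\<exists>m. g \<in> F m" for g
    proof -
      obtain C where C: "\<And>k. \<bar>?I k g\<bar> \<le> C"
        using bdd[of "apply_bcontfun g"] continuous_on_apply_bcontfun[of UNIV g] by auto
      obtain m :: nat where "C \<le> real m" using real_arch_simple by blast
      then have "\<bar>?I k g\<bar> \<le> real m" for k using C[of k] by linarith
      then show ?thesis by (auto simp: F_def)
    qed
    then show ?thesis by auto
  qed
  have "\<exists>m. interior (F m) \<noteq> {}"
  proof (rule ccontr)
    assume "\<not> ?thesis"
    then have "euclidean interior_of (\<Union>(range F)) = {}"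
      using Baire_category_alt[of euclidean "range F"] closedF completely_metrizable_space_euclidean
      by (auto simp: euclidean_interior_of)
    then show False using UN by (auto simp: euclidean_interior_of)
  qed
  then obtain m g0 where "g0 \<in> interior (F m)" by blast
  then obtain r where r: "r > 0" "ball g0 r \<subseteq> F m" by (meson mem_interior)
  \<comment> \<open>\<open>(r / 2) * g\<close> is a difference of two members of \<open>F m\<close>,
    so its integral is at most \<open>2 * m\<close>; dividing by \<open>r / 2\<close> gives
    \<open>4 * m / r\<close>. The 1 is the loss in nearly attaining the norm.\<close>
  have "?V k \<le> 4 * real m / r + 1" for k
  proof -
    obtain g where g: "continuous_on UNIV g" "\<And>x. \<bar>g x\<bar> \<le> 1" "?V k - 1 \<le> signed_integral (\<nu> k) g"
      using signed_measure_norm_attained[OF \<nu>, of 1 k] by auto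
    define G where "G = Bcontfun g"
    have G: "apply_bcontfun G = g"
      unfolding G_def using g(1,2) by (intro Bcontfun_inverse) (auto simp: bcontfun_def bounded_iff)
    have nG: "norm G \<le> 1"
      by (rule norm_bound) (use G g(2) in auto)
    define h where "h = g0 - (- (r / 2)) *\<^sub>R G"
    have "norm ((r / 2) *\<^sub>R G) \<le> r / 2 * 1" using nG r by (simp add: mult_left_mono)
    then have "h \<in> ball g0 r" using r by (simp add: h_def dist_norm)
    then have "h \<in> F m" "g0 \<in> F m" using r by auto
    then have "\<bar>?I k h\<bar> \<le> real m" "\<bar>?I k g0\<bar> \<le> real m" by (auto simp: F_def)
    then have "\<bar>?I k (h - g0)\<bar> \<le> 2 * real m" unfolding diff by linarith
    moreover have "apply_bcontfun (h - g0) = (\<lambda>x. (r / 2) * g x)" by (auto simp: h_def G fun_eq_iff)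
    then have "?I k (h - g0) = (r / 2) * signed_integral (\<nu> k) g"
      unfolding signed_integral_def by (simp add: right_diff_distrib)
    ultimately have "r / 2 * \<bar>signed_integral (\<nu> k) g\<bar> \<le> 2 * real m" using r by (simp add: abs_mult)
    then have "signed_integral (\<nu> k) g \<le> 4 * real m / r" using r by (simp add: field_simps abs_le_iff) (smt (verit) mult_left_mono)
    then show ?thesis using g(3) by simp
  qed
  then show ?thesis by blast
qed

section \<open>Circle bundles and families of fibre maps\<close>

lemma circle_bundle_orientation:
  "oriented_circle_subbundle p E \<Longrightarrow> is_orientation (fibre p E x) (orient E x)"
  unfolding oriented_circle_subbundle_def by blast

lemma circle_bundle_parametrization:
  "oriented_circle_subbundle p E \<Longrightarrow> c \<in> orient E x \<Longrightarrow> circle_parametrization (fibre p E x) c"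
  using circle_bundle_orientation is_orientation_parametrization by blast

lemma circle_bundle_mem:
  assumes "oriented_circle_subbundle p E" "c \<in> orient E x"
  shows "c (circle_point s) \<in> fibre p E x"
  by (rule circle_parametrization_mem[OF circle_bundle_parametrization[OF assms]])

text \<open>Passes to \<open>homeomorphism\<close> with a named inverse \<open>\<zeta>\<close>,
  because \<open>snd (\<zeta> v)\<close> is used below as the circle coordinate of
  \<open>v\<close>.\<close>

lemma circle_bundle_trivialization:
  assumes "oriented_circle_subbundle p E"
  shows "\<exists>U \<tau> \<zeta>. open U \<and> x \<in> U \<and> homeomorphism (U \<times> circle) (total E \<inter> p -` U) \<tau> \<zeta> \<and>
    (\<forall>y\<in>U. (\<forall>z\<in>circle. p (\<tau> (y, z)) = y) \<and> (\<lambda>z. \<tau> (y, z)) \<in> orient E y)"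
proof -
  obtain U \<tau> where U: "open U" "x \<in> U"
    and h: "homeomorphic_map (prod_topology (top_of_set U) (top_of_set circle))
      (top_of_set (total E \<inter> p -` U)) \<tau>"
    and f: "\<forall>y\<in>U. (\<forall>z\<in>circle. p (\<tau> (y, z)) = y) \<and> (\<lambda>z. \<tau> (y, z)) \<in> orient E y"
    using assms unfolding oriented_circle_subbundle_def by blast
  obtain \<zeta> where "homeomorphic_maps (top_of_set (U \<times> circle)) (top_of_set (total E \<inter> p -` U)) \<tau> \<zeta>"
    using h unfolding homeomorphic_map_maps prod_topology_subtopology_eu by blast
  then have "homeomorphism (U \<times> circle) (total E \<inter> p -` U) \<tau> \<zeta>"
  proof -
    assume m: "homeomorphic_maps (top_of_set (U \<times> circle)) (top_of_set (total E \<inter> p -` U)) \<tau> \<zeta>"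
    have c: "continuous_map (top_of_set (U \<times> circle)) (top_of_set (total E \<inter> p -` U)) \<tau>"
      "continuous_map (top_of_set (total E \<inter> p -` U)) (top_of_set (U \<times> circle)) \<zeta>"
      using m unfolding homeomorphic_maps_def by blast+
    show ?thesis
    proof (rule homeomorphismI)
      show "continuous_on (U \<times> circle) \<tau>" "continuous_on (total E \<inter> p -` U) \<zeta>"
        using c by (simp_all add: continuous_map_in_subtopology)
      show "\<tau> ` (U \<times> circle) \<subseteq> total E \<inter> p -` U" "\<zeta> ` (total E \<inter> p -` U) \<subseteq> U \<times> circle"
        using c[THEN continuous_map_image_subset_topspace] by simp_all
      show "\<zeta> (\<tau> v) = v" if "v \<in> U \<times> circle" for v
        using m that unfolding homeomorphic_maps_def topspace_euclidean_subtopology by blast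
      show "\<tau> (\<zeta> v) = v" if "v \<in> total E \<inter> p -` U" for v
        using m that unfolding homeomorphic_maps_def topspace_euclidean_subtopology by blast
    qed
  qed
  then show ?thesis using U f by blast
qed

text \<open>Special case of \<open>algebraic_length_family\<close> for the family of identity maps,
  which becomes a degree one map when the source is read in \<open>c\<close> and the target in
  \<open>c'\<close>.\<close>

lemma algebraic_length_reparametrize:
  assumes E: "oriented_circle_subbundle p E" and c: "c \<in> orient E x" "c' \<in> orient E x"
    and \<gamma>: "continuous_on {0..1} \<gamma>" "\<And>t. t \<in> {0..1} \<Longrightarrow> \<gamma> t \<in> fibre p E x"
  shows "\<bar>algebraic_length c' \<gamma> - algebraic_length c \<gamma>\<bar> \<le> 2"
proof -
  note P = circle_bundle_parametrization[OF E]
  have u: "\<gamma> 0 \<in> fibre p E x" using \<gamma>(2) by simp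
  have "\<bar>algebraic_length c' (\<lambda>t. \<gamma> t) - algebraic_length c' (\<lambda>t. \<gamma> 0) - algebraic_length c \<gamma>\<bar> \<le> 2"
  proof (rule algebraic_length_family[OF P[OF c(1)] P[OF c(2)], where g = "\<lambda>t u. u"])
    show "continuous_on ({0..1} \<times> fibre p E x) (\<lambda>(t, u). u)"
      by (auto simp: case_prod_unfold intro!: continuous_intros)
    show "\<exists>\<kappa>. degree_one \<kappa> \<and> (\<forall>s. c (circle_point s) = c' (circle_point (\<kappa> s)))"
      by (rule is_orientation_transition[OF circle_bundle_orientation[OF E] c(2,1)])
  qed (use \<gamma> u in auto)
  then show ?thesis using algebraic_length_const[OF P[OF c(2)] u, of "\<lambda>t. \<gamma> 0"] by simp
qed

text \<open>Covers paths of skew-products (\<open>S = T\<close>), their iterates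
  (\<open>S = T ^^ n\<close>) and conjugating families between different bundles
  (\<open>S = id\<close>). Expressing orientation through parametrizations makes composition
  immediate.\<close>

definition fibre_family ::
  "('g::topological_space \<Rightarrow> 'x) \<Rightarrow> ('x, 'g) oriented_bundle \<Rightarrow> ('x, 'g) oriented_bundle \<Rightarrow>
   ('x \<Rightarrow> 'x) \<Rightarrow> (real \<Rightarrow> 'g \<Rightarrow> 'g) \<Rightarrow> bool" where
  "fibre_family p E F S g \<longleftrightarrow> continuous_on ({0..1} \<times> total E) (\<lambda>(t, u). g t u) \<and>
    (\<forall>t\<in>{0..1}. (\<forall>u\<in>total E. g t u \<in> total F \<and> p (g t u) = S (p u)) \<and>
      (\<forall>x. \<forall>c\<in>orient E x. g t \<circ> c \<in> orient F (S x)))"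

lemma fibre_family_compose:
  assumes g: "fibre_family p E F S g" and k: "fibre_family p F G R k"
  shows "fibre_family p E G (R \<circ> S) (\<lambda>t. k t \<circ> g t)"
  unfolding fibre_family_def
proof (intro conjI ballI allI)
  have "continuous_on ({0..1} \<times> total E) (\<lambda>x. (fst x, g (fst x) (snd x)))"
    using g unfolding fibre_family_def case_prod_unfold by (intro continuous_intros) auto
  moreover have "(\<lambda>x. (fst x, g (fst x) (snd x))) ` ({0..1} \<times> total E) \<subseteq> {0..1} \<times> total F"
    using g unfolding fibre_family_def by auto
  ultimately show "continuous_on ({0..1} \<times> total E) (\<lambda>(t, u). (k t \<circ> g t) u)"
    using k continuous_on_compose2[of "{0..1} \<times> total F" "\<lambda>x. k (fst x) (snd x)" "{0..1} \<times> total E"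
      "\<lambda>x. (fst x, g (fst x) (snd x))"]
    unfolding fibre_family_def case_prod_unfold by simp
next
  fix t :: real and x c assume t: "t \<in> {0..1}" and c: "c \<in> orient E x"
  have "g t \<circ> c \<in> orient F (S x)" using g t c unfolding fibre_family_def by blast
  then have "k t \<circ> (g t \<circ> c) \<in> orient G (R (S x))" using k t unfolding fibre_family_def by blast
  then show "k t \<circ> g t \<circ> c \<in> orient G ((R \<circ> S) x)" by (simp add: comp_assoc)
qed (use g k in \<open>auto simp: fibre_family_def\<close>)

lemma fibre_family_id: "fibre_family p E E id (\<lambda>t. id)"
  unfolding fibre_family_def by (auto simp: case_prod_unfold intro!: continuous_intros)

lemma fibre_family_funpow:
  assumes "fibre_family p E E S f"
  shows "fibre_family p E E (S ^^ n) (\<lambda>t. f t ^^ n)"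
proof (induction n)
  case (Suc n)
  show ?case using fibre_family_compose[OF Suc assms] by (simp add: comp_def)
qed (use fibre_family_id[of p E] in \<open>simp add: id_def\<close>)

lemma fibre_family_fibre:
  assumes "fibre_family p E F S g" "t \<in> {0..1}" "u \<in> fibre p E x"
  shows "g t u \<in> fibre p F (S x)"
  using assms unfolding fibre_family_def fibre_def by auto

lemma fibre_family_path:
  assumes g: "fibre_family p E F S g" and \<delta>: "continuous_on {0..1} \<delta>" "\<And>t. t \<in> {0..1} \<Longrightarrow> \<delta> t \<in> total E"
  shows "continuous_on {0..1} (\<lambda>t. g t (\<delta> t))"
proof -
  have "continuous_on {0..1} (\<lambda>t. (t, \<delta> t))" using \<delta>(1) by (intro continuous_intros)
  moreover have "(\<lambda>t. (t, \<delta> t)) ` {0..1} \<subseteq> {0..1} \<times> total E" using \<delta>(2) by auto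
  ultimately show ?thesis
    using g continuous_on_compose2[of "{0..1} \<times> total E" "\<lambda>x. g (fst x) (snd x)" "{0..1}" "\<lambda>t. (t, \<delta> t)"]
    unfolding fibre_family_def case_prod_unfold by simp
qed

lemma fibre_family_orbit:
  assumes "fibre_family p E F S g" "u \<in> total E"
  shows "continuous_on {0..1} (\<lambda>t. g t u)"
  by (rule fibre_family_path[OF assms(1)]) (use assms(2) in auto)

lemma fibre_subset_total: "u \<in> fibre p E x \<Longrightarrow> u \<in> total E"
  by (simp add: fibre_def)

lemma fibre_family_length:
  assumes g: "fibre_family p E F S g" and E: "oriented_circle_subbundle p E"
    and F: "oriented_circle_subbundle p F"
    and c: "c \<in> orient E x" "c' \<in> orient F (S x)"
    and \<delta>: "continuous_on {0..1} \<delta>" "\<And>t. t \<in> {0..1} \<Longrightarrow> \<delta> t \<in> fibre p E x"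
    and u: "u \<in> fibre p E x"
  shows "\<bar>algebraic_length c' (\<lambda>t. g t (\<delta> t)) - algebraic_length c' (\<lambda>t. g t u)
    - algebraic_length c \<delta>\<bar> \<le> 2"
proof (rule algebraic_length_family[OF circle_bundle_parametrization[OF E c(1)]
      circle_bundle_parametrization[OF F c(2)]])
  show "continuous_on ({0..1} \<times> fibre p E x) (\<lambda>(t, u). g t u)"
    by (rule continuous_on_subset[of "{0..1} \<times> total E"])
      (use g in \<open>auto simp: fibre_family_def fibre_def\<close>)
  fix t :: real assume t: "t \<in> {0..1}"
  have "g t \<circ> c \<in> orient F (S x)" using g t c(1) unfolding fibre_family_def by blast
  from is_orientation_transition[OF circle_bundle_orientation[OF F] c(2) this]
  show "\<exists>\<kappa>. degree_one \<kappa> \<and> (\<forall>s. g t (c (circle_point s)) = c' (circle_point (\<kappa> s)))" by simp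
qed (use \<delta> u in auto)

text \<open>Changing the starting point costs 2, changing the parametrization another 2. This is why
  the rotation number depends on neither.\<close>

lemma fibre_family_length_base_point:
  assumes g: "fibre_family p E F S g" and E: "oriented_circle_subbundle p E"
    and F: "oriented_circle_subbundle p F"
    and c: "c \<in> orient F (S x)" "c' \<in> orient F (S x)" and u: "u \<in> fibre p E x" "v \<in> fibre p E x"
  shows "\<bar>algebraic_length c (\<lambda>t. g t u) - algebraic_length c' (\<lambda>t. g t v)\<bar> \<le> 4"
proof -
  obtain c0 where c0: "c0 \<in> orient E x"
    using is_orientation_nonempty[OF circle_bundle_orientation[OF E]] by blast
  have 1: "\<bar>algebraic_length c (\<lambda>t. g t u) - algebraic_length c (\<lambda>t. g t v) - algebraic_length c0 (\<lambda>t. u)\<bar> \<le> 2"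
    by (rule fibre_family_length[OF g E F c0 c(1)]) (use u in auto)
  have 2: "algebraic_length c0 (\<lambda>t. u) = 0"
    by (rule algebraic_length_const[OF circle_bundle_parametrization[OF E c0] u(1)]) simp
  have "\<bar>algebraic_length c (\<lambda>t. g t v) - algebraic_length c' (\<lambda>t. g t v)\<bar> \<le> 2"
    by (rule algebraic_length_reparametrize[OF F c(2,1)
          fibre_family_orbit[OF g fibre_subset_total[OF u(2)]] fibre_family_fibre[OF g _ u(2)]])
  then show ?thesis using 1 2 by linarith
qed

section \<open>Uniform estimates over a compact base\<close>

locale compact_base =
  fixes p :: "'g::metric_space \<Rightarrow> 'x::metric_space"
  assumes compact_base: "compact (UNIV :: 'x set)" and p_continuous: "continuous_on UNIV p"
begin

lemma compact_cball_base: "compact (cball (x :: 'x) r)"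
  using compact_Int_closed[OF compact_base closed_cball[of x r]] by simp

text \<open>The factor 2 leaves room for a second base point within \<open>r\<close> of one that is
  within \<open>r\<close> of \<open>x\<close>. Over the closed ball the bundle is the image of a
  compact product, so that the circle coordinate is uniformly continuous there.\<close>

lemma trivialization_neighbourhood:
  assumes E: "oriented_circle_subbundle p E"
  shows "\<exists>U \<tau> \<zeta> r. r > 0 \<and> cball x (2 * r) \<subseteq> U \<and> open U \<and> x \<in> U \<and>
    homeomorphism (U \<times> circle) (total E \<inter> p -` U) \<tau> \<zeta> \<and>
    compact (total E \<inter> p -` cball x (2 * r)) \<and>
    (\<forall>y\<in>U. (\<forall>z\<in>circle. p (\<tau> (y, z)) = y) \<and> (\<lambda>z. \<tau> (y, z)) \<in> orient E y)"
proof -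
  obtain U \<tau> \<zeta> where U: "open U" "x \<in> U" and h: "homeomorphism (U \<times> circle) (total E \<inter> p -` U) \<tau> \<zeta>"
    and f: "\<forall>y\<in>U. (\<forall>z\<in>circle. p (\<tau> (y, z)) = y) \<and> (\<lambda>z. \<tau> (y, z)) \<in> orient E y"
    using circle_bundle_trivialization[OF E, of x] by blast
  obtain s where s: "s > 0" "cball x s \<subseteq> U" using U open_contains_cball by blast
  let ?C = "cball x s"
  have "total E \<inter> p -` ?C = \<tau> ` (?C \<times> circle)"
  proof (intro set_eqI iffI)
    fix v assume v: "v \<in> total E \<inter> p -` ?C"
    then have vU: "v \<in> total E \<inter> p -` U" using s by auto
    have "\<zeta> v \<in> \<zeta> ` (total E \<inter> p -` U)" using vU by (rule imageI)
    then have z: "\<zeta> v \<in> U \<times> circle" by (simp only: homeomorphism_image2[OF h])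
    have z': "\<tau> (\<zeta> v) = v" by (rule homeomorphism_apply2[OF h vU])
    obtain y w where yw: "\<zeta> v = (y, w)" by (cases "\<zeta> v")
    then have "p v = y" using z z' f by auto
    then have "\<zeta> v \<in> ?C \<times> circle" using v z yw by auto
    then have "\<tau> (\<zeta> v) \<in> \<tau> ` (?C \<times> circle)" by (rule imageI)
    then show "v \<in> \<tau> ` (?C \<times> circle)" using z' by simp
  next
    fix v assume "v \<in> \<tau> ` (?C \<times> circle)"
    then obtain y w where yw: "y \<in> ?C" "w \<in> circle" "v = \<tau> (y, w)" by auto
    then have yU: "y \<in> U" using s by auto
    then have "v \<in> \<tau> ` (U \<times> circle)" using yw by auto
    then have "v \<in> total E" using homeomorphism_image1[OF h] by simp
    moreover have "p v = y" using f yU yw by auto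
    ultimately show "v \<in> total E \<inter> p -` ?C" using yw by simp
  qed
  moreover have "compact (\<tau> ` (?C \<times> circle))"
  proof (rule compact_continuous_image)
    show "continuous_on (?C \<times> circle) \<tau>"
      by (rule continuous_on_subset[OF homeomorphism_cont1[OF h]]) (use s in auto)
    show "compact (?C \<times> circle)" by (intro compact_Times compact_cball_base compact_sphere)
  qed
  ultimately show ?thesis using U h f s
    by (intro exI[of _ U] exI[of _ \<tau>] exI[of _ \<zeta>] exI[of _ "s / 2"]) auto
qed

lemma compact_total:
  assumes E: "oriented_circle_subbundle p E"
  shows "compact (total E)"
proof -
  have "\<exists>r>0. compact (total E \<inter> p -` cball x r)" for x
    using trivialization_neighbourhood[OF E, of x] by (meson mult_pos_pos zero_less_numeral)
  then obtain r where r: "\<And>x. r x > 0" "\<And>x. compact (total E \<inter> p -` cball x (r x))" by metis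
  obtain D where D: "finite D" "UNIV \<subseteq> (\<Union>x\<in>D. ball x (r x))"
  proof (rule compactE_image[OF compact_base, of UNIV "\<lambda>x. ball x (r x)"])
    show "UNIV \<subseteq> (\<Union>x\<in>UNIV. ball x (r x))" using r(1) by (auto intro: centre_in_ball[THEN iffD2])
  qed auto
  have "total E = (\<Union>x\<in>D. total E \<inter> p -` cball x (r x))"
  proof (intro set_eqI iffI)
    fix v assume v: "v \<in> total E"
    obtain x where "x \<in> D" "p v \<in> ball x (r x)" using D(2) by blast
    then show "v \<in> (\<Union>x\<in>D. total E \<inter> p -` cball x (r x))"
      using v ball_subset_cball by (intro UN_I[of x]) auto
  qed auto
  then show ?thesis using D(1) r(2) compact_UN[of D] by metis
qed

text \<open>In a common trivialization the circle coordinates of the two paths stay within distance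
  1, so their lengths differ by at most 1; returning to the parametrizations \<open>c\<close> and
  \<open>c'\<close> costs 2 each, hence 5. A finite cover of the base makes \<open>\<delta>\<close>
  uniform.\<close>

lemma close_paths:
  assumes E: "oriented_circle_subbundle p E"
  shows "\<exists>\<delta>>0. \<forall>y y' c c' \<gamma> \<gamma>'. c \<in> orient E y \<longrightarrow> c' \<in> orient E y' \<longrightarrow>
    continuous_on {0..1} \<gamma> \<longrightarrow> continuous_on {0..1} \<gamma>' \<longrightarrow>
    (\<forall>t\<in>{0..1}. \<gamma> t \<in> fibre p E y \<and> \<gamma>' t \<in> fibre p E y' \<and> dist (\<gamma> t) (\<gamma>' t) < \<delta>) \<longrightarrow>
    \<bar>algebraic_length c \<gamma> - algebraic_length c' \<gamma>'\<bar> \<le> 5"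
proof -
  define good where "good = (\<lambda>x \<delta>. \<forall>y y' c c' \<gamma> \<gamma>'. y \<in> ball x \<delta> \<longrightarrow> c \<in> orient E y \<longrightarrow> c' \<in> orient E y' \<longrightarrow>
    continuous_on {0..1} \<gamma> \<longrightarrow> continuous_on {0..1} \<gamma>' \<longrightarrow>
    (\<forall>t\<in>{0..1::real}. \<gamma> t \<in> fibre p E y \<and> \<gamma>' t \<in> fibre p E y' \<and> dist (\<gamma> t) (\<gamma>' t) < \<delta>) \<longrightarrow>
    \<bar>algebraic_length c \<gamma> - algebraic_length c' \<gamma>'\<bar> \<le> 5)"
  have local: "\<exists>\<delta>>0. good x \<delta>" for x
  proof -
    obtain U \<tau> \<zeta> r where r: "r > 0" "cball x (2 * r) \<subseteq> U" and
      h: "homeomorphism (U \<times> circle) (total E \<inter> p -` U) \<tau> \<zeta>" and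
      K: "compact (total E \<inter> p -` cball x (2 * r))" and
      f: "\<And>y. y \<in> U \<Longrightarrow> (\<lambda>z. \<tau> (y, z)) \<in> orient E y" "\<And>y z. y \<in> U \<Longrightarrow> z \<in> circle \<Longrightarrow> p (\<tau> (y, z)) = y"
      using trivialization_neighbourhood[OF E, of x] by blast
    let ?K = "total E \<inter> p -` cball x (2 * r)"
    have cont: "continuous_on ?K (\<lambda>v. snd (\<zeta> v))"
      by (intro continuous_on_snd continuous_on_subset[OF homeomorphism_cont2[OF h]]) (use r in auto)
    obtain d1 where d1: "d1 > 0" "\<And>v v'. v \<in> ?K \<Longrightarrow> v' \<in> ?K \<Longrightarrow> dist v' v < d1 \<Longrightarrow> dist (snd (\<zeta> v')) (snd (\<zeta> v)) < 1"
      using compact_uniformly_continuous[OF cont K] unfolding uniformly_continuous_on_def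
      by (metis zero_less_one)
    have "uniformly_continuous_on (total E) p"
      by (rule compact_uniformly_continuous[OF continuous_on_subset[OF p_continuous] compact_total[OF E]]) auto
    then obtain d2 where d2: "d2 > 0"
      "\<And>v v'. v \<in> total E \<Longrightarrow> v' \<in> total E \<Longrightarrow> dist v' v < d2 \<Longrightarrow> dist (p v') (p v) < r"
      using r(1) unfolding uniformly_continuous_on_def by metis
    \<comment> \<open>\<open>r\<close> bounds the distance of \<open>y\<close> from the centre,
      \<open>d2\<close> keeps the two base points within \<open>r\<close> of each other, hence both
      in the chart, and \<open>d1\<close> keeps the circle coordinates within 1.\<close>
    define \<delta> where "\<delta> = min r (min d1 d2)"
    have coord: "snd (\<zeta> v) \<in> circle" "v = \<tau> (p v, snd (\<zeta> v))" if "v \<in> total E" "p v \<in> U" for v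
    proof -
      have v: "v \<in> total E \<inter> p -` U" using that by simp
      have "\<zeta> v \<in> \<zeta> ` (total E \<inter> p -` U)" using v by (rule imageI)
      then have z: "\<zeta> v \<in> U \<times> circle" by (simp only: homeomorphism_image2[OF h])
      have z': "\<tau> (\<zeta> v) = v" by (rule homeomorphism_apply2[OF h v])
      obtain y w where yw: "\<zeta> v = (y, w)" by (cases "\<zeta> v")
      then have "p v = y" using z z' f(2)[of y w] by auto
      then show "snd (\<zeta> v) \<in> circle" "v = \<tau> (p v, snd (\<zeta> v))" using z z' yw by auto
    qed
    have "good x \<delta>" unfolding good_def
    proof (intro allI impI)
      fix y y' c c' and \<gamma> \<gamma>' :: "real \<Rightarrow> 'g"
      assume y: "y \<in> ball x \<delta>" and c: "c \<in> orient E y" "c' \<in> orient E y'"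
        and \<gamma>: "continuous_on {0..1} \<gamma>" "continuous_on {0..1} \<gamma>'"
        and m: "\<forall>t\<in>{0..1}. \<gamma> t \<in> fibre p E y \<and> \<gamma>' t \<in> fibre p E y' \<and> dist (\<gamma> t) (\<gamma>' t) < \<delta>"
      have \<gamma>E: "\<gamma> t \<in> total E" "p (\<gamma> t) = y" "\<gamma>' t \<in> total E" "p (\<gamma>' t) = y'" "dist (\<gamma> t) (\<gamma>' t) < \<delta>"
        if "t \<in> {0..1}" for t using m that by (auto simp: fibre_def)
      have "dist y y' < r" using \<gamma>E[of 0] d2(2)[of "\<gamma>' 0" "\<gamma> 0"] by (simp add: \<delta>_def)
      moreover have "dist x y < r" using y by (simp add: \<delta>_def)
      ultimately have yy: "y \<in> cball x (2 * r)" "y' \<in> cball x (2 * r)"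
        using dist_triangle[of x y' y] r(1) by auto
      then have yU: "y \<in> U" "y' \<in> U" using r(2) by auto
      define z where "z = (\<lambda>t. snd (\<zeta> (\<gamma> t)))"
      define z' where "z' = (\<lambda>t. snd (\<zeta> (\<gamma>' t)))"
      have inK: "\<gamma> t \<in> ?K" "\<gamma>' t \<in> ?K" if "t \<in> {0..1}" for t using \<gamma>E[OF that] yy by auto
      have zc: "continuous_on {0..1} z" unfolding z_def
        by (rule continuous_on_compose2[OF cont \<gamma>(1)]) (use inK in auto)
      have zc': "continuous_on {0..1} z'" unfolding z'_def
        by (rule continuous_on_compose2[OF cont \<gamma>(2)]) (use inK in auto)
      have zz: "z t \<in> circle" "z' t \<in> circle" "\<gamma> t = \<tau> (y, z t)" "\<gamma>' t = \<tau> (y', z' t)" if "t \<in> {0..1}" for t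
        using coord[of "\<gamma> t"] coord[of "\<gamma>' t"] \<gamma>E[OF that] yU unfolding z_def z'_def by simp_all
      let ?c = "\<lambda>z. \<tau> (y, z)" and ?c' = "\<lambda>z. \<tau> (y', z)"
      have 1: "\<bar>algebraic_length ?c (\<lambda>t. ?c (z t)) - algebraic_length ?c' (\<lambda>t. ?c' (z' t))\<bar> \<le> 1"
      proof (rule algebraic_length_close[OF _ _ zc _ zc'])
        show "inj_on ?c circle" "inj_on ?c' circle"
          using circle_parametrization_inj[OF circle_bundle_parametrization[OF E f(1)]] yU by blast+
        show "z ` {0..1} \<subseteq> circle" "z' ` {0..1} \<subseteq> circle" using zz(1,2) by blast+
        show "dist (z t) (z' t) < 1" if "t \<in> {0..1}" for t
          unfolding z_def z'_def
          by (rule d1(2)[OF inK(2)[OF that] inK(1)[OF that]]) (use \<gamma>E(5)[OF that] in \<open>simp add: \<delta>_def\<close>)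
      qed
      have 2: "algebraic_length ?c (\<lambda>t. ?c (z t)) = algebraic_length ?c \<gamma>"
        "algebraic_length ?c' (\<lambda>t. ?c' (z' t)) = algebraic_length ?c' \<gamma>'"
        by (rule algebraic_length_cong, simp add: zz(3,4))+
      have 3: "\<bar>algebraic_length ?c \<gamma> - algebraic_length c \<gamma>\<bar> \<le> 2"
        by (rule algebraic_length_reparametrize[OF E c(1) f(1)[OF yU(1)] \<gamma>(1)]) (use m in blast)
      have 4: "\<bar>algebraic_length ?c' \<gamma>' - algebraic_length c' \<gamma>'\<bar> \<le> 2"
        by (rule algebraic_length_reparametrize[OF E c(2) f(1)[OF yU(2)] \<gamma>(2)]) (use m in blast)
      show "\<bar>algebraic_length c \<gamma> - algebraic_length c' \<gamma>'\<bar> \<le> 5" using 1 2 3 4 by linarith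
    qed
    moreover have "\<delta> > 0" using r d1 d2 by (simp add: \<delta>_def)
    ultimately show ?thesis by blast
  qed
  obtain d where d: "\<And>x. d x > 0" "\<And>x. good x (d x)" using local by metis
  obtain D where D: "finite D" "UNIV \<subseteq> (\<Union>x\<in>D. ball x (d x))"
  proof (rule compactE_image[OF compact_base, of UNIV "\<lambda>x. ball x (d x)"])
    show "UNIV \<subseteq> (\<Union>x\<in>UNIV. ball x (d x))" using d(1) by (auto intro: centre_in_ball[THEN iffD2])
  qed auto
  have Dne: "D \<noteq> {}" using D(2) by auto
  define \<delta> where "\<delta> = Min (d ` D)"
  have \<delta>: "\<delta> > 0" using D(1) Dne d(1) by (simp add: \<delta>_def)
  show ?thesis
  proof (intro exI[of _ \<delta>] conjI \<delta> allI impI)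
    fix y y' c c' and \<gamma> \<gamma>' :: "real \<Rightarrow> 'g"
    assume c: "c \<in> orient E y" "c' \<in> orient E y'" "continuous_on {0..1} \<gamma>" "continuous_on {0..1} \<gamma>'"
      and m: "\<forall>t\<in>{0..1}. \<gamma> t \<in> fibre p E y \<and> \<gamma>' t \<in> fibre p E y' \<and> dist (\<gamma> t) (\<gamma>' t) < \<delta>"
    obtain x where x: "x \<in> D" "y \<in> ball x (d x)" using D(2) by blast
    have "\<delta> \<le> d x" using x(1) D(1) by (simp add: \<delta>_def)
    then have "\<forall>t\<in>{0..1}. \<gamma> t \<in> fibre p E y \<and> \<gamma>' t \<in> fibre p E y' \<and> dist (\<gamma> t) (\<gamma>' t) < d x"
      using m by fastforce
    then show "\<bar>algebraic_length c \<gamma> - algebraic_length c' \<gamma>'\<bar> \<le> 5"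
      using d(2)[of x] c x(2) unfolding good_def by metis
  qed
qed

end

section \<open>Rotation numbers of fibre families\<close>

text \<open>A lift exists over the whole square, and the increments of a function around the
  boundary of a square cancel. Homotopy invariance rests on this.\<close>

lemma algebraic_length_square:
  assumes c: "circle_parametrization A c" and X: "continuous_on ({0..1} \<times> {0..1}) (\<lambda>(s, t). X s t)"
    "\<And>s t. s \<in> {0..1} \<Longrightarrow> t \<in> {0..1} \<Longrightarrow> X s t \<in> A"
  shows "algebraic_length c (\<lambda>t. X 1 t) - algebraic_length c (\<lambda>t. X 0 t) =
    algebraic_length c (\<lambda>s. X s 1) - algebraic_length c (\<lambda>s. X s (0 :: real))"
proof -
  let ?S = "{0..1::real} \<times> {0..1::real}"
  have "(\<lambda>(s, t). X s t) ` ?S \<subseteq> A" using X(2) by auto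
  moreover have "convex ?S" by (intro convex_Times convex_real_interval)
  ultimately obtain g where g: "continuous_on ?S g" "\<And>x. x \<in> ?S \<Longrightarrow> (\<lambda>(s, t). X s t) x = c (circle_point (g x))"
    using circle_parametrization_lift[OF c X(1)] by blast
  have h: "algebraic_length c (\<lambda>t. X s t) = g (s, 1) - g (s, 0)" if "s \<in> {0..1}" for s
  proof (rule algebraic_length_eq[OF circle_parametrization_inj[OF c]])
    have "continuous_on {0..1} (\<lambda>t. g (s, t))"
      by (rule continuous_on_compose2[OF g(1)]) (use that in \<open>auto intro!: continuous_intros\<close>)
    then show "path_lift c (\<lambda>t. X s t) (\<lambda>t. g (s, t))" using g(2) that by (auto simp: path_lift_def)
  qed
  have v: "algebraic_length c (\<lambda>s. X s t) = g (1, t) - g (0, t)" if "t \<in> {0..1}" for t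
  proof (rule algebraic_length_eq[OF circle_parametrization_inj[OF c]])
    have "continuous_on {0..1} (\<lambda>s. g (s, t))"
      by (rule continuous_on_compose2[OF g(1)]) (use that in \<open>auto intro!: continuous_intros\<close>)
    then show "path_lift c (\<lambda>s. X s t) (\<lambda>s. g (s, t))" using g(2) that by (auto simp: path_lift_def)
  qed
  show ?thesis using h[of 0] h[of 1] v[of 0] v[of 1] by simp
qed

lemma fibre_family_funpow_total:
  assumes "fibre_family p E E T f" "t \<in> {0..1}" "u \<in> total E"
  shows "(f t ^^ n) u \<in> total E"
  using fibre_family_funpow[OF assms(1), of n] assms(2,3) unfolding fibre_family_def by blast

context compact_base
begin

lemma fibre_family_uniformly_continuous:
  assumes E: "oriented_circle_subbundle p E" and g: "fibre_family p E F S g" and d: "\<delta> > 0"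
  shows "\<exists>\<eta>>0. \<forall>t\<in>{0..1}. \<forall>u\<in>total E. \<forall>u'\<in>total E. dist u u' < \<eta> \<longrightarrow> dist (g t u) (g t u') < \<delta>"
proof -
  have "uniformly_continuous_on ({0..1} \<times> total E) (\<lambda>(t, u). g t u)"
    by (rule compact_uniformly_continuous)
      (use g compact_total[OF E] in \<open>auto simp: fibre_family_def intro!: compact_Times\<close>)
  then obtain \<eta> where "\<eta> > 0" and \<eta>: "\<And>x x'. x \<in> {0..1} \<times> total E \<Longrightarrow> x' \<in> {0..1} \<times> total E \<Longrightarrow>
    dist x' x < \<eta> \<Longrightarrow> dist ((\<lambda>(t, u). g t u) x') ((\<lambda>(t, u). g t u) x) < \<delta>"
    unfolding uniformly_continuous_on_def using d by metis
  have "dist (g t u) (g t u') < \<delta>" if "t \<in> {0..1}" "u \<in> total E" "u' \<in> total E" "dist u u' < \<eta>" for t u u'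
    using \<eta>[of "(t, u')" "(t, u)"] that by (simp add: dist_Pair_Pair)
  then show ?thesis using \<open>\<eta> > 0\<close> by blast
qed

text \<open>Orbits of nearby points are close for all times, so their lengths differ by at most 5; a
  finite net in the compact total space then bounds them all, without any continuity of the
  length.\<close>

lemma fibre_family_length_bounded:
  assumes B: "oriented_circle_subbundle p B" and E: "oriented_circle_subbundle p E"
    and k: "fibre_family p B E S k"
  shows "\<exists>M\<ge>0. \<forall>x c u. c \<in> orient E (S x) \<longrightarrow> u \<in> fibre p B x \<longrightarrow> \<bar>algebraic_length c (\<lambda>t. k t u)\<bar> \<le> M"
proof -
  obtain \<delta> where "\<delta> > 0" and \<delta>: "\<And>y y' c c' \<gamma> \<gamma>'. c \<in> orient E y \<Longrightarrow> c' \<in> orient E y' \<Longrightarrow>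
    continuous_on {0..1} \<gamma> \<Longrightarrow> continuous_on {0..1} \<gamma>' \<Longrightarrow>
    (\<forall>t\<in>{0..1}. \<gamma> t \<in> fibre p E y \<and> \<gamma>' t \<in> fibre p E y' \<and> dist (\<gamma> t) (\<gamma>' t) < \<delta>) \<Longrightarrow>
    \<bar>algebraic_length c \<gamma> - algebraic_length c' \<gamma>'\<bar> \<le> 5"
    using close_paths[OF E] by (metis (no_types))
  obtain \<eta> where "\<eta> > 0" and \<eta>: "\<And>t u u'. t \<in> {0..1} \<Longrightarrow> u \<in> total B \<Longrightarrow> u' \<in> total B \<Longrightarrow> dist u u' < \<eta> \<Longrightarrow>
    dist (k t u) (k t u') < \<delta>"
    using fibre_family_uniformly_continuous[OF B k \<open>\<delta> > 0\<close>] by blast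
  obtain D where D: "D \<subseteq> total B" "finite D" "total B \<subseteq> (\<Union>u\<in>D. ball u \<eta>)"
  proof (rule compactE_image[OF compact_total[OF B], of "total B" "\<lambda>u. ball u \<eta>"])
    show "total B \<subseteq> (\<Union>u\<in>total B. ball u \<eta>)" using \<open>\<eta> > 0\<close> by (auto intro: centre_in_ball[THEN iffD2])
  qed auto
  define c0 where "c0 = (\<lambda>y. SOME c. c \<in> orient E y)"
  have c0: "c0 y \<in> orient E y" for y
    unfolding c0_def using is_orientation_nonempty[OF circle_bundle_orientation[OF E]] some_in_eq by metis
  define L where "L = (\<lambda>u. \<bar>algebraic_length (c0 (S (p u))) (\<lambda>t. k t u)\<bar>)"
  define M where "M = (\<Sum>u\<in>D. L u) + 5"
  have "\<bar>algebraic_length c (\<lambda>t. k t u)\<bar> \<le> M" if c: "c \<in> orient E (S x)" and u: "u \<in> fibre p B x" for x c u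
  proof -
    have uB: "u \<in> total B" "p u = x" using u by (auto simp: fibre_def)
    then obtain d where d: "d \<in> D" "dist d u < \<eta>" using D(3) by auto
    have dB: "d \<in> total B" using d D by auto
    have "\<bar>algebraic_length c (\<lambda>t. k t u) - algebraic_length (c0 (S (p d))) (\<lambda>t. k t d)\<bar> \<le> 5"
    proof (rule \<delta>[OF c c0 fibre_family_orbit[OF k uB(1)] fibre_family_orbit[OF k dB]], intro ballI conjI)
      fix t :: real assume t: "t \<in> {0..1}"
      show "k t u \<in> fibre p E (S x)" by (rule fibre_family_fibre[OF k t u])
      show "k t d \<in> fibre p E (S (p d))" by (rule fibre_family_fibre[OF k t]) (simp add: fibre_def dB)
      show "dist (k t u) (k t d) < \<delta>" by (rule \<eta>[OF t uB(1) dB]) (use d in \<open>simp add: dist_commute\<close>)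
    qed
    moreover have "L d \<le> (\<Sum>u\<in>D. L u)" by (rule member_le_sum) (use d D in \<open>auto simp: L_def\<close>)
    ultimately show ?thesis unfolding M_def L_def by linarith
  qed
  moreover have "M \<ge> 0" unfolding M_def L_def by (intro add_nonneg_nonneg sum_nonneg) auto
  ultimately show ?thesis by blast
qed

text \<open>The path of \<open>k t ((f' t ^^ n) u) = (f t ^^ n) (k t u)\<close> is measured in two
  ways. Each way splits off, with error 2, the length of one of the iterates and that of an orbit of
  \<open>k\<close>, which is at most \<open>M\<close>; the total is \<open>4 + 2 * M\<close>,
  independent of \<open>n\<close>.\<close>

lemma conjugate_families_length:
  assumes B: "oriented_circle_subbundle p B" and E: "oriented_circle_subbundle p E"
    and f: "fibre_family p E E T f" and f': "fibre_family p B B T f'" and k: "fibre_family p B E id k"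
    and conj: "\<And>t u. t \<in> {0..1} \<Longrightarrow> u \<in> total B \<Longrightarrow> k t (f' t u) = f t (k t u)"
  shows "\<exists>M. \<forall>n x u w c c'. u \<in> fibre p B x \<longrightarrow> w \<in> fibre p E x \<longrightarrow>
    c \<in> orient B ((T ^^ n) x) \<longrightarrow> c' \<in> orient E ((T ^^ n) x) \<longrightarrow>
    \<bar>algebraic_length c (\<lambda>t. (f' t ^^ n) u) - algebraic_length c' (\<lambda>t. (f t ^^ n) w)\<bar> \<le> M"
proof -
  obtain M where M: "\<And>x c u. c \<in> orient E (id x) \<Longrightarrow> u \<in> fibre p B x \<Longrightarrow> \<bar>algebraic_length c (\<lambda>t. k t u)\<bar> \<le> M"
    using fibre_family_length_bounded[OF B E k] by blast
  have "\<bar>algebraic_length c (\<lambda>t. (f' t ^^ n) u) - algebraic_length c' (\<lambda>t. (f t ^^ n) w)\<bar> \<le> 4 + 2 * M"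
    if u: "u \<in> fibre p B x" and w: "w \<in> fibre p E x"
      and c: "c \<in> orient B ((T ^^ n) x)" and c': "c' \<in> orient E ((T ^^ n) x)" for n x u w c c'
  proof -
    note uB = fibre_subset_total[OF u]
    note fn = fibre_family_funpow[OF f, of n] and fn' = fibre_family_funpow[OF f', of n]
    have conj_n: "k t ((f' t ^^ n) u) = (f t ^^ n) (k t u)" if t: "t \<in> {0..1}" for t
    proof (induction n)
      case (Suc n)
      then show ?case using conj[OF t fibre_family_funpow_total[OF f' t uB, of n]] by simp
    qed simp
    obtain c0 where c0: "c0 \<in> orient E x"
      using is_orientation_nonempty[OF circle_bundle_orientation[OF E]] by blast
    define v where "v = c (circle_point 0)"
    have v: "v \<in> fibre p B ((T ^^ n) x)" unfolding v_def by (rule circle_bundle_mem[OF B c])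
    have c'': "c' \<in> orient E (id ((T ^^ n) x))" using c' by simp
    have k0: "k t u \<in> fibre p E x" if "t \<in> {0..1}" for t
      using fibre_family_fibre[OF k that u] by simp
    have 1: "\<bar>algebraic_length c' (\<lambda>t. k t ((f' t ^^ n) u)) - algebraic_length c' (\<lambda>t. k t v)
      - algebraic_length c (\<lambda>t. (f' t ^^ n) u)\<bar> \<le> 2"
      by (rule fibre_family_length[OF k B E c c'' fibre_family_orbit[OF fn' uB] fibre_family_fibre[OF fn' _ u] v])
    have 2: "\<bar>algebraic_length c' (\<lambda>t. (f t ^^ n) (k t u)) - algebraic_length c' (\<lambda>t. (f t ^^ n) w)
      - algebraic_length c0 (\<lambda>t. k t u)\<bar> \<le> 2"
      by (rule fibre_family_length[OF fn E E c0 c' fibre_family_orbit[OF k uB] k0 w])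
    have 3: "algebraic_length c' (\<lambda>t. k t ((f' t ^^ n) u)) = algebraic_length c' (\<lambda>t. (f t ^^ n) (k t u))"
      by (rule algebraic_length_cong) (rule conj_n)
    have 4: "\<bar>algebraic_length c' (\<lambda>t. k t v)\<bar> \<le> M" by (rule M[OF c'' v])
    have 5: "\<bar>algebraic_length c0 (\<lambda>t. k t u)\<bar> \<le> M" by (rule M[OF _ u]) (simp add: c0)
    show ?thesis using 1 2 3 4 5 by linarith
  qed
  then show ?thesis by blast
qed

text \<open>Only \<open>f\<close> is asked for uniform continuity; \<open>f'\<close> enters through
  its distance to \<open>f\<close> alone, so that one \<open>\<eta>\<close> serves all
  \<open>f'\<close>.\<close>

lemma iterates_close:
  assumes E: "oriented_circle_subbundle p E" and f: "fibre_family p E E T f" and d: "\<delta> > 0"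
  shows "\<exists>\<eta>>0. \<forall>f'. fibre_family p E E T f' \<longrightarrow>
    (\<forall>t\<in>{0..1}. \<forall>u\<in>total E. dist (f t u) (f' t u) < \<eta>) \<longrightarrow>
    (\<forall>t\<in>{0..1}. \<forall>u\<in>total E. dist ((f t ^^ m) u) ((f' t ^^ m) u) < \<delta>)"
  using d
proof (induction m arbitrary: \<delta>)
  case 0
  then show ?case by (intro exI[of _ 1]) auto
next
  case (Suc m)
  obtain \<eta>1 where "\<eta>1 > 0" and \<eta>1: "\<And>t u u'. t \<in> {0..1} \<Longrightarrow> u \<in> total E \<Longrightarrow> u' \<in> total E \<Longrightarrow>
      dist u u' < \<eta>1 \<Longrightarrow> dist (f t u) (f t u') < \<delta> / 2"
    using fibre_family_uniformly_continuous[OF E f, of "\<delta> / 2"] Suc(2) by auto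
  obtain \<eta>2 where "\<eta>2 > 0" and \<eta>2: "\<And>f' t u. fibre_family p E E T f' \<Longrightarrow>
    (\<forall>t\<in>{0..1}. \<forall>u\<in>total E. dist (f t u) (f' t u) < \<eta>2) \<Longrightarrow> t \<in> {0..1} \<Longrightarrow> u \<in> total E \<Longrightarrow>
    dist ((f t ^^ m) u) ((f' t ^^ m) u) < \<eta>1"
    using Suc(1)[OF \<open>\<eta>1 > 0\<close>] by metis
  show ?case
  proof (intro exI[of _ "min \<eta>2 (\<delta> / 2)"] conjI allI impI ballI)
    show "min \<eta>2 (\<delta> / 2) > 0" using \<open>\<eta>2 > 0\<close> Suc(2) by simp
    fix f' and t :: real and u
    assume f': "fibre_family p E E T f'" and t: "t \<in> {0..1}" and u: "u \<in> total E"
      and cl: "\<forall>t\<in>{0..1}. \<forall>u\<in>total E. dist (f t u) (f' t u) < min \<eta>2 (\<delta> / 2)"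
    have m: "(f t ^^ m) u \<in> total E" "(f' t ^^ m) u \<in> total E"
      using fibre_family_funpow_total[OF f t u] fibre_family_funpow_total[OF f' t u] by auto
    have "dist ((f t ^^ m) u) ((f' t ^^ m) u) < \<eta>1" by (rule \<eta>2[OF f' _ t u]) (use cl in auto)
    then have "dist (f t ((f t ^^ m) u)) (f t ((f' t ^^ m) u)) < \<delta> / 2" by (rule \<eta>1[OF t m])
    moreover have "dist (f t ((f' t ^^ m) u)) (f' t ((f' t ^^ m) u)) < \<delta> / 2" using cl t m by auto
    ultimately have "dist (f t ((f t ^^ m) u)) (f' t ((f' t ^^ m) u)) < \<delta>"
      using dist_triangle[of "f t ((f t ^^ m) u)" "f' t ((f' t ^^ m) u)" "f t ((f' t ^^ m) u)"] by linarith
    then show "dist ((f t ^^ Suc m) u) ((f' t ^^ Suc m) u) < \<delta>" by simp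
  qed
qed

end

text \<open>Allows arbitrary positively oriented parametrizations along the orbit instead of a fixed
  \<open>l\<close>. Thus the notion refers to the bundle alone and can be carried through
  conjugations.\<close>

definition rotates ::
  "('g \<Rightarrow> 'x) \<Rightarrow> ('x \<Rightarrow> 'x) \<Rightarrow> ('x, 'g) oriented_bundle \<Rightarrow> (real \<Rightarrow> 'g \<Rightarrow> 'g) \<Rightarrow> 'x \<Rightarrow> real \<Rightarrow> bool" where
  "rotates p T E f x r \<longleftrightarrow> (\<forall>u\<in>fibre p E x. \<forall>c. (\<forall>n. c n \<in> orient E ((T ^^ n) x)) \<longrightarrow>
     (\<lambda>n. algebraic_length (c n) (\<lambda>t. (f t ^^ n) u) / real n) \<longlonglongrightarrow> r)"

section \<open>Orbit lengths and rotation numbers of one family\<close>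

locale compact_base_dynamics = compact_base p
  for p :: "'g::metric_space \<Rightarrow> 'x::metric_space" +
  fixes T :: "'x \<Rightarrow> 'x"
  assumes T_continuous: "continuous_on UNIV T"
begin

text \<open>A representative choice of starting point and parametrizations; nothing is claimed about
  its regularity in \<open>x\<close>, as \<open>l\<close> is arbitrary.\<close>

definition orbit_length ::
  "('x \<Rightarrow> complex \<Rightarrow> 'g) \<Rightarrow> (real \<Rightarrow> 'g \<Rightarrow> 'g) \<Rightarrow> nat \<Rightarrow> 'x \<Rightarrow> real" where
  "orbit_length l f n x = algebraic_length (l ((T ^^ n) x)) (\<lambda>t. (f t ^^ n) (l x (circle_point 0)))"

context
  fixes E :: "('x, 'g) oriented_bundle" and l :: "'x \<Rightarrow> complex \<Rightarrow> 'g"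
  assumes E: "oriented_circle_subbundle p E" and l: "\<And>x. l x \<in> orient E x"
begin

lemma base_point: "l x (circle_point s) \<in> fibre p E x"
  by (rule circle_bundle_mem[OF E l])

text \<open>After \<open>n\<close> steps the starting point traces a path in the fibre over
  \<open>(T ^^ n) x\<close>. Applying the remaining \<open>m\<close> steps to this path splits the
  length with error 2, by \<open>fibre_family_length\<close>.\<close>

lemma orbit_length_quasi_cocycle:
  assumes f: "fibre_family p E E T f"
  shows "\<bar>orbit_length l f (n + m) x - orbit_length l f n x - orbit_length l f m ((T ^^ n) x)\<bar> \<le> 2"
proof -
  let ?u = "l x (circle_point 0)"
  note fn = fibre_family_funpow[OF f, of n] and fm = fibre_family_funpow[OF f, of m]
  have 1: "\<bar>algebraic_length (l ((T ^^ m) ((T ^^ n) x))) (\<lambda>t. (f t ^^ m) ((f t ^^ n) ?u))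
      - algebraic_length (l ((T ^^ m) ((T ^^ n) x))) (\<lambda>t. (f t ^^ m) (l ((T ^^ n) x) (circle_point 0)))
      - algebraic_length (l ((T ^^ n) x)) (\<lambda>t. (f t ^^ n) ?u)\<bar> \<le> 2"
    by (rule fibre_family_length[OF fm E E l l fibre_family_orbit[OF fn fibre_subset_total[OF base_point]]
          fibre_family_fibre[OF fn _ base_point] base_point])
  have 2: "(T ^^ m) ((T ^^ n) x) = (T ^^ (n + m)) x" "(f t ^^ m) ((f t ^^ n) ?u) = (f t ^^ (n + m)) ?u" for t
    by (simp_all add: funpow_add add.commute[of n])
  show ?thesis using 1 unfolding 2 orbit_length_def by (simp add: 2)
qed

lemma orbit_length_compare:
  assumes f: "fibre_family p E E T f" and u: "u \<in> fibre p E x" and c: "c \<in> orient E ((T ^^ n) x)"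
  shows "\<bar>algebraic_length c (\<lambda>t. (f t ^^ n) u) - orbit_length l f n x\<bar> \<le> 4"
  unfolding orbit_length_def
  by (rule fibre_family_length_base_point[OF fibre_family_funpow[OF f] E E c l u base_point])

text \<open>As \<open>l\<close> may jump, the orbits of a continuous local section are compared
  instead; they are close and their lengths differ by at most 5. Passing to the starting points and
  parametrizations of \<open>l\<close> costs 4 at each of the two base points.\<close>

lemma orbit_length_locally_bounded_oscillation:
  assumes f: "fibre_family p E E T f"
  shows "eventually (\<lambda>y. \<bar>orbit_length l f n y - orbit_length l f n x\<bar> \<le> 13) (nhds x)"
proof -
  note fn = fibre_family_funpow[OF f, of n]
  obtain \<delta> where "\<delta> > 0" and \<delta>: "\<And>y y' c c' \<gamma> \<gamma>'. c \<in> orient E y \<Longrightarrow> c' \<in> orient E y' \<Longrightarrow>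
    continuous_on {0..1} \<gamma> \<Longrightarrow> continuous_on {0..1} \<gamma>' \<Longrightarrow>
    (\<forall>t\<in>{0..1}. \<gamma> t \<in> fibre p E y \<and> \<gamma>' t \<in> fibre p E y' \<and> dist (\<gamma> t) (\<gamma>' t) < \<delta>) \<Longrightarrow>
    \<bar>algebraic_length c \<gamma> - algebraic_length c' \<gamma>'\<bar> \<le> 5"
    using close_paths[OF E] by (metis (no_types))
  obtain \<eta> where "\<eta> > 0" and \<eta>: "\<And>t u u'. t \<in> {0..1} \<Longrightarrow> u \<in> total E \<Longrightarrow> u' \<in> total E \<Longrightarrow> dist u u' < \<eta> \<Longrightarrow>
    dist ((f t ^^ n) u) ((f t ^^ n) u') < \<delta>"
    using fibre_family_uniformly_continuous[OF E fn \<open>\<delta> > 0\<close>] by blast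
  obtain U \<tau> \<zeta> where U: "open U" "x \<in> U" and h: "homeomorphism (U \<times> circle) (total E \<inter> p -` U) \<tau> \<zeta>"
    and \<tau>: "\<And>y. y \<in> U \<Longrightarrow> (\<lambda>z. \<tau> (y, z)) \<in> orient E y"
    using circle_bundle_trivialization[OF E, of x] by blast
  define s where "s = (\<lambda>y. \<tau> (y, circle_point 0))"
  have sE: "s y \<in> fibre p E y" if "y \<in> U" for y
    using circle_bundle_mem[OF E \<tau>[OF that]] by (simp add: s_def)
  have "continuous_on U s" unfolding s_def
    by (rule continuous_on_compose2[OF homeomorphism_cont1[OF h]]) (auto intro!: continuous_intros)
  then have "(s \<longlongrightarrow> s x) (nhds x)"
    using U continuous_on_eq_continuous_at[OF U(1)] isCont_def tendsto_at_iff_tendsto_nhds by blast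
  then have ev: "eventually (\<lambda>y. dist (s y) (s x) < \<eta>) (nhds x)"
    using \<open>\<eta> > 0\<close> by (rule tendstoD)
  moreover have "eventually (\<lambda>y. y \<in> U) (nhds x)" using U by (rule eventually_nhds_in_open)
  ultimately show ?thesis
  proof eventually_elim
    case (elim y)
    have mem: "s y \<in> total E" "s x \<in> total E"
      by (rule fibre_subset_total[OF sE[OF elim(2)]], rule fibre_subset_total[OF sE[OF U(2)]])
    have 1: "\<bar>algebraic_length (l ((T ^^ n) y)) (\<lambda>t. (f t ^^ n) (s y))
      - algebraic_length (l ((T ^^ n) x)) (\<lambda>t. (f t ^^ n) (s x))\<bar> \<le> 5"
    proof (rule \<delta>[OF l l fibre_family_orbit[OF fn mem(1)] fibre_family_orbit[OF fn mem(2)]], intro ballI conjI)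
      fix t :: real assume t: "t \<in> {0..1}"
      show "(f t ^^ n) (s y) \<in> fibre p E ((T ^^ n) y)" by (rule fibre_family_fibre[OF fn t sE[OF elim(2)]])
      show "(f t ^^ n) (s x) \<in> fibre p E ((T ^^ n) x)" by (rule fibre_family_fibre[OF fn t sE[OF U(2)]])
      show "dist ((f t ^^ n) (s y)) ((f t ^^ n) (s x)) < \<delta>" by (rule \<eta>[OF t mem elim(1)])
    qed
    show ?case
      using 1 orbit_length_compare[OF f sE[OF elim(2)] l, of n] orbit_length_compare[OF f sE[OF U(2)] l, of n]
      by linarith
  qed
qed

lemma orbit_length_birkhoff:
  assumes f: "fibre_family p E E T f"
  shows "\<exists>b. continuous_on UNIV b \<and>
    (\<forall>x. (\<lambda>n. orbit_length l f n x / real n - birkhoff_sum T b n x / real n) \<longlonglongrightarrow> 0)"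
proof -
  have "\<forall>n. \<exists>a. continuous_on UNIV a \<and> (\<forall>x. \<bar>a x - orbit_length l f n x\<bar> \<le> 13)"
    using continuous_approximation_of_locally_bounded_oscillation[OF compact_base
        orbit_length_locally_bounded_oscillation[OF f]] by blast
  then obtain a where a: "\<And>n. continuous_on UNIV (a n)" "\<And>n x. \<bar>a n x - orbit_length l f n x\<bar> \<le> 13"
    by metis
  \<comment> \<open>The defect 2 of the orbit lengths and the approximation error 13 at three
    places.\<close>
  have "\<bar>a (n + m) x - a n x - a m ((T ^^ n) x)\<bar> \<le> 41" for n m x
    using orbit_length_quasi_cocycle[OF f, of n m x] a(2)[of "n + m" x] a(2)[of n x] a(2)[of m "(T ^^ n) x"]
    by linarith
  from quasi_cocycle_birkhoff_sums[OF compact_base T_continuous a(1) this]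
  obtain b where b: "continuous_on UNIV b"
    "\<And>x. (\<lambda>n. a n x / real n - birkhoff_sum T b n x / real n) \<longlonglongrightarrow> 0" by blast
  have "(\<lambda>n. orbit_length l f n x / real n - birkhoff_sum T b n x / real n) \<longlonglongrightarrow> 0" for x
  proof -
    have "\<bar>orbit_length l f n x - a n x\<bar> \<le> 13" for n using a(2)[of n x] by linarith
    note bounded_difference_averages(1)[of "\<lambda>n. orbit_length l f n x" "\<lambda>n. a n x", OF this]
    from tendsto_add[OF this b(2)[of x]] show ?thesis by simp
  qed
  then show ?thesis using b(1) by blast
qed

lemma rotates_orbit_length:
  assumes f: "fibre_family p E E T f" and u: "u \<in> fibre p E x" and c: "\<And>n. c n \<in> orient E ((T ^^ n) x)"
  shows "(\<lambda>n. algebraic_length (c n) (\<lambda>t. (f t ^^ n) u) / real n) \<longlonglongrightarrow> r \<longleftrightarrow>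
    (\<lambda>n. orbit_length l f n x / real n) \<longlonglongrightarrow> r"
  by (rule bounded_difference_averages(2)) (rule orbit_length_compare[OF f u c])

lemma rotates_iff:
  assumes f: "fibre_family p E E T f"
  shows "rotates p T E f x r \<longleftrightarrow> (\<lambda>n. orbit_length l f n x / real n) \<longlonglongrightarrow> r"
proof
  assume "rotates p T E f x r"
  then have "\<forall>c. (\<forall>n. c n \<in> orient E ((T ^^ n) x)) \<longrightarrow>
      (\<lambda>n. algebraic_length (c n) (\<lambda>t. (f t ^^ n) (l x (circle_point 0))) / real n) \<longlonglongrightarrow> r"
    unfolding rotates_def using base_point[of x 0] by (rule bspec)
  from this[rule_format, of "\<lambda>n. l ((T ^^ n) x)", OF l] show "(\<lambda>n. orbit_length l f n x / real n) \<longlonglongrightarrow> r" by (simp add: orbit_length_def)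
qed (use rotates_orbit_length[OF f] in \<open>auto simp: rotates_def\<close>)

end

lemma circle_bundle_section:
  assumes "oriented_circle_subbundle p E"
  shows "\<exists>l. \<forall>x. l x \<in> orient E x"
proof (rule choice, rule allI)
  show "\<exists>c. c \<in> orient E x" for x
    using is_orientation_nonempty[OF circle_bundle_orientation[OF assms], of x] by blast
qed

lemma rotates_birkhoff:
  assumes E: "oriented_circle_subbundle p E" and f: "fibre_family p E E T f"
  shows "\<exists>b. continuous_on UNIV b \<and>
    (\<forall>x r. rotates p T E f x r \<longleftrightarrow> (\<lambda>n. birkhoff_sum T b n x / real n) \<longlonglongrightarrow> r)"
proof -
  obtain l where l: "\<And>x. l x \<in> orient E x" using circle_bundle_section[OF E] by blast
  obtain b where b: "continuous_on UNIV b"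
    "\<And>x. (\<lambda>n. orbit_length l f n x / real n - birkhoff_sum T b n x / real n) \<longlonglongrightarrow> 0"
    using orbit_length_birkhoff[OF E l f] by blast
  have "rotates p T E f x r \<longleftrightarrow> (\<lambda>n. birkhoff_sum T b n x / real n) \<longlonglongrightarrow> r" for x r
  proof -
    have "(\<lambda>n. birkhoff_sum T b n x / real n) \<longlonglongrightarrow> r" if "(\<lambda>n. orbit_length l f n x / real n) \<longlonglongrightarrow> r"
      using tendsto_diff[OF that b(2)[of x]] by simp
    moreover have "(\<lambda>n. orbit_length l f n x / real n) \<longlonglongrightarrow> r" if "(\<lambda>n. birkhoff_sum T b n x / real n) \<longlonglongrightarrow> r"
      using tendsto_add[OF b(2)[of x] that] by simp
    ultimately show ?thesis unfolding rotates_iff[OF E l f] by blast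
  qed
  then show ?thesis using b(1) by blast
qed

lemma rotates_conjugate:
  assumes B: "oriented_circle_subbundle p B" and E: "oriented_circle_subbundle p E"
    and f: "fibre_family p E E T f" and f': "fibre_family p B B T f'" and k: "fibre_family p B E id k"
    and conj: "\<And>t u. t \<in> {0..1} \<Longrightarrow> u \<in> total B \<Longrightarrow> k t (f' t u) = f t (k t u)"
  shows "rotates p T B f' x r \<longleftrightarrow> rotates p T E f x r"
proof -
  obtain l where l: "\<And>x. l x \<in> orient E x" using circle_bundle_section[OF E] by blast
  obtain l' where l': "\<And>x. l' x \<in> orient B x" using circle_bundle_section[OF B] by blast
  obtain M where M: "\<And>n x u w c c'. u \<in> fibre p B x \<Longrightarrow> w \<in> fibre p E x \<Longrightarrow>
    c \<in> orient B ((T ^^ n) x) \<Longrightarrow> c' \<in> orient E ((T ^^ n) x) \<Longrightarrow>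
    \<bar>algebraic_length c (\<lambda>t. (f' t ^^ n) u) - algebraic_length c' (\<lambda>t. (f t ^^ n) w)\<bar> \<le> M"
  proof -
    from conjugate_families_length[OF B E f f' k, OF conj] obtain M where
      M: "\<forall>n x u w c c'. u \<in> fibre p B x \<longrightarrow> w \<in> fibre p E x \<longrightarrow>
        c \<in> orient B ((T ^^ n) x) \<longrightarrow> c' \<in> orient E ((T ^^ n) x) \<longrightarrow>
        \<bar>algebraic_length c (\<lambda>t. (f' t ^^ n) u) - algebraic_length c' (\<lambda>t. (f t ^^ n) w)\<bar> \<le> M" ..
    show thesis by (rule that) (rule M[rule_format])
  qed
  have "\<bar>orbit_length l' f' n x - orbit_length l f n x\<bar> \<le> M" for n
    unfolding orbit_length_def by (rule M[OF base_point[OF B l'] base_point[OF E l] l' l])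
  then show ?thesis unfolding rotates_iff[OF E l f] rotates_iff[OF B l' f']
    by (rule bounded_difference_averages(2))
qed

text \<open>Closeness of infinitely many iterates cannot be had, but closeness of the single iterate
  \<open>m\<close> is enough: the error per block of length \<open>m\<close> is at most 9 whatever
  the orbit, and \<open>m\<close> is chosen beforehand so that
  \<open>9 / m \<le> \<epsilon>\<close>.\<close>

lemma rotates_close:
  assumes E: "oriented_circle_subbundle p E" and f: "fibre_family p E E T f" and e: "\<epsilon> > 0"
  shows "\<exists>\<eta>>0. \<forall>f'. fibre_family p E E T f' \<longrightarrow>
    (\<forall>t\<in>{0..1}. \<forall>u\<in>total E. dist (f t u) (f' t u) < \<eta>) \<longrightarrow>
    (\<forall>x r r'. rotates p T E f x r \<longrightarrow> rotates p T E f' x r' \<longrightarrow> \<bar>r - r'\<bar> \<le> \<epsilon>)"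
proof -
  obtain l where l: "\<And>x. l x \<in> orient E x" using circle_bundle_section[OF E] by blast
  obtain \<delta> where "\<delta> > 0" and \<delta>: "\<And>y y' c c' \<gamma> \<gamma>'. c \<in> orient E y \<Longrightarrow> c' \<in> orient E y' \<Longrightarrow>
    continuous_on {0..1} \<gamma> \<Longrightarrow> continuous_on {0..1} \<gamma>' \<Longrightarrow>
    (\<forall>t\<in>{0..1}. \<gamma> t \<in> fibre p E y \<and> \<gamma>' t \<in> fibre p E y' \<and> dist (\<gamma> t) (\<gamma>' t) < \<delta>) \<Longrightarrow>
    \<bar>algebraic_length c \<gamma> - algebraic_length c' \<gamma>'\<bar> \<le> 5"
    using close_paths[OF E] by (metis (no_types))
  obtain m0 :: nat where m0: "9 / \<epsilon> < real m0" using reals_Archimedean2 by blast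
  define m where "m = Suc m0"
  have m: "9 / real m \<le> \<epsilon>" using m0 e by (simp add: m_def field_simps)
  obtain \<eta> where "\<eta> > 0" and \<eta>: "\<And>f' t u. fibre_family p E E T f' \<Longrightarrow>
    (\<forall>t\<in>{0..1}. \<forall>u\<in>total E. dist (f t u) (f' t u) < \<eta>) \<Longrightarrow> t \<in> {0..1} \<Longrightarrow> u \<in> total E \<Longrightarrow>
    dist ((f t ^^ m) u) ((f' t ^^ m) u) < \<delta>"
    using iterates_close[OF E f \<open>\<delta> > 0\<close>, of m] by metis
  have "\<bar>r - r'\<bar> \<le> \<epsilon>"
    if f': "fibre_family p E E T f'" and cl: "\<forall>t\<in>{0..1}. \<forall>u\<in>total E. dist (f t u) (f' t u) < \<eta>"
      and r: "rotates p T E f x r" "rotates p T E f' x r'" for f' x r r'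
  proof -
    note fm = fibre_family_funpow[OF f, of m] and fm' = fibre_family_funpow[OF f', of m]
    have one: "\<bar>orbit_length l f m y - orbit_length l f' m y\<bar> \<le> 5" for y
      unfolding orbit_length_def
    proof (rule \<delta>[OF l l], goal_cases)
      case 1
      show ?case by (rule fibre_family_orbit[OF fm fibre_subset_total[OF base_point[OF E l]]])
    next
      case 2
      show ?case by (rule fibre_family_orbit[OF fm' fibre_subset_total[OF base_point[OF E l]]])
    next
      case 3
      show ?case
        using fibre_family_fibre[OF fm _ base_point[OF E l]] fibre_family_fibre[OF fm' _ base_point[OF E l]]
          \<eta>[OF f' cl _ fibre_subset_total[OF base_point[OF E l]]] by blast
    qed
    \<comment> \<open>Each new block costs 5 for the comparison of the two iterates and 2 for each
      of the paths for cutting the block off.\<close>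
    have many: "\<bar>orbit_length l f (k * m) x - orbit_length l f' (k * m) x\<bar> \<le> 9 * real k" for k
    proof (induction k)
      case 0
      have "orbit_length l f 0 x = 0" "orbit_length l f' 0 x = 0"
        unfolding orbit_length_def
        by (rule algebraic_length_const[OF circle_bundle_parametrization[OF E l] base_point[OF E l]], simp)+
      then show ?case by simp
    next
      case (Suc k)
      show ?case
        using Suc one[of "(T ^^ (k * m)) x"] orbit_length_quasi_cocycle[OF E l f, of "k * m" m x]
          orbit_length_quasi_cocycle[OF E l f', of "k * m" m x]
        by (simp add: add.commute)
    qed
    have sub: "filterlim (\<lambda>k. k * m) at_top sequentially"
      by (rule filterlim_subseq) (simp add: strict_mono_def m_def del: mult_Suc_right)
    have lim: "(\<lambda>n. orbit_length l f n x / real n) \<longlonglongrightarrow> r" "(\<lambda>n. orbit_length l f' n x / real n) \<longlonglongrightarrow> r'"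
      using r rotates_iff[OF E l f] rotates_iff[OF E l f'] by auto
    have "(\<lambda>k. \<bar>orbit_length l f (k * m) x / real (k * m) - orbit_length l f' (k * m) x / real (k * m)\<bar>)
      \<longlonglongrightarrow> \<bar>r - r'\<bar>"
      by (intro tendsto_rabs tendsto_diff filterlim_compose[OF lim(1) sub] filterlim_compose[OF lim(2) sub])
    moreover have "\<bar>orbit_length l f (k * m) x / real (k * m) - orbit_length l f' (k * m) x / real (k * m)\<bar> \<le> 9 / real m" for k
    proof (cases "k = 0")
      case False
      have "\<bar>orbit_length l f (k * m) x / real (k * m) - orbit_length l f' (k * m) x / real (k * m)\<bar>
        = \<bar>orbit_length l f (k * m) x - orbit_length l f' (k * m) x\<bar> / real (k * m)"
        by (simp add: diff_divide_distrib[symmetric])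
      also have "\<dots> \<le> (9 * real k) / real (k * m)" by (intro divide_right_mono many) simp
      also have "\<dots> = 9 / real m" using False by simp
      finally show ?thesis .
    qed simp
    ultimately have "\<bar>r - r'\<bar> \<le> 9 / real m" using LIMSEQ_le_const2 by blast
    then show ?thesis using m by linarith
  qed
  then show ?thesis using \<open>\<eta> > 0\<close> by blast
qed

end

section \<open>Bundle homeomorphisms and the distances on skew-products\<close>

lemma bundle_homeosI:
  assumes h: "homeomorphism (total E) (total F) h q" and p: "\<And>u. u \<in> total E \<Longrightarrow> p (h u) = p u"
    and o: "\<And>x c. c \<in> orient E x \<Longrightarrow> h \<circ> c \<in> orient F x"
  shows "h \<in> bundle_homeos p E F"
proof -
  have "homeomorphism (fibre p E x) (fibre p F x) h q" for x
  proof (rule homeomorphism_of_subsets[OF h])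
    show "fibre p E x \<subseteq> total E" by (auto simp: fibre_def)
    show "fibre p F x \<subseteq> total F" by (auto simp: fibre_def)
    show "h ` fibre p E x = fibre p F x"
    proof (intro set_eqI iffI)
      fix v assume "v \<in> h ` fibre p E x"
      then obtain u where u: "u \<in> total E" "p u = x" "v = h u" by (auto simp: fibre_def)
      have "h u \<in> h ` total E" using u(1) by (rule imageI)
      then show "v \<in> fibre p F x" using u p[OF u(1)] homeomorphism_image1[OF h] by (simp add: fibre_def)
    next
      fix v assume v: "v \<in> fibre p F x"
      then have vF: "v \<in> total F" "p v = x" by (auto simp: fibre_def)
      have "q v \<in> q ` total F" using vF(1) by (rule imageI)
      then have qE: "q v \<in> total E" by (simp only: homeomorphism_image2[OF h])
      have hq: "h (q v) = v" by (rule homeomorphism_apply2[OF h vF(1)])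
      then have "q v \<in> fibre p E x" using p[OF qE] qE vF(2) by (simp add: fibre_def)
      then have "h (q v) \<in> h ` fibre p E x" by (rule imageI)
      then show "v \<in> h ` fibre p E x" by (simp only: hq)
    qed
  qed
  then show ?thesis
    unfolding bundle_homeos_def orientation_preserving_fibre_homeo_def using assms by blast
qed

lemma bundle_homeosD:
  assumes "h \<in> bundle_homeos p E F"
  shows bundle_homeos_homeomorphism: "homeomorphism (total E) (total F) h (inv_into (total E) h)"
    and bundle_homeos_fibre: "\<And>u. u \<in> total E \<Longrightarrow> p (h u) = p u"
    and bundle_homeos_orient: "\<And>x c. c \<in> orient E x \<Longrightarrow> h \<circ> c \<in> orient F x"
proof -
  obtain q where q: "homeomorphism (total E) (total F) h q"
    using assms unfolding bundle_homeos_def by blast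
  have inj: "inj_on h (total E)" using homeomorphism_apply1[OF q] by (rule inj_on_inverseI)
  have "inv_into (total E) h v = q v" if "v \<in> total F" for v
  proof (rule inv_into_f_eq[OF inj])
    have "q v \<in> q ` total F" using that by (rule imageI)
    then show "q v \<in> total E" by (simp only: homeomorphism_image2[OF q])
    show "h (q v) = v" by (rule homeomorphism_apply2[OF q that])
  qed
  then show "homeomorphism (total E) (total F) h (inv_into (total E) h)"
    using q by (auto intro: homeomorphism_cong)
qed (use assms in \<open>auto simp: bundle_homeos_def orientation_preserving_fibre_homeo_def\<close>)

lemma bundle_homeos_mem: "h \<in> bundle_homeos p E F \<Longrightarrow> u \<in> total E \<Longrightarrow> h u \<in> total F"
  using homeomorphism_image1[OF bundle_homeos_homeomorphism] by (metis imageI)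

lemma bundle_homeos_inv_mem: "h \<in> bundle_homeos p E F \<Longrightarrow> v \<in> total F \<Longrightarrow> inv_into (total E) h v \<in> total E"
  using homeomorphism_image2[OF bundle_homeos_homeomorphism] by (metis imageI)

lemma bundle_homeos_inv_left: "h \<in> bundle_homeos p E F \<Longrightarrow> u \<in> total E \<Longrightarrow> inv_into (total E) h (h u) = u"
  by (rule homeomorphism_apply1[OF bundle_homeos_homeomorphism])

lemma bundle_homeos_inv_right: "h \<in> bundle_homeos p E F \<Longrightarrow> v \<in> total F \<Longrightarrow> h (inv_into (total E) h v) = v"
  by (rule homeomorphism_apply2[OF bundle_homeos_homeomorphism])

lemma bundle_homeos_inv_eq:
  "h \<in> bundle_homeos p E F \<Longrightarrow> u \<in> total E \<Longrightarrow> h u = v \<Longrightarrow> inv_into (total E) h v = u"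
  using bundle_homeos_inv_left by blast

lemma bundle_homeos_id: "id \<in> bundle_homeos p E E"
  by (rule bundle_homeosI[where q = id]) (auto simp: homeomorphism_def)

lemma bundle_homeos_compose:
  assumes h: "h \<in> bundle_homeos p E F" and k: "k \<in> bundle_homeos p F G"
  shows "k \<circ> h \<in> bundle_homeos p E G"
proof (rule bundle_homeosI)
  show "homeomorphism (total E) (total G) (k \<circ> h) (inv_into (total E) h \<circ> inv_into (total F) k)"
    by (rule homeomorphism_compose[OF bundle_homeos_homeomorphism[OF h] bundle_homeos_homeomorphism[OF k]])
  show "p ((k \<circ> h) u) = p u" if "u \<in> total E" for u
    using bundle_homeos_fibre[OF h that] bundle_homeos_fibre[OF k bundle_homeos_mem[OF h that]] by simp
  show "k \<circ> h \<circ> c \<in> orient G x" if "c \<in> orient E x" for x c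
    using bundle_homeos_orient[OF k bundle_homeos_orient[OF h that]] by (simp add: comp_assoc)
qed

text \<open>For orientations, a parametrization \<open>c'\<close> of a fibre of \<open>F\<close> is
  compared with \<open>h \<circ> c\<close> for some \<open>c\<close> of \<open>E\<close>. The
  transition is a degree one map, and it is also the transition between the pull-back of
  \<open>c'\<close> and \<open>c\<close>.\<close>

lemma bundle_homeos_inverse:
  assumes E: "oriented_circle_subbundle p E" and F: "oriented_circle_subbundle p F"
    and h: "h \<in> bundle_homeos p E F"
  shows "inv_into (total E) h \<in> bundle_homeos p F E"
proof (rule bundle_homeosI)
  let ?k = "inv_into (total E) h"
  note hom = bundle_homeos_homeomorphism[OF h]
  show "homeomorphism (total F) (total E) ?k h" using hom by (rule homeomorphism_symD)
  show pk: "p (?k v) = p v" if "v \<in> total F" for v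
    using bundle_homeos_fibre[OF h bundle_homeos_inv_mem[OF h that]] bundle_homeos_inv_right[OF h that] by simp
  show "?k \<circ> c' \<in> orient E x" if c': "c' \<in> orient F x" for x c'
  proof -
    obtain c where c: "c \<in> orient E x"
      using is_orientation_nonempty[OF circle_bundle_orientation[OF E]] by blast
    obtain \<kappa> where \<kappa>: "degree_one \<kappa>" "\<And>s. c' (circle_point s) = (h \<circ> c) (circle_point (\<kappa> s))"
      using is_orientation_transition[OF circle_bundle_orientation[OF F] bundle_homeos_orient[OF h c] c']
      by blast
    have mem: "c (circle_point s) \<in> total E" for s
      by (rule fibre_subset_total[OF circle_bundle_mem[OF E c]])
    have eq: "(?k \<circ> c') (circle_point s) = c (circle_point (\<kappa> s))" for s
      using \<kappa>(2)[of s] bundle_homeos_inv_left[OF h mem] by simp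
    have P: "homeomorphism circle (fibre p F x) c' (inv_into circle c')"
      by (rule circle_parametrization_homeomorphism[OF circle_bundle_parametrization[OF F c']])
    have Q: "homeomorphism (fibre p F x) (fibre p E x) ?k h"
    proof (rule homeomorphism_of_subsets[OF homeomorphism_symD[OF hom]])
      show "fibre p F x \<subseteq> total F" "fibre p E x \<subseteq> total E" by (auto simp: fibre_def)
      show "?k ` fibre p F x = fibre p E x"
      proof (intro set_eqI iffI)
        fix u assume "u \<in> ?k ` fibre p F x"
        then show "u \<in> fibre p E x" using pk bundle_homeos_inv_mem[OF h] by (auto simp: fibre_def)
      next
        fix u assume u: "u \<in> fibre p E x"
        then have uE: "u \<in> total E" "p u = x" by (auto simp: fibre_def)
        have "h u \<in> fibre p F x"
          using bundle_homeos_mem[OF h uE(1)] bundle_homeos_fibre[OF h uE(1)] uE(2) by (simp add: fibre_def)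
        then have "?k (h u) \<in> ?k ` fibre p F x" by (rule imageI)
        then show "u \<in> ?k ` fibre p F x" by (simp only: bundle_homeos_inv_left[OF h uE(1)])
      qed
    qed
    have "circle_parametrization (fibre p E x) (?k \<circ> c')"
      unfolding circle_parametrization_def using homeomorphism_compose[OF P Q] by blast
    then show ?thesis
      by (rule is_orientation_memI[OF circle_bundle_orientation[OF E] c _ \<kappa>(1)]) (rule eq)
  qed
qed

section \<open>Estimates for the distances on bundles and skew-products\<close>

lemma d_sup_lessD: "d_sup K f g < ennreal r \<Longrightarrow> u \<in> K \<Longrightarrow> dist (f u) (g u) < r"
proof -
  assume a: "d_sup K f g < ennreal r" "u \<in> K"
  have "ennreal (dist (f u) (g u)) \<le> d_sup K f g" unfolding d_sup_def by (rule SUP_upper[OF a(2)])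
  then have "ennreal (dist (f u) (g u)) < ennreal r" using a(1) by (rule le_less_trans)
  then show ?thesis by (simp add: ennreal_less_iff)
qed

lemma d_sup_leI: "(\<And>u. u \<in> K \<Longrightarrow> dist (f u) (g u) \<le> r) \<Longrightarrow> d_sup K f g \<le> ennreal r"
  unfolding d_sup_def by (intro SUP_least ennreal_leI)

lemma bundle_dist_lessD:
  assumes "bundle_dist p E F < ennreal r"
  shows "\<exists>h\<in>bundle_homeos p E F. \<forall>u\<in>total E. dist u (h u) < r"
proof -
  obtain h where h: "h \<in> bundle_homeos p E F" "d_sup (total E) id h < ennreal r"
    using assms unfolding bundle_dist_def by (auto simp: INF_less_iff)
  then show ?thesis using d_sup_lessD[OF h(2)] by auto
qed

lemma bundle_dist_leI:
  assumes "h \<in> bundle_homeos p E F" "\<And>u. u \<in> total E \<Longrightarrow> dist u (h u) \<le> r"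
  shows "bundle_dist p E F \<le> ennreal r"
  unfolding bundle_dist_def
  by (rule order_trans[OF INF_lower[OF assms(1)]]) (rule d_sup_leI, use assms(2) in simp)

lemma bundle_dist_self: "bundle_dist p E E = 0"
  using bundle_dist_leI[OF bundle_homeos_id, of E 0 p] by simp

text \<open>The strict premises provide actual homeomorphisms, as the infimum need not be attained.
  The conclusion is weak, because strict bounds at all points do not pass to a supremum.\<close>

lemma bundle_dist_triangle_less:
  assumes "bundle_dist p E F < ennreal r" "bundle_dist p F G < ennreal s"
  shows "bundle_dist p E G \<le> ennreal (r + s)"
proof -
  obtain h where h: "h \<in> bundle_homeos p E F" "\<And>u. u \<in> total E \<Longrightarrow> dist u (h u) < r"
    using bundle_dist_lessD[OF assms(1)] by blast
  obtain k where k: "k \<in> bundle_homeos p F G" "\<And>u. u \<in> total F \<Longrightarrow> dist u (k u) < s"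
    using bundle_dist_lessD[OF assms(2)] by blast
  show ?thesis
  proof (rule bundle_dist_leI[OF bundle_homeos_compose[OF h(1) k(1)]])
    fix u assume u: "u \<in> total E"
    show "dist u ((k \<circ> h) u) \<le> r + s"
      using h(2)[OF u] k(2)[OF bundle_homeos_mem[OF h(1) u]] dist_triangle[of u "k (h u)" "h u"] by simp
  qed
qed

lemma bundle_dist_sym_less:
  assumes "oriented_circle_subbundle p E" "oriented_circle_subbundle p F" "bundle_dist p E F < ennreal r"
  shows "bundle_dist p F E \<le> ennreal r"
proof -
  obtain h where h: "h \<in> bundle_homeos p E F" "\<And>u. u \<in> total E \<Longrightarrow> dist u (h u) < r"
    using bundle_dist_lessD[OF assms(3)] by blast
  show ?thesis
  proof (rule bundle_dist_leI[OF bundle_homeos_inverse[OF assms(1,2) h(1)]])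
    fix v assume v: "v \<in> total F"
    show "dist v (inv_into (total E) h v) \<le> r"
      using h(2)[OF bundle_homeos_inv_mem[OF h(1) v]] bundle_homeos_inv_right[OF h(1) v]
      by (simp add: dist_commute)
  qed
qed

lemma Sk_dist_lessD:
  assumes "Sk_dist p a b < ennreal r"
  shows "\<exists>h\<in>bundle_homeos p (fst a) (fst b). \<forall>u\<in>total (fst a). dist u (h u) < r \<and>
    dist (snd a u) (inv_into (total (fst a)) h (snd b (h u))) < r"
proof -
  obtain h where h: "h \<in> bundle_homeos p (fst a) (fst b)"
    "d_sup (total (fst a)) id h + d_sup (total (fst a)) (snd a) (inv_into (total (fst a)) h \<circ> snd b \<circ> h) < ennreal r"
    using assms unfolding Sk_dist_def by (auto simp: case_prod_unfold INF_less_iff)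
  have "d_sup (total (fst a)) id h < ennreal r"
    "d_sup (total (fst a)) (snd a) (inv_into (total (fst a)) h \<circ> snd b \<circ> h) < ennreal r"
    by (rule le_less_trans[OF _ h(2)], simp)+
  from d_sup_lessD[OF this(1)] d_sup_lessD[OF this(2)] show ?thesis using h(1) by auto
qed

lemma Sk_dist_leI:
  assumes "h \<in> bundle_homeos p (fst a) (fst b)" "0 \<le> r" "0 \<le> s"
    "\<And>u. u \<in> total (fst a) \<Longrightarrow> dist u (h u) \<le> r"
    "\<And>u. u \<in> total (fst a) \<Longrightarrow> dist (snd a u) (inv_into (total (fst a)) h (snd b (h u))) \<le> s"
  shows "Sk_dist p a b \<le> ennreal (r + s)"
proof -
  have "Sk_dist p a b \<le> d_sup (total (fst a)) id h +
      d_sup (total (fst a)) (snd a) (inv_into (total (fst a)) h \<circ> snd b \<circ> h)"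
    unfolding Sk_dist_def case_prod_unfold by (rule INF_lower[OF assms(1)])
  also have "\<dots> \<le> ennreal r + ennreal s"
    by (intro add_mono d_sup_leI) (use assms(4,5) in auto)
  finally show ?thesis using assms(2,3) by simp
qed

lemma bundle_dist_le_Sk_dist: "bundle_dist p (fst a) (fst b) \<le> Sk_dist p a b"
  unfolding bundle_dist_def Sk_dist_def case_prod_unfold
  by (rule INF_mono) (metis le_iff_add)

lemma SkD:
  assumes "a \<in> Sk p T \<E>"
  shows "fst a \<in> \<E>" "u \<in> total (fst a) \<Longrightarrow> snd a u \<in> total (fst a)" "continuous_on (total (fst a)) (snd a)"
    "u \<in> total (fst a) \<Longrightarrow> p (snd a u) = T (p u)" "c \<in> orient (fst a) x \<Longrightarrow> snd a \<circ> c \<in> orient (fst a) (T x)"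
  using assms by (auto simp: Sk_def Sk_fixed_def orientation_preserving_fibre_homeo_def)

lemma Sk_dist_self:
  assumes "a \<in> Sk p T \<E>"
  shows "Sk_dist p a a = 0"
proof -
  have "Sk_dist p a a \<le> ennreal (0 + 0)"
  proof (rule Sk_dist_leI[OF bundle_homeos_id])
    fix u assume u: "u \<in> total (fst a)"
    have "inv_into (total (fst a)) id (snd a (id u)) = snd a u"
      using bundle_homeos_inv_left[OF bundle_homeos_id[of p] SkD(2)[OF assms u]] by simp
    then show "dist (snd a u) (inv_into (total (fst a)) id (snd a (id u))) \<le> 0" by simp
  qed auto
  then show ?thesis by simp
qed

text \<open>The constant is large because moving the comparison of \<open>g\<close> with \<open>e\<close> back to \<open>E\<close> costs twice the
  distance of \<open>h\<close> to the identity.\<close>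

lemma Sk_dist_quasi_triangle:
  assumes S: "a \<in> Sk p T \<E>" "b \<in> Sk p T \<E>" "c \<in> Sk p T \<E>"
    and ab: "Sk_dist p a b < ennreal r" and bc: "Sk_dist p b c < ennreal r"
  shows "Sk_dist p a c \<le> ennreal (6 * r)"
proof -
  let ?E = "total (fst a)" and ?F = "total (fst b)"
  have r: "r \<ge> 0" using ab by (cases "r \<ge> 0") (auto simp: ennreal_neg)
  obtain h where h: "h \<in> bundle_homeos p (fst a) (fst b)" "\<And>u. u \<in> ?E \<Longrightarrow> dist u (h u) < r"
    "\<And>u. u \<in> ?E \<Longrightarrow> dist (snd a u) (inv_into ?E h (snd b (h u))) < r"
    using Sk_dist_lessD[OF ab] by blast
  obtain k where k: "k \<in> bundle_homeos p (fst b) (fst c)" "\<And>u. u \<in> ?F \<Longrightarrow> dist u (k u) < r"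
    "\<And>u. u \<in> ?F \<Longrightarrow> dist (snd b u) (inv_into ?F k (snd c (k u))) < r"
    using Sk_dist_lessD[OF bc] by blast
  have hinv: "dist (inv_into ?E h v) v < r" if "v \<in> ?F" for v
    using h(2)[OF bundle_homeos_inv_mem[OF h(1) that]] bundle_homeos_inv_right[OF h(1) that] by simp
  have "Sk_dist p a c \<le> ennreal (2 * r + 4 * r)"
  proof (rule Sk_dist_leI[OF bundle_homeos_compose[OF h(1) k(1)]])
    fix u assume u: "u \<in> ?E"
    have hu: "h u \<in> ?F" by (rule bundle_homeos_mem[OF h(1) u])
    show "dist u ((k \<circ> h) u) \<le> 2 * r"
      using h(2)[OF u] k(2)[OF hu] dist_triangle[of u "k (h u)" "h u"] by simp
    define w where "w = snd b (h u)"
    define w' where "w' = inv_into ?F k (snd c (k (h u)))"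
    have w: "w \<in> ?F" unfolding w_def by (rule SkD(2)[OF S(2) hu])
    have ckh: "snd c (k (h u)) \<in> total (fst c)" by (rule SkD(2)[OF S(3) bundle_homeos_mem[OF k(1) hu]])
    have w': "w' \<in> ?F" unfolding w'_def by (rule bundle_homeos_inv_mem[OF k(1) ckh])
    have "inv_into ?E (k \<circ> h) (snd c ((k \<circ> h) u)) = inv_into ?E h w'"
    proof (rule bundle_homeos_inv_eq[OF bundle_homeos_compose[OF h(1) k(1)] bundle_homeos_inv_mem[OF h(1) w']])
      show "(k \<circ> h) (inv_into ?E h w') = snd c ((k \<circ> h) u)"
        using bundle_homeos_inv_right[OF h(1) w'] bundle_homeos_inv_right[OF k(1) ckh] by (simp add: w'_def)
    qed
    moreover have "dist (snd a u) (inv_into ?E h w') \<le> 4 * r"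
    proof -
      have "dist (snd a u) (inv_into ?E h w) < r" using h(3)[OF u] by (simp add: w_def)
      moreover have "dist w w' < r" using k(3)[OF hu] by (simp add: w_def w'_def)
      ultimately show ?thesis using hinv[OF w] hinv[OF w']
        dist_triangle[of "snd a u" "inv_into ?E h w'" "inv_into ?E h w"]
        dist_triangle[of "inv_into ?E h w" "inv_into ?E h w'" w]
        dist_triangle[of w "inv_into ?E h w'" w'] by (simp add: dist_commute)
    qed
    ultimately show "dist (snd a u) (inv_into ?E (k \<circ> h) (snd c ((k \<circ> h) u))) \<le> 4 * r" by simp
  qed (use r in auto)
  then show ?thesis by (simp add: algebra_simps)
qed

text \<open>Under a quasi-triangle inequality balls need not be open. \<open>U\<close> collects the
  points \<open>y\<close> that have a whole ball inside the ball of radius \<open>r\<close> around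
  \<open>x\<close>; the quasi-triangle inequality makes \<open>U\<close> open.\<close>

lemma dist_topology_neighbourhood:
  assumes refl: "\<And>x. x \<in> S \<Longrightarrow> d x x = 0"
    and quasi: "\<And>r. r > 0 \<Longrightarrow> \<exists>r'>0. \<forall>x\<in>S. \<forall>y\<in>S. \<forall>z\<in>S. d x y < r' \<longrightarrow> d y z < r' \<longrightarrow> d x z < (r :: ennreal)"
    and x: "x \<in> S" and r: "r > 0"
  shows "\<exists>U. openin (dist_topology S d) U \<and> x \<in> U \<and> (\<forall>y\<in>U. d x y < r)"
proof -
  define U where "U = {y \<in> S. \<exists>s>0. \<forall>z\<in>S. d y z < s \<longrightarrow> d x z < r}"
  have "openin (dist_topology S d) U"
    unfolding openin_dist_topology
  proof (intro conjI ballI)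
    show "U \<subseteq> S" by (auto simp: U_def)
    fix y assume "y \<in> U"
    then obtain s where y: "y \<in> S" and s: "s > 0" "\<And>z. z \<in> S \<Longrightarrow> d y z < s \<Longrightarrow> d x z < r"
      by (auto simp: U_def)
    obtain r' where r': "r' > 0"
      and q: "\<forall>x\<in>S. \<forall>y\<in>S. \<forall>z\<in>S. d x y < r' \<longrightarrow> d y z < r' \<longrightarrow> d x z < s"
      using quasi[OF s(1)] by blast
    have "z \<in> U" if z: "z \<in> S" "d y z < r'" for z
      unfolding U_def using z r' s(2) q y by blast
    then show "\<exists>r>0. \<forall>z\<in>S. d y z < r \<longrightarrow> z \<in> U" using r' by blast
  qed
  moreover have "x \<in> U" using x r by (auto simp: U_def)
  moreover have "d x y < r" if "y \<in> U" for y
  proof -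
    obtain s where "y \<in> S" and s: "s > 0" "\<And>z. z \<in> S \<Longrightarrow> d y z < s \<Longrightarrow> d x z < r" using \<open>y \<in> U\<close> by (auto simp: U_def)
    then show ?thesis using refl[of y] by auto
  qed
  ultimately show ?thesis by blast
qed

lemma ennreal_pos_real_below:
  assumes "(r :: ennreal) > 0"
  shows "\<exists>s>0. ennreal s < r"
proof -
  obtain q where q: "0 < q" "q < r" using dense assms by blast
  then have "q \<noteq> top" by auto
  then obtain s where "q = ennreal s" "s \<ge> 0" by (cases q) auto
  then show ?thesis using q by (intro exI[of _ s]) (auto simp: less_le)
qed

lemma bundle_topology_neighbourhood:
  assumes "E \<in> \<E>" "r > 0"
  shows "\<exists>U. openin (bundle_topology p \<E>) U \<and> E \<in> U \<and> (\<forall>F\<in>U. bundle_dist p E F < r)"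
  unfolding bundle_topology_def
proof (rule dist_topology_neighbourhood[OF bundle_dist_self _ assms])
  fix r :: ennreal assume "r > 0"
  then obtain s where s: "s > 0" "ennreal s < r" using ennreal_pos_real_below by blast
  show "\<exists>r'>0. \<forall>x\<in>\<E>. \<forall>y\<in>\<E>. \<forall>z\<in>\<E>. bundle_dist p x y < r' \<longrightarrow> bundle_dist p y z < r' \<longrightarrow> bundle_dist p x z < r"
  proof (intro exI[of _ "ennreal (s / 2)"] conjI ballI impI)
    fix x y z assume "bundle_dist p x y < ennreal (s / 2)" "bundle_dist p y z < ennreal (s / 2)"
    from bundle_dist_triangle_less[OF this] have "bundle_dist p x z \<le> ennreal s" by simp
    then show "bundle_dist p x z < r" using s(2) by (rule le_less_trans)
  qed (use s in simp)
qed

lemma Sk_dist_quasi: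
  assumes "r > 0"
  shows "\<exists>s>0. \<forall>a\<in>Sk p T \<E>. \<forall>b\<in>Sk p T \<E>. \<forall>c\<in>Sk p T \<E>.
    Sk_dist p a b < ennreal s \<longrightarrow> Sk_dist p b c < ennreal s \<longrightarrow> Sk_dist p a c \<le> ennreal r"
  by (rule exI[of _ "r / 6"]) (use assms Sk_dist_quasi_triangle[of _ p T \<E> _ _ "r / 6"] in auto)

lemma Sk_topology_neighbourhood:
  assumes "a \<in> Sk p T \<E>" "r > 0"
  shows "\<exists>U. openin (Sk_topology p T \<E>) U \<and> a \<in> U \<and> (\<forall>b\<in>U. Sk_dist p a b < r)"
  unfolding Sk_topology_def
proof (rule dist_topology_neighbourhood[OF Sk_dist_self _ assms])
  fix r :: ennreal assume "r > 0"
  then obtain s where s: "s > 0" "ennreal s < r" using ennreal_pos_real_below by blast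
  obtain s' where s': "s' > 0" and q: "\<forall>a\<in>Sk p T \<E>. \<forall>b\<in>Sk p T \<E>. \<forall>c\<in>Sk p T \<E>.
    Sk_dist p a b < ennreal s' \<longrightarrow> Sk_dist p b c < ennreal s' \<longrightarrow> Sk_dist p a c \<le> ennreal s"
    using Sk_dist_quasi[OF s(1)] by blast
  show "\<exists>r'>0. \<forall>x\<in>Sk p T \<E>. \<forall>y\<in>Sk p T \<E>. \<forall>z\<in>Sk p T \<E>.
      Sk_dist p x y < r' \<longrightarrow> Sk_dist p y z < r' \<longrightarrow> Sk_dist p x z < r"
  proof (intro exI[of _ "ennreal s'"] conjI ballI impI)
    fix x y z assume "x \<in> Sk p T \<E>" "y \<in> Sk p T \<E>" "z \<in> Sk p T \<E>"
      "Sk_dist p x y < ennreal s'" "Sk_dist p y z < ennreal s'"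
    then have "Sk_dist p x z \<le> ennreal s" using q by blast
    then show "Sk_dist p x z < r" using s(2) by (rule le_less_trans)
  qed (use s' in simp)
qed

lemma Sk_pathsD:
  assumes "\<phi> \<in> Sk_paths p T \<E>"
  shows "t \<in> {0..1} \<Longrightarrow> \<phi> t \<in> Sk p T \<E>" "continuous_map (top_of_set {0..1}) (Sk_topology p T \<E>) \<phi>"
proof -
  show c: "continuous_map (top_of_set {0..1}) (Sk_topology p T \<E>) \<phi>"
    using assms by (simp add: Sk_paths_def)
  show "\<phi> t \<in> Sk p T \<E>" if "t \<in> {0..1}"
    using continuous_map_image_subset_topspace[OF c] that by (auto simp: Sk_topology_def)
qed

lemma Sk_paths_topology_neighbourhood:
  assumes "\<phi> \<in> Sk_paths p T \<E>" "r > 0"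
  shows "\<exists>U. openin (Sk_paths_topology p T \<E>) U \<and> \<phi> \<in> U \<and>
    (\<forall>\<psi>\<in>U. \<forall>t\<in>{0..1}. Sk_dist p (\<phi> t) (\<psi> t) < r)"
proof -
  let ?d = "\<lambda>\<phi> \<psi>. SUP t\<in>{0..1::real}. Sk_dist p (\<phi> t) (\<psi> t)"
  have "\<exists>U. openin (Sk_paths_topology p T \<E>) U \<and> \<phi> \<in> U \<and> (\<forall>\<psi>\<in>U. ?d \<phi> \<psi> < r)"
    unfolding Sk_paths_topology_def
  proof (rule dist_topology_neighbourhood[OF _ _ assms])
    show "?d \<psi> \<psi> = 0" if "\<psi> \<in> Sk_paths p T \<E>" for \<psi>
      using Sk_dist_self[OF Sk_pathsD(1)[OF that]] by (simp add: SUP_eq_const)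
    fix r :: ennreal assume "r > 0"
    then obtain s where s: "s > 0" "ennreal s < r" using ennreal_pos_real_below by blast
    obtain s' where s': "s' > 0" and q: "\<forall>a\<in>Sk p T \<E>. \<forall>b\<in>Sk p T \<E>. \<forall>c\<in>Sk p T \<E>.
      Sk_dist p a b < ennreal s' \<longrightarrow> Sk_dist p b c < ennreal s' \<longrightarrow> Sk_dist p a c \<le> ennreal s"
      using Sk_dist_quasi[OF s(1)] by blast
    show "\<exists>r'>0. \<forall>x\<in>Sk_paths p T \<E>. \<forall>y\<in>Sk_paths p T \<E>. \<forall>z\<in>Sk_paths p T \<E>. ?d x y < r' \<longrightarrow> ?d y z < r' \<longrightarrow> ?d x z < r"
    proof (intro exI[of _ "ennreal s'"] conjI ballI impI)
      fix x y z assume S: "x \<in> Sk_paths p T \<E>" "y \<in> Sk_paths p T \<E>" "z \<in> Sk_paths p T \<E>"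
        and d: "?d x y < ennreal s'" "?d y z < ennreal s'"
      have "?d x z \<le> ennreal s"
      proof (rule SUP_least)
        fix t :: real assume t: "t \<in> {0..1}"
        have "Sk_dist p (x t) (y t) < ennreal s'" by (rule le_less_trans[OF SUP_upper[OF t] d(1)])
        moreover have "Sk_dist p (y t) (z t) < ennreal s'" by (rule le_less_trans[OF SUP_upper[OF t] d(2)])
        ultimately show "Sk_dist p (x t) (z t) \<le> ennreal s"
          using q Sk_pathsD(1)[OF S(1) t] Sk_pathsD(1)[OF S(2) t] Sk_pathsD(1)[OF S(3) t] by blast
      qed
      then show "?d x z < r" using s(2) by (rule le_less_trans)
    qed (use s' in simp)
  qed
  then obtain U where U: "openin (Sk_paths_topology p T \<E>) U" "\<phi> \<in> U" "\<And>\<psi>. \<psi> \<in> U \<Longrightarrow> ?d \<phi> \<psi> < r" by blast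
  have "Sk_dist p (\<phi> t) (\<psi> t) < r" if "\<psi> \<in> U" "t \<in> {0..1}" for \<psi> t
    by (rule le_less_trans[OF SUP_upper[OF that(2)] U(3)[OF that(1)]])
  then show ?thesis using U(1,2) by blast
qed

lemma continuous_map_dist_topologyD:
  fixes \<phi> :: "'z::metric_space \<Rightarrow> 'a"
  assumes \<phi>: "continuous_map (top_of_set Z) X \<phi>" and z: "z \<in> Z" and U: "openin X U" "\<phi> z \<in> U"
  shows "\<exists>e>0. \<forall>y\<in>Z. dist y z < e \<longrightarrow> \<phi> y \<in> U"
proof -
  have "openin (top_of_set Z) {y \<in> Z. \<phi> y \<in> U}"
    using openin_continuous_map_preimage[OF \<phi> U(1)] by simp
  moreover have "z \<in> {y \<in> Z. \<phi> y \<in> U}" using z U by simp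
  ultimately show ?thesis unfolding openin_euclidean_subtopology_iff by blast
qed

lemma Sk_continuousD:
  fixes \<phi> :: "'z::metric_space \<Rightarrow> _"
  assumes "continuous_map (top_of_set Z) (Sk_topology p T \<E>) \<phi>" "z \<in> Z"
  shows "\<phi> z \<in> Sk p T \<E>" "r > 0 \<Longrightarrow> \<exists>e>0. \<forall>y\<in>Z. dist y z < e \<longrightarrow> Sk_dist p (\<phi> z) (\<phi> y) < ennreal r"
proof -
  show s: "\<phi> z \<in> Sk p T \<E>"
    using continuous_map_image_subset_topspace[OF assms(1)] assms(2) by (auto simp: Sk_topology_def)
  show "\<exists>e>0. \<forall>y\<in>Z. dist y z < e \<longrightarrow> Sk_dist p (\<phi> z) (\<phi> y) < ennreal r" if r: "r > 0"
  proof -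
    obtain U where U: "openin (Sk_topology p T \<E>) U" "\<phi> z \<in> U" "\<And>b. b \<in> U \<Longrightarrow> Sk_dist p (\<phi> z) b < ennreal r"
      using Sk_topology_neighbourhood[OF s, of "ennreal r"] r unfolding ennreal_less_zero_iff[symmetric] by blast
    show ?thesis using continuous_map_dist_topologyD[OF assms U(1,2)] U(3) by blast
  qed
qed

lemma bundle_continuousD:
  fixes e :: "'z::metric_space \<Rightarrow> _"
  assumes "continuous_map (top_of_set Z) (bundle_topology p \<E>) e" "z \<in> Z"
  shows "e z \<in> \<E>" "r > 0 \<Longrightarrow> \<exists>d>0. \<forall>y\<in>Z. dist y z < d \<longrightarrow> bundle_dist p (e z) (e y) < ennreal r"
proof -
  show s: "e z \<in> \<E>"
    using continuous_map_image_subset_topspace[OF assms(1)] assms(2) by (auto simp: bundle_topology_def)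
  show "\<exists>d>0. \<forall>y\<in>Z. dist y z < d \<longrightarrow> bundle_dist p (e z) (e y) < ennreal r" if r: "r > 0"
  proof -
    obtain U where U: "openin (bundle_topology p \<E>) U" "e z \<in> U" "\<And>b. b \<in> U \<Longrightarrow> bundle_dist p (e z) b < ennreal r"
      using bundle_topology_neighbourhood[OF s, of "ennreal r" p] r unfolding ennreal_less_zero_iff[symmetric] by blast
    show ?thesis using continuous_map_dist_topologyD[OF assms U(1,2)] U(3) by blast
  qed
qed

lemma continuous_map_Sk_fst: "continuous_map (Sk_topology p T \<E>) (bundle_topology p \<E>) fst"
  unfolding continuous_map_def
proof (intro conjI allI impI)
  show "fst \<in> topspace (Sk_topology p T \<E>) \<rightarrow> topspace (bundle_topology p \<E>)"
    by (auto simp: Sk_topology_def bundle_topology_def Sk_def)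
  fix U assume "openin (bundle_topology p \<E>) U"
  then have U: "\<And>x. x \<in> U \<Longrightarrow> \<exists>r>0. \<forall>y\<in>\<E>. bundle_dist p x y < r \<longrightarrow> y \<in> U"
    unfolding bundle_topology_def openin_dist_topology by blast
  show "openin (Sk_topology p T \<E>) {x \<in> topspace (Sk_topology p T \<E>). fst x \<in> U}"
    unfolding Sk_topology_def openin_dist_topology
  proof (intro conjI ballI)
    fix a assume "a \<in> {x \<in> topspace (dist_topology (Sk p T \<E>) (Sk_dist p)). fst x \<in> U}"
    then have a: "fst a \<in> U" by simp
    obtain r where r: "r > 0" "\<And>y. y \<in> \<E> \<Longrightarrow> bundle_dist p (fst a) y < r \<Longrightarrow> y \<in> U" using U[OF a] by blast
    have "fst b \<in> U" if b: "b \<in> Sk p T \<E>" "Sk_dist p a b < r" for b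
      by (rule r(2)[OF SkD(1)[OF b(1)] le_less_trans[OF bundle_dist_le_Sk_dist b(2)]])
    then show "\<exists>r>0. \<forall>y\<in>Sk p T \<E>. Sk_dist p a y < r \<longrightarrow>
        y \<in> {x \<in> topspace (dist_topology (Sk p T \<E>) (Sk_dist p)). fst x \<in> U}"
      using r(1) by auto
  qed auto
qed

text \<open>A homeomorphism \<open>j\<close> nearly attaining the distance moves \<open>v\<close>
  into the bundle at \<open>z0\<close>, where continuity of the single map
  \<open>snd (\<phi> z0)\<close> applies, and moves the image back. Each of the three errors is
  below \<open>\<epsilon> / 3\<close>; \<open>j\<close> need not depend continuously on
  \<open>z\<close>.\<close>

lemma Sk_evaluation_continuous:
  fixes \<phi> :: "'z::metric_space \<Rightarrow> ('x, 'g::metric_space) oriented_bundle \<times> ('g \<Rightarrow> 'g)"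
  assumes \<phi>: "continuous_map (top_of_set Z) (Sk_topology p T \<E>) \<phi>"
  shows "continuous_on {(z, v). z \<in> Z \<and> v \<in> total (fst (\<phi> z))} (\<lambda>(z, v). snd (\<phi> z) v)"
  unfolding continuous_on_iff
proof (intro ballI allI impI)
  fix y0 and \<epsilon> :: real
  assume "y0 \<in> {(z, v). z \<in> Z \<and> v \<in> total (fst (\<phi> z))}" and e: "\<epsilon> > 0"
  then obtain z0 v0 where y0: "y0 = (z0, v0)" and z0: "z0 \<in> Z" and v0: "v0 \<in> total (fst (\<phi> z0))" by blast
  note S0 = Sk_continuousD(1)[OF \<phi> z0]
  let ?E = "total (fst (\<phi> z0))"
  obtain d1 where d1: "d1 > 0" "\<And>v. v \<in> ?E \<Longrightarrow> dist v v0 < d1 \<Longrightarrow> dist (snd (\<phi> z0) v) (snd (\<phi> z0) v0) < \<epsilon> / 3"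
    using SkD(3)[OF S0] v0 e unfolding continuous_on_iff by (metis divide_pos_pos zero_less_numeral)
  define r where "r = min (d1 / 2) (\<epsilon> / 3)"
  have r: "r > 0" using d1 e by (simp add: r_def)
  obtain d2 where d2: "d2 > 0" "\<And>z. z \<in> Z \<Longrightarrow> dist z z0 < d2 \<Longrightarrow> Sk_dist p (\<phi> z0) (\<phi> z) < ennreal r"
    using Sk_continuousD(2)[OF \<phi> z0 r] by blast
  show "\<exists>d>0. \<forall>y\<in>{(z, v). z \<in> Z \<and> v \<in> total (fst (\<phi> z))}. dist y y0 < d \<longrightarrow>
      dist (case y of (z, v) \<Rightarrow> snd (\<phi> z) v) (case y0 of (z, v) \<Rightarrow> snd (\<phi> z) v) < \<epsilon>"
  proof (intro exI[of _ "min d2 r"] conjI ballI impI)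
    fix y assume "y \<in> {(z, v). z \<in> Z \<and> v \<in> total (fst (\<phi> z))}" and dy: "dist y y0 < min d2 r"
    then obtain z v where y: "y = (z, v)" and z: "z \<in> Z" and v: "v \<in> total (fst (\<phi> z))" by blast
    have dz: "dist z z0 < d2" using dy dist_fst_le[of y y0] by (simp add: y y0)
    have dv: "dist v v0 < r" using dy dist_snd_le[of y y0] by (simp add: y y0)
    obtain j where j: "j \<in> bundle_homeos p (fst (\<phi> z0)) (fst (\<phi> z))" "\<And>u. u \<in> ?E \<Longrightarrow> dist u (j u) < r"
      "\<And>u. u \<in> ?E \<Longrightarrow> dist (snd (\<phi> z0) u) (inv_into ?E j (snd (\<phi> z) (j u))) < r"
      using Sk_dist_lessD[OF d2(2)[OF z dz]] by blast
    define u where "u = inv_into ?E j v"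
    have u: "u \<in> ?E" "j u = v"
      unfolding u_def by (rule bundle_homeos_inv_mem[OF j(1) v], rule bundle_homeos_inv_right[OF j(1) v])
    have fv: "snd (\<phi> z) v \<in> total (fst (\<phi> z))" by (rule SkD(2)[OF Sk_continuousD(1)[OF \<phi> z] v])
    define w where "w = inv_into ?E j (snd (\<phi> z) v)"
    have w: "w \<in> ?E" "j w = snd (\<phi> z) v"
      unfolding w_def by (rule bundle_homeos_inv_mem[OF j(1) fv], rule bundle_homeos_inv_right[OF j(1) fv])
    have "dist u v0 < d1"
      using j(2)[OF u(1)] dv dist_triangle[of u v0 v] unfolding u(2) r_def by linarith
    then have "dist (snd (\<phi> z0) u) (snd (\<phi> z0) v0) < \<epsilon> / 3" by (rule d1(2)[OF u(1)])
    moreover have "dist (snd (\<phi> z0) u) w < \<epsilon> / 3" using j(3)[OF u(1)] by (simp add: u(2) w_def r_def)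
    moreover have "dist w (snd (\<phi> z) v) < \<epsilon> / 3" using j(2)[OF w(1)] by (simp add: w(2) r_def)
    ultimately show "dist (case y of (z, v) \<Rightarrow> snd (\<phi> z) v) (case y0 of (z, v) \<Rightarrow> snd (\<phi> z) v) < \<epsilon>"
      using dist_triangle[of "snd (\<phi> z) v" "snd (\<phi> z0) v0" w] dist_triangle[of w "snd (\<phi> z0) v0" "snd (\<phi> z0) u"]
      unfolding y y0 by (simp add: dist_commute)
  qed (use d2 r in simp)
qed

section \<open>Transport along paths of bundles\<close>

text \<open>\<open>transport_family\<close> with an arbitrary parameter space, to admit the square
  of a homotopy, and an arbitrary reference bundle, to compare paths that start in different
  bundles.\<close>

definition transports ::
  "('g::metric_space \<Rightarrow> 'x) \<Rightarrow> 'z::metric_space set \<Rightarrow> ('z \<Rightarrow> ('x, 'g) oriented_bundle) \<Rightarrow>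
   ('x, 'g) oriented_bundle \<Rightarrow> ('z \<Rightarrow> 'g \<Rightarrow> 'g) \<Rightarrow> bool" where
  "transports p Z e B h \<longleftrightarrow> (\<forall>z\<in>Z. h z \<in> bundle_homeos p B (e z)) \<and>
     continuous_on (Z \<times> total B) (\<lambda>(z, u). h z u)"

text \<open>Unlike \<open>pull_back_path\<close> this is not restricted to \<open>total B\<close>;
  values off the total space never matter, and composition is simpler.\<close>

definition pull_back ::
  "('z \<Rightarrow> ('x, 'g) oriented_bundle \<times> ('g \<Rightarrow> 'g)) \<Rightarrow> ('x, 'g) oriented_bundle \<Rightarrow> ('z \<Rightarrow> 'g \<Rightarrow> 'g) \<Rightarrow>
   'z \<Rightarrow> 'g \<Rightarrow> 'g" where
  "pull_back \<phi> B h z u = inv_into (total B) (h z) (snd (\<phi> z) (h z u))"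

lemma transports_homeo: "transports p Z e B h \<Longrightarrow> z \<in> Z \<Longrightarrow> h z \<in> bundle_homeos p B (e z)"
  by (simp add: transports_def)

lemma transports_cong:
  assumes "transports p Z e B h" "\<And>z. z \<in> Z \<Longrightarrow> e z = e' z"
  shows "transports p Z e' B h"
  using assms by (simp add: transports_def)

lemma transports_reparametrize:
  fixes m :: "'y::metric_space \<Rightarrow> 'z::metric_space"
  assumes h: "transports p Z e B h" and m: "continuous_on Y m" "\<And>y. y \<in> Y \<Longrightarrow> m y \<in> Z"
  shows "transports p Y (e \<circ> m) B (h \<circ> m)"
  unfolding transports_def
proof
  show "\<forall>y\<in>Y. (h \<circ> m) y \<in> bundle_homeos p B ((e \<circ> m) y)" using transports_homeo[OF h m(2)] by simp
  have "continuous_on (Y \<times> total B) (\<lambda>x. (m (fst x), snd x))"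
    by (intro continuous_intros continuous_on_compose2[OF m(1)]) auto
  moreover have "(\<lambda>x. (m (fst x), snd x)) ` (Y \<times> total B) \<subseteq> Z \<times> total B" using m(2) by auto
  ultimately show "continuous_on (Y \<times> total B) (\<lambda>(y, u). (h \<circ> m) y u)"
    using h continuous_on_compose2[of "Z \<times> total B" "\<lambda>x. h (fst x) (snd x)" "Y \<times> total B" "\<lambda>x. (m (fst x), snd x)"]
    unfolding transports_def case_prod_unfold by simp
qed

lemma transports_graph:
  assumes h: "transports p Z e B h"
  shows "(\<lambda>(z, u). (z, h z u)) ` (Z \<times> total B) = {(z, v). z \<in> Z \<and> v \<in> total (e z)}"
proof (intro set_eqI iffI)
  fix y assume "y \<in> (\<lambda>(z, u). (z, h z u)) ` (Z \<times> total B)"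
  then show "y \<in> {(z, v). z \<in> Z \<and> v \<in> total (e z)}"
    using bundle_homeos_mem[OF transports_homeo[OF h]] by auto
next
  fix y assume "y \<in> {(z, v). z \<in> Z \<and> v \<in> total (e z)}"
  then obtain z v where y: "y = (z, v)" "z \<in> Z" "v \<in> total (e z)" by blast
  let ?u = "inv_into (total B) (h z) v"
  have "?u \<in> total B" "h z ?u = v"
    using bundle_homeos_inv_mem[OF transports_homeo[OF h y(2)] y(3)]
      bundle_homeos_inv_right[OF transports_homeo[OF h y(2)] y(3)] by auto
  then have "y = (\<lambda>(z, u). (z, h z u)) (z, ?u)" "(z, ?u) \<in> Z \<times> total B" using y by auto
  then show "y \<in> (\<lambda>(z, u). (z, h z u)) ` (Z \<times> total B)" by (rule image_eqI)
qed

lemma transports_graph_continuous: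
  assumes h: "transports p Z e B h"
  shows "continuous_on (Z \<times> total B) (\<lambda>(z, u). (z, h z u))"
  using h unfolding transports_def case_prod_unfold by (intro continuous_intros) auto

lemma transports_graph_compact:
  assumes "transports p Z e B h" "compact Z" "compact (total B)"
  shows "compact {(z, v). z \<in> Z \<and> v \<in> total (e z)}"
  using compact_continuous_image[OF transports_graph_continuous[OF assms(1)] compact_Times[OF assms(2,3)]]
  unfolding transports_graph[OF assms(1)] .

text \<open>The map sending \<open>(z, u)\<close> to \<open>(z, h z u)\<close> is a continuous
  injection on a compact set, hence a homeomorphism onto its image, the graph of the family of total
  spaces.\<close>

lemma transports_inverse_continuous:
  assumes h: "transports p Z e B h" and "compact Z" "compact (total B)"
  shows "continuous_on {(z, v). z \<in> Z \<and> v \<in> total (e z)} (\<lambda>(z, v). inv_into (total B) (h z) v)"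
proof -
  have "continuous_on ((\<lambda>(z, u). (z, h z u)) ` (Z \<times> total B)) (\<lambda>(z, v). (z, inv_into (total B) (h z) v))"
    by (rule continuous_on_inv[OF transports_graph_continuous[OF h] compact_Times[OF assms(2,3)]])
      (use bundle_homeos_inv_left[OF transports_homeo[OF h]] in auto)
  then have "continuous_on {(z, v). z \<in> Z \<and> v \<in> total (e z)} (\<lambda>y. snd ((\<lambda>(z, v). (z, inv_into (total B) (h z) v)) y))"
    unfolding transports_graph[OF h] by (rule continuous_on_snd)
  then show ?thesis by (simp add: case_prod_unfold)
qed

lemma transports_transition_continuous:
  assumes h: "transports p Z e B h" and h': "transports p Z e B' h'" and "compact Z" "compact (total B')"
  shows "continuous_on (Z \<times> total B) (\<lambda>(z, u). inv_into (total B') (h' z) (h z u))"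
proof -
  have "(\<lambda>(z, u). (z, h z u)) ` (Z \<times> total B) \<subseteq> {(z, v). z \<in> Z \<and> v \<in> total (e z)}"
    using transports_graph[OF h] by simp
  from continuous_on_compose2[OF transports_inverse_continuous[OF h' assms(3,4)] transports_graph_continuous[OF h] this]
  show ?thesis by (simp add: case_prod_unfold)
qed

lemma pull_back_continuous:
  assumes h: "transports p Z (\<lambda>z. fst (\<phi> z)) B h" and \<phi>: "continuous_map (top_of_set Z) (Sk_topology p T \<E>) \<phi>"
    and "compact Z" "compact (total B)"
  shows "continuous_on (Z \<times> total B) (\<lambda>(z, u). pull_back \<phi> B h z u)"
proof -
  let ?Y = "{(z, v). z \<in> Z \<and> v \<in> total (fst (\<phi> z))}"
  have g: "(\<lambda>(z, u). (z, h z u)) ` (Z \<times> total B) \<subseteq> ?Y" using transports_graph[OF h] by simp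
  have 1: "continuous_on (Z \<times> total B) (\<lambda>x. (\<lambda>(z, v). snd (\<phi> z) v) ((\<lambda>(z, u). (z, h z u)) x))"
    by (rule continuous_on_compose2[OF Sk_evaluation_continuous[OF \<phi>] transports_graph_continuous[OF h] g])
  then have 2: "continuous_on (Z \<times> total B) (\<lambda>x. (fst x, snd (\<phi> (fst x)) (h (fst x) (snd x))))"
    unfolding case_prod_unfold by (intro continuous_intros) simp
  have "(\<lambda>x. (fst x, snd (\<phi> (fst x)) (h (fst x) (snd x)))) ` (Z \<times> total B) \<subseteq> ?Y"
    using SkD(2)[OF Sk_continuousD(1)[OF \<phi>]] bundle_homeos_mem[OF transports_homeo[OF h]] by auto
  from continuous_on_compose2[OF transports_inverse_continuous[OF h assms(3,4)] 2 this]
  show ?thesis by (simp add: case_prod_unfold pull_back_def)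
qed

lemma pull_back_conjugate:
  assumes h: "transports p Z (\<lambda>z. fst (\<phi> z)) B h" and z: "z \<in> Z" "\<phi> z \<in> Sk p T \<E>" and u: "u \<in> total B"
  shows "h z (pull_back \<phi> B h z u) = snd (\<phi> z) (h z u)" "pull_back \<phi> B h z u \<in> total B"
proof -
  note hz = transports_homeo[OF h z(1)]
  have "snd (\<phi> z) (h z u) \<in> total (fst (\<phi> z))" by (rule SkD(2)[OF z(2) bundle_homeos_mem[OF hz u]])
  then show "h z (pull_back \<phi> B h z u) = snd (\<phi> z) (h z u)" "pull_back \<phi> B h z u \<in> total B"
    unfolding pull_back_def by (rule bundle_homeos_inv_right[OF hz], rule bundle_homeos_inv_mem[OF hz])
qed

lemma pull_back_fibre:
  assumes h: "transports p Z (\<lambda>z. fst (\<phi> z)) B h" and z: "z \<in> Z" "\<phi> z \<in> Sk p T \<E>" and u: "u \<in> total B"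
  shows "p (pull_back \<phi> B h z u) = T (p u)"
proof -
  note hz = transports_homeo[OF h z(1)]
  have "p (pull_back \<phi> B h z u) = p (snd (\<phi> z) (h z u))"
    using bundle_homeos_fibre[OF hz pull_back_conjugate(2)[OF assms]] pull_back_conjugate(1)[OF assms] by simp
  also have "\<dots> = T (p (h z u))" by (rule SkD(4)[OF z(2) bundle_homeos_mem[OF hz u]])
  finally show ?thesis using bundle_homeos_fibre[OF hz u] by simp
qed

lemma pull_back_orient:
  assumes h: "transports p Z (\<lambda>z. fst (\<phi> z)) B h" and z: "z \<in> Z" "\<phi> z \<in> Sk p T \<E>"
    and B: "oriented_circle_subbundle p B" and E: "oriented_circle_subbundle p (fst (\<phi> z))"
    and c: "c \<in> orient B x"
  shows "pull_back \<phi> B h z \<circ> c \<in> orient B (T x)"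
proof -
  note hz = transports_homeo[OF h z(1)]
  have "inv_into (total B) (h z) \<circ> (snd (\<phi> z) \<circ> (h z \<circ> c)) \<in> orient B (T x)"
    by (rule bundle_homeos_orient[OF bundle_homeos_inverse[OF B E hz] SkD(5)[OF z(2) bundle_homeos_orient[OF hz c]]])
  then show ?thesis by (simp add: pull_back_def[abs_def] comp_def)
qed

section \<open>Existence of transports and independence of their choice\<close>

locale circle_bundle_space = compact_base_dynamics p T
  for p :: "'g::metric_space \<Rightarrow> 'x::metric_space" and T :: "'x \<Rightarrow> 'x" +
  fixes \<E> :: "('x, 'g) oriented_bundle set" and \<alpha> :: real
    and H :: "('x, 'g) oriented_bundle \<Rightarrow> ('x, 'g) oriented_bundle \<Rightarrow> 'g \<Rightarrow> 'g"
  assumes bundles: "\<And>E. E \<in> \<E> \<Longrightarrow> oriented_circle_subbundle p E"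
    and \<alpha>_pos: "\<alpha> > 0" and good: "good_homeo_family p \<E> \<alpha> H"
begin

text \<open>Here the joint continuity of \<open>H\<close> in both bundles and the point is used, by
  composition with the continuous map from \<open>(z, u)\<close> to
  \<open>((e z, e' z), h z u)\<close>.\<close>

lemma transports_step:
  fixes e e' :: "'z::metric_space \<Rightarrow> ('x, 'g) oriented_bundle"
  assumes e: "continuous_map (top_of_set Z) (bundle_topology p \<E>) e"
    and e': "continuous_map (top_of_set Z) (bundle_topology p \<E>) e'"
    and close: "\<And>z. z \<in> Z \<Longrightarrow> bundle_dist p (e z) (e' z) < ennreal \<alpha>"
    and h: "transports p Z e B h"
  shows "transports p Z e' B (\<lambda>z. H (e z) (e' z) \<circ> h z)"
  unfolding transports_def
proof (intro conjI ballI)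
  fix z assume z: "z \<in> Z"
  have "H (e z) (e' z) \<in> bundle_homeos p (e z) (e' z)"
    using good close[OF z] bundle_continuousD(1)[OF e z] bundle_continuousD(1)[OF e' z]
    unfolding good_homeo_family_def by blast
  then show "H (e z) (e' z) \<circ> h z \<in> bundle_homeos p B (e' z)"
    by (rule bundle_homeos_compose[OF transports_homeo[OF h z]])
next
  let ?D = "{((E, F), u). bundle_dist p E F < ennreal \<alpha> \<and> u \<in> total E}"
  let ?P = "prod_topology (prod_topology (bundle_topology p \<E>) (bundle_topology p \<E>)) euclidean"
  let ?W = "top_of_set (Z \<times> total B)"
  have f: "continuous_map ?W (top_of_set Z) fst"
    by (auto simp: continuous_map_in_subtopology intro!: continuous_intros)
  have 1: "continuous_map ?W (bundle_topology p \<E>) (\<lambda>x. e (fst x))"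
    using continuous_map_compose[OF f e] by (simp add: comp_def)
  have 2: "continuous_map ?W (bundle_topology p \<E>) (\<lambda>x. e' (fst x))"
    using continuous_map_compose[OF f e'] by (simp add: comp_def)
  have 3: "continuous_map ?W euclidean (\<lambda>x. h (fst x) (snd x))"
    using h by (simp add: transports_def case_prod_unfold)
  have "continuous_map ?W ?P (\<lambda>x. ((e (fst x), e' (fst x)), h (fst x) (snd x)))"
    by (intro continuous_map_pairedI 1 2 3)
  moreover have "(\<lambda>x. ((e (fst x), e' (fst x)), h (fst x) (snd x))) \<in> topspace ?W \<rightarrow> ?D"
    using close bundle_homeos_mem[OF transports_homeo[OF h]] by auto
  ultimately have "continuous_map ?W (subtopology ?P ?D) (\<lambda>x. ((e (fst x), e' (fst x)), h (fst x) (snd x)))"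
    by (simp add: continuous_map_in_subtopology)
  moreover have "continuous_map (subtopology ?P ?D) euclidean (\<lambda>((E, F), u). H E F u)"
    using good unfolding good_homeo_family_def by blast
  ultimately have "continuous_map ?W euclidean
      ((\<lambda>((E, F), u). H E F u) \<circ> (\<lambda>x. ((e (fst x), e' (fst x)), h (fst x) (snd x))))"
    by (rule continuous_map_compose)
  then show "continuous_on (Z \<times> total B) (\<lambda>(z, u). (H (e z) (e' z) \<circ> h z) u)"
    by (simp add: comp_def case_prod_unfold)
qed

text \<open>A Lebesgue number of the cover of \<open>Z\<close> by balls on which the bundle moves by
  less than \<open>r / 3\<close> from the centre.\<close>

lemma bundle_dist_uniform:
  fixes e :: "'z::metric_space \<Rightarrow> ('x, 'g) oriented_bundle"
  assumes e: "continuous_map (top_of_set Z) (bundle_topology p \<E>) e" and Z: "compact Z" and r: "r > 0"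
  shows "\<exists>d>0. \<forall>z\<in>Z. \<forall>z'\<in>Z. dist z z' < d \<longrightarrow> bundle_dist p (e z) (e z') < ennreal r"
proof -
  have "\<forall>z\<in>Z. \<exists>d>0. \<forall>y\<in>Z. dist y z < d \<longrightarrow> bundle_dist p (e z) (e y) < ennreal (r / 3)"
    using bundle_continuousD(2)[OF e] r by simp
  then obtain d where d: "\<And>z. z \<in> Z \<Longrightarrow> d z > 0"
    "\<And>z y. z \<in> Z \<Longrightarrow> y \<in> Z \<Longrightarrow> dist y z < d z \<Longrightarrow> bundle_dist p (e z) (e y) < ennreal (r / 3)"
    by metis
  let ?G = "(\<lambda>z. ball z (d z)) ` Z"
  have "Z \<subseteq> \<Union>?G" using d(1) by (auto intro!: bexI)
  then obtain \<epsilon> where eps: "\<epsilon> > 0" "\<forall>x\<in>Z. \<exists>G\<in>?G. ball x \<epsilon> \<subseteq> G"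
  proof (rule Heine_Borel_lemma[OF Z])
    show "open G" if "G \<in> ?G" for G using that by auto
  qed blast
  have "bundle_dist p (e z) (e z') < ennreal r" if z: "z \<in> Z" "z' \<in> Z" "dist z z' < \<epsilon>" for z z'
  proof -
    obtain y where y: "y \<in> Z" "ball z \<epsilon> \<subseteq> ball y (d y)" using bspec[OF eps(2) z(1)] by auto
    have "z \<in> ball z \<epsilon>" "z' \<in> ball z \<epsilon>" using z(3) eps(1) by auto
    then have "z \<in> ball y (d y)" "z' \<in> ball y (d y)" using y(2) by blast+
    then have dy: "dist z y < d y" "dist z' y < d y" by (simp_all add: dist_commute)
    note osb = bundles[OF bundle_continuousD(1)[OF e y(1)]] bundles[OF bundle_continuousD(1)[OF e z(1)]]
    have "bundle_dist p (e z) (e y) \<le> ennreal (r / 3)"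
      by (rule bundle_dist_sym_less[OF osb d(2)[OF y(1) z(1) dy(1)]])
    \<comment> \<open>The symmetry estimate returns only a weak inequality; enlarging
      \<open>r / 3\<close> to \<open>r / 2\<close> restores a strict one, and
      \<open>r / 2 + r / 3\<close> is still below \<open>r\<close>.\<close>
    also have "\<dots> < ennreal (r / 2)" using r by (simp add: ennreal_lessI)
    finally have "bundle_dist p (e z) (e z') \<le> ennreal (r / 2 + r / 3)"
      by (rule bundle_dist_triangle_less[OF _ d(2)[OF y(1) z(2) dy(2)]])
    also have "\<dots> < ennreal r" using r by (simp add: ennreal_lessI)
    finally show ?thesis .
  qed
  then show ?thesis using eps(1) by blast
qed

text \<open>The second coordinate is frozen at \<open>i / N\<close> by \<open>m i\<close>. For
  \<open>i = 0\<close> only the bundle \<open>B\<close> occurs and the identity is a transport; from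
  \<open>i\<close> to \<open>Suc i\<close> the bundles move by less than \<open>\<alpha>\<close>, so
  that \<open>H\<close> extends the transport; \<open>m N\<close> is the identity on the
  square.\<close>

lemma transports_square:
  fixes e :: "real \<times> real \<Rightarrow> ('x, 'g) oriented_bundle"
  assumes e: "continuous_map (top_of_set ({0..1} \<times> {0..1})) (bundle_topology p \<E>) e"
    and B: "\<And>s. s \<in> {0..1} \<Longrightarrow> e (s, 0) = B"
  shows "\<exists>h. transports p ({0..1} \<times> {0..1}) e B h"
proof -
  let ?Z = "{0..1::real} \<times> {0..1::real}"
  have Z: "compact ?Z" by (intro compact_Times compact_Icc)
  obtain d where d: "d > 0" "\<And>z z'. z \<in> ?Z \<Longrightarrow> z' \<in> ?Z \<Longrightarrow> dist z z' < d \<Longrightarrow> bundle_dist p (e z) (e z') < ennreal \<alpha>"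
    using bundle_dist_uniform[OF e Z \<alpha>_pos] by metis
  obtain N0 :: nat where N0: "1 / d < real N0" using reals_Archimedean2 by blast
  define N where "N = Suc N0"
  have N: "1 / real N < d" using N0 d(1) by (simp add: N_def field_simps)
  define m where "m = (\<lambda>i z. (fst z, min (snd z) (real i / real N)) :: real \<times> real)"
  have mZ: "m i z \<in> ?Z" if "z \<in> ?Z" for i z using that by (auto simp: m_def min_def)
  have mc: "continuous_on ?Z (m i)" for i unfolding m_def by (intro continuous_intros)
  have em: "continuous_map (top_of_set ?Z) (bundle_topology p \<E>) (\<lambda>z. e (m i z))" for i
  proof -
    have "continuous_map (top_of_set ?Z) (top_of_set ?Z) (m i)"
      using mc mZ by (auto simp: continuous_map_in_subtopology)
    from continuous_map_compose[OF this e] show ?thesis by (simp add: comp_def)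
  qed
  have "\<exists>h. transports p ?Z (\<lambda>z. e (m i z)) B h" for i
  proof (induction i)
    case 0
    have "e (m 0 z) = B" if "z \<in> ?Z" for z
      using that B[of "fst z"] by (auto simp: m_def)
    then have "transports p ?Z (\<lambda>z. e (m 0 z)) B (\<lambda>z. id)"
      unfolding transports_def using bundle_homeos_id[of p B]
      by (auto simp: case_prod_unfold intro!: continuous_intros)
    then show ?case by blast
  next
    case (Suc i)
    then obtain h where h: "transports p ?Z (\<lambda>z. e (m i z)) B h" by blast
    have "bundle_dist p (e (m i z)) (e (m (Suc i) z)) < ennreal \<alpha>" if z: "z \<in> ?Z" for z
    proof (rule d(2)[OF mZ[OF z] mZ[OF z]])
      have "dist (m i z) (m (Suc i) z) = \<bar>min (snd z) (real i / real N) - min (snd z) (real (Suc i) / real N)\<bar>"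
        by (simp add: m_def dist_Pair_Pair dist_real_def)
      also have "\<dots> \<le> real (Suc i) / real N - real i / real N"
      proof -
        have "real i / real N \<le> real (Suc i) / real N" by (intro divide_right_mono) auto
        then show ?thesis by (auto simp: min_def)
      qed
      also have "\<dots> = 1 / real N" by (simp add: diff_divide_distrib[symmetric])
      finally show "dist (m i z) (m (Suc i) z) < d" using N by linarith
    qed
    from transports_step[OF em em this h] show ?case by blast
  qed
  then obtain h where h: "transports p ?Z (\<lambda>z. e (m N z)) B h" by blast
  have "m N z = z" if "z \<in> ?Z" for z using that by (auto simp: m_def N_def min_def)
  then have "transports p ?Z e B h" by (intro transports_cong[OF h]) simp
  then show ?thesis by blast
qed

text \<open>An interval is treated as a square that does not depend on its first coordinate.\<close>

lemma transports_interval: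
  fixes e :: "real \<Rightarrow> ('x, 'g) oriented_bundle"
  assumes e: "continuous_map (top_of_set {0..1}) (bundle_topology p \<E>) e"
  shows "\<exists>h. transports p {0..1} e (e 0) h"
proof -
  have "continuous_map (top_of_set ({0..1::real} \<times> {0..1::real})) (top_of_set {0..1}) snd"
    by (auto simp: continuous_map_in_subtopology intro!: continuous_intros)
  from continuous_map_compose[OF this e]
  have "continuous_map (top_of_set ({0..1::real} \<times> {0..1})) (bundle_topology p \<E>) (\<lambda>z. e (snd z))"
    by (simp add: comp_def)
  from transports_square[OF this] obtain h where h: "transports p ({0..1::real} \<times> {0..1}) (\<lambda>z. e (snd z)) (e 0) h"
    by auto
  have "transports p {0..1} ((\<lambda>z. e (snd z)) \<circ> (\<lambda>t. (0 :: real, t))) (e 0) (h \<circ> (\<lambda>t. (0, t)))"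
    by (rule transports_reparametrize[OF h]) (auto intro!: continuous_intros)
  then show ?thesis by (auto simp: comp_def)
qed

lemma pull_back_fibre_family:
  assumes \<phi>: "continuous_map (top_of_set {0..1}) (Sk_topology p T \<E>) \<phi>"
    and h: "transports p {0..1} (\<lambda>t. fst (\<phi> t)) B h" and B: "oriented_circle_subbundle p B"
  shows "fibre_family p B B T (pull_back \<phi> B h)"
  unfolding fibre_family_def
proof (intro conjI ballI allI)
  show "continuous_on ({0..1} \<times> total B) (\<lambda>(t, u). pull_back \<phi> B h t u)"
    by (rule pull_back_continuous[OF h \<phi> _ compact_total[OF B]]) simp
  fix t :: real assume t: "t \<in> {0..1}"
  note S = Sk_continuousD(1)[OF \<phi> t]
  show "pull_back \<phi> B h t u \<in> total B" "p (pull_back \<phi> B h t u) = T (p u)" if "u \<in> total B" for u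
    by (rule pull_back_conjugate(2)[OF h t S that], rule pull_back_fibre[OF h t S that])
  show "pull_back \<phi> B h t \<circ> c \<in> orient B (T x)" if "c \<in> orient B x" for x c
    by (rule pull_back_orient[OF h t S B bundles[OF SkD(1)[OF S]] that])
qed

lemma transition_fibre_family:
  fixes e :: "real \<Rightarrow> ('x, 'g) oriented_bundle"
  assumes h: "transports p {0..1} e B h" and h': "transports p {0..1} e B' h'"
    and e: "\<And>t. t \<in> {0..1} \<Longrightarrow> oriented_circle_subbundle p (e t)"
    and B': "oriented_circle_subbundle p B'"
  shows "fibre_family p B B' id (\<lambda>t u. inv_into (total B') (h' t) (h t u))"
  unfolding fibre_family_def
proof (intro conjI ballI allI)
  show "continuous_on ({0..1} \<times> total B) (\<lambda>(t, u). inv_into (total B') (h' t) (h t u))"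
    by (rule transports_transition_continuous[OF h h' _ compact_total[OF B']]) simp
  fix t :: real assume t: "t \<in> {0..1}"
  note ht = transports_homeo[OF h t] and ht' = transports_homeo[OF h' t]
  note k = bundle_homeos_compose[OF ht bundle_homeos_inverse[OF B' e[OF t] ht']]
  show "inv_into (total B') (h' t) (h t u) \<in> total B'" "p (inv_into (total B') (h' t) (h t u)) = id (p u)"
    if "u \<in> total B" for u
    using bundle_homeos_mem[OF k that] bundle_homeos_fibre[OF k that] by simp_all
  show "(\<lambda>u. inv_into (total B') (h' t) (h t u)) \<circ> c \<in> orient B' (id x)" if "c \<in> orient B x" for x c
    using bundle_homeos_orient[OF k that] by (simp add: comp_def)
qed

text \<open>The transition maps between the two transports conjugate one pull-back to the other. The
  reference bundles \<open>B\<close> and \<open>B'\<close> may differ.\<close>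

lemma rotates_transport_independent:
  assumes \<phi>: "continuous_map (top_of_set {0..1}) (Sk_topology p T \<E>) \<phi>"
    and h: "transports p {0..1} (\<lambda>t. fst (\<phi> t)) B h" and B: "oriented_circle_subbundle p B"
    and h': "transports p {0..1} (\<lambda>t. fst (\<phi> t)) B' h'" and B': "oriented_circle_subbundle p B'"
  shows "rotates p T B (pull_back \<phi> B h) x r \<longleftrightarrow> rotates p T B' (pull_back \<phi> B' h') x r"
proof (rule rotates_conjugate[OF B B' pull_back_fibre_family[OF \<phi> h' B'] pull_back_fibre_family[OF \<phi> h B]])
  show "fibre_family p B B' id (\<lambda>t u. inv_into (total B') (h' t) (h t u))"
    by (rule transition_fibre_family[OF h h' bundles[OF SkD(1)[OF Sk_continuousD(1)[OF \<phi>]]] B'])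
  fix t :: real and u assume t: "t \<in> {0..1}" and u: "u \<in> total B"
  note S = Sk_continuousD(1)[OF \<phi> t]
  show "inv_into (total B') (h' t) (h t (pull_back \<phi> B h t u)) =
      pull_back \<phi> B' h' t (inv_into (total B') (h' t) (h t u))"
    unfolding pull_back_conjugate(1)[OF h t S u] unfolding pull_back_def
    using bundle_homeos_inv_right[OF transports_homeo[OF h' t] bundle_homeos_mem[OF transports_homeo[OF h t] u]]
    by simp
qed

lemma transport_family_iff: "transport_family p \<phi> h \<longleftrightarrow> transports p {0..1} (\<lambda>t. fst (\<phi> t)) (fst (\<phi> 0)) h"
  unfolding transport_family_def transports_def by simp

text \<open>Restriction does not alter iterates on \<open>total B\<close>, which \<open>f t\<close>
  maps into itself; the particular parametrizations and starting points matter only up to a bounded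
  error.\<close>

lemma has_rotation_number_fixed_iff:
  assumes l: "\<And>x. l x \<in> orient B x" and B: "oriented_circle_subbundle p B" and f: "fibre_family p B B T f"
  shows "has_rotation_number_fixed p T B l (\<lambda>t. restrict (f t) (total B)) x r \<longleftrightarrow> rotates p T B f x r"
proof -
  have it: "(restrict (f t) (total B) ^^ n) u = (f t ^^ n) u" if "t \<in> {0..1}" "u \<in> total B" for t u n
  proof (induction n)
    case (Suc n)
    then show ?case using fibre_family_funpow_total[OF f that, of n] by simp
  qed simp
  have len: "algebraic_length c (\<lambda>t. (restrict (f t) (total B) ^^ n) u) = algebraic_length c (\<lambda>t. (f t ^^ n) u)"
    if "u \<in> total B" for c n u
    by (rule algebraic_length_cong) (rule it[OF _ that])
  have iff: "(\<lambda>n. algebraic_length (l ((T ^^ n) x)) (\<lambda>t. (restrict (f t) (total B) ^^ n) u) / real n) \<longlonglongrightarrow> r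
    \<longleftrightarrow> rotates p T B f x r" if u: "u \<in> fibre p B x" for u
    unfolding len[OF fibre_subset_total[OF u]] rotates_iff[OF B l f]
    by (rule rotates_orbit_length[OF B l f u l])
  have "l x (circle_point 0) \<in> fibre p B x" by (rule circle_bundle_mem[OF B l])
  then show ?thesis unfolding has_rotation_number_fixed_def using iff by blast
qed

text \<open>One transport decides for all, even from a bundle \<open>B\<close> other than the
  initial one. This freedom allows two nearby paths to be compared over a common
  \<open>B\<close>.\<close>

lemma has_rotation_number_iff:
  assumes \<phi>: "continuous_map (top_of_set {0..1}) (Sk_topology p T \<E>) \<phi>"
    and h: "transports p {0..1} (\<lambda>t. fst (\<phi> t)) B h" and B: "oriented_circle_subbundle p B"
    and l: "unit_length_structure \<E> l"
  shows "has_rotation_number p T l \<phi> x r \<longleftrightarrow> rotates p T B (pull_back \<phi> B h) x r"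
proof -
  let ?E = "fst (\<phi> 0)"
  have E: "?E \<in> \<E>" using SkD(1)[OF Sk_continuousD(1)[OF \<phi>]] by simp
  have lE: "l ?E x \<in> orient ?E x" for x using l E by (simp add: unit_length_structure_def)
  have pb: "pull_back_path \<phi> h = (\<lambda>t. restrict (pull_back \<phi> ?E h t) (total ?E))" for h
    by (simp add: pull_back_path_def fun_eq_iff pull_back_def restrict_def)
  have "has_rotation_number_fixed p T ?E (l ?E) (pull_back_path \<phi> h') x r \<longleftrightarrow> rotates p T B (pull_back \<phi> B h) x r"
    if h': "transport_family p \<phi> h'" for h'
  proof -
    have t: "transports p {0..1} (\<lambda>t. fst (\<phi> t)) ?E h'" using h' by (simp add: transport_family_iff)
    show ?thesis
      unfolding pb has_rotation_number_fixed_iff[OF lE bundles[OF E] pull_back_fibre_family[OF \<phi> t bundles[OF E]]]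
      by (rule rotates_transport_independent[OF \<phi> t bundles[OF E] h B])
  qed
  moreover have "\<exists>h. transport_family p \<phi> h"
    using transports_interval[OF continuous_map_compose[OF \<phi> continuous_map_Sk_fst]]
    by (simp add: transport_family_iff comp_def)
  ultimately show ?thesis unfolding has_rotation_number_def by blast
qed

end

section \<open>Homotopy invariance and continuity of the rotation number\<close>

context circle_bundle_space
begin

text \<open>Although \<open>\<Phi>\<close> is constant, \<open>h s\<close> may move with
  \<open>s\<close>, so the pulled back family is not constant. It is conjugate to the one for the
  transport frozen at \<open>h 0\<close>, which is constant and has orbits of length 0.\<close>

lemma pull_back_stationary_side:
  fixes \<Phi> :: "real \<Rightarrow> ('x, 'g) oriented_bundle \<times> ('g \<Rightarrow> 'g)"
  assumes \<Phi>: "continuous_map (top_of_set {0..1}) (Sk_topology p T \<E>) \<Phi>"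
    and h: "transports p {0..1} (\<lambda>s. fst (\<Phi> s)) B h" and B: "oriented_circle_subbundle p B"
    and const: "\<And>s. s \<in> {0..1} \<Longrightarrow> \<Phi> s = \<Phi> 0"
  shows "\<exists>M. \<forall>n x u c. u \<in> fibre p B x \<longrightarrow> c \<in> orient B ((T ^^ n) x) \<longrightarrow>
    \<bar>algebraic_length c (\<lambda>s. (pull_back \<Phi> B h s ^^ n) u)\<bar> \<le> M"
proof -
  have h0: "transports p {0..1} (\<lambda>s. fst (\<Phi> s)) B (h \<circ> (\<lambda>s. 0))"
  proof (rule transports_cong)
    show "transports p {0..1} ((\<lambda>s. fst (\<Phi> s)) \<circ> (\<lambda>s. 0)) B (h \<circ> (\<lambda>s. 0))"
      by (rule transports_reparametrize[OF h]) (auto intro!: continuous_intros)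
    show "((\<lambda>s. fst (\<Phi> s)) \<circ> (\<lambda>s. 0)) s = fst (\<Phi> s)" if "s \<in> {0..1}" for s using const[OF that] by simp
  qed
  have osb: "oriented_circle_subbundle p (fst (\<Phi> s))" if "s \<in> {0..1}" for s
    by (rule bundles[OF SkD(1)[OF Sk_continuousD(1)[OF \<Phi> that]]])
  let ?f = "pull_back \<Phi> B (h \<circ> (\<lambda>s. 0))" and ?k = "\<lambda>s u. inv_into (total B) ((h \<circ> (\<lambda>s. 0)) s) (h s u)"
  note f' = pull_back_fibre_family[OF \<Phi> h B] and f = pull_back_fibre_family[OF \<Phi> h0 B]
  have k: "fibre_family p B B id ?k" by (rule transition_fibre_family[OF h h0 osb B])
  have conj: "?k t (pull_back \<Phi> B h t u) = ?f t (?k t u)" if t: "t \<in> {0..1}" and u: "u \<in> total B" for t u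
  proof -
    note S = Sk_continuousD(1)[OF \<Phi> t]
    show ?thesis
      unfolding pull_back_conjugate(1)[OF h t S u] unfolding pull_back_def
      using bundle_homeos_inv_right[OF transports_homeo[OF h0 t] bundle_homeos_mem[OF transports_homeo[OF h t] u]]
      by simp
  qed
  from conjugate_families_length[OF B B f f' k, OF conj] obtain M where
    M: "\<forall>n x u w c c'. u \<in> fibre p B x \<longrightarrow> w \<in> fibre p B x \<longrightarrow>
      c \<in> orient B ((T ^^ n) x) \<longrightarrow> c' \<in> orient B ((T ^^ n) x) \<longrightarrow>
      \<bar>algebraic_length c (\<lambda>t. (pull_back \<Phi> B h t ^^ n) u) - algebraic_length c' (\<lambda>t. (?f t ^^ n) w)\<bar> \<le> M" ..
  have "\<bar>algebraic_length c (\<lambda>s. (pull_back \<Phi> B h s ^^ n) u)\<bar> \<le> M"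
    if u: "u \<in> fibre p B x" and c: "c \<in> orient B ((T ^^ n) x)" for n x u c
  proof -
    have eq: "?f t = ?f 0" if "t \<in> {0..1}" for t
      by (rule ext) (simp add: pull_back_def const[OF that])
    have "(?f 0 ^^ n) u \<in> fibre p B ((T ^^ n) x)"
      by (rule fibre_family_fibre[OF fibre_family_funpow[OF f] _ u]) simp
    then have "algebraic_length c (\<lambda>t. (?f t ^^ n) u) = 0"
      by (rule algebraic_length_const[OF circle_bundle_parametrization[OF B c]]) (simp only: eq)
    then show ?thesis using M[rule_format, OF u u c c] by simp
  qed
  then show ?thesis by blast
qed

text \<open>For each \<open>n\<close> the square identity is applied to the orbit of a base point
  under the \<open>n\<close>-th iterate. Two sides give the orbit lengths for \<open>s = 0\<close>
  and \<open>s = 1\<close>; the other two are stationary and contribute at most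
  \<open>M0 + M1\<close> for all \<open>n\<close>.\<close>

lemma rotates_homotopic:
  assumes \<Phi>: "continuous_map (top_of_set ({0..1} \<times> {0..1})) (Sk_topology p T \<E>) \<Phi>"
    and h: "transports p ({0..1} \<times> {0..1}) (\<lambda>z. fst (\<Phi> z)) B h" and B: "oriented_circle_subbundle p B"
    and ends: "\<And>s. s \<in> {0..1} \<Longrightarrow> \<Phi> (s, 0) = \<Phi> (0, 0)" "\<And>s. s \<in> {0..1} \<Longrightarrow> \<Phi> (s, 1) = \<Phi> (0 :: real, 1 :: real)"
  shows "rotates p T B (pull_back (\<lambda>t. \<Phi> (0, t)) B (\<lambda>t. h (0, t))) x r \<longleftrightarrow>
    rotates p T B (pull_back (\<lambda>t. \<Phi> (1, t)) B (\<lambda>t. h (1, t))) x r"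
proof -
  let ?Z = "{0..1::real} \<times> {0..1::real}"
  let ?f = "pull_back \<Phi> B h"
  have line: "continuous_map (top_of_set {0..1}) (Sk_topology p T \<E>) (\<lambda>t. \<Phi> (m t))"
    "transports p {0..1} (\<lambda>t. fst (\<Phi> (m t))) B (\<lambda>t. h (m t))"
    if m: "continuous_on {0..1} m" "\<And>t. t \<in> {0..1} \<Longrightarrow> m t \<in> ?Z" for m :: "real \<Rightarrow> real \<times> real"
  proof -
    have "continuous_map (top_of_set {0..1}) (top_of_set ?Z) m"
      using m by (auto simp: continuous_map_in_subtopology)
    from continuous_map_compose[OF this \<Phi>]
    show "continuous_map (top_of_set {0..1}) (Sk_topology p T \<E>) (\<lambda>t. \<Phi> (m t))" by (simp add: comp_def)
    show "transports p {0..1} (\<lambda>t. fst (\<Phi> (m t))) B (\<lambda>t. h (m t))"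
      using transports_reparametrize[OF h m] by (simp add: comp_def)
  qed
  have hor: "continuous_map (top_of_set {0..1}) (Sk_topology p T \<E>) (\<lambda>t. \<Phi> (s, t))"
    "transports p {0..1} (\<lambda>t. fst (\<Phi> (s, t))) B (\<lambda>t. h (s, t))" if "s \<in> {0..1}" for s
    by (rule line, use that in \<open>auto intro!: continuous_intros\<close>)+
  have ver: "continuous_map (top_of_set {0..1}) (Sk_topology p T \<E>) (\<lambda>s. \<Phi> (s, t))"
    "transports p {0..1} (\<lambda>s. fst (\<Phi> (s, t))) B (\<lambda>s. h (s, t))" if "t \<in> {0..1}" for t
    by (rule line, use that in \<open>auto intro!: continuous_intros\<close>)+
  have pb: "pull_back (\<lambda>t. \<Phi> (s, t)) B (\<lambda>t. h (s, t)) = (\<lambda>t. ?f (s, t))"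
    "pull_back (\<lambda>s. \<Phi> (s, t)) B (\<lambda>s. h (s, t)) = (\<lambda>s. ?f (s, t))" for s t
    by (simp_all add: pull_back_def fun_eq_iff)
  have bd: "\<exists>M. \<forall>n x u c. u \<in> fibre p B x \<longrightarrow> c \<in> orient B ((T ^^ n) x) \<longrightarrow>
      \<bar>algebraic_length c (\<lambda>s. (?f (s, t) ^^ n) u)\<bar> \<le> M" if t: "t = 0 \<or> t = 1" for t
  proof -
    have t01: "t \<in> {0..1}" using t by auto
    have "\<Phi> (s, t) = \<Phi> (0, t)" if "s \<in> {0..1}" for s using t ends[OF that] by auto
    from pull_back_stationary_side[OF ver[OF t01] B, OF this] show ?thesis unfolding pb .
  qed
  obtain M0 where M0: "\<forall>n x u c. u \<in> fibre p B x \<longrightarrow> c \<in> orient B ((T ^^ n) x) \<longrightarrow>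
      \<bar>algebraic_length c (\<lambda>s. (?f (s, 0) ^^ n) u)\<bar> \<le> M0" using bd[of 0] by auto
  obtain M1 where M1: "\<forall>n x u c. u \<in> fibre p B x \<longrightarrow> c \<in> orient B ((T ^^ n) x) \<longrightarrow>
      \<bar>algebraic_length c (\<lambda>s. (?f (s, 1) ^^ n) u)\<bar> \<le> M1" using bd[of 1] by auto
  have fam: "fibre_family p B B T (\<lambda>t. ?f (s, t))" if "s \<in> {0..1}" for s
    using pull_back_fibre_family[OF hor[OF that] B] unfolding pb .
  have fc: "continuous_on (?Z \<times> total B) (\<lambda>(z, u). ?f z u)"
    by (rule pull_back_continuous[OF h \<Phi> _ compact_total[OF B]]) (intro compact_Times compact_Icc)
  obtain l where l: "\<And>x. l x \<in> orient B x" using circle_bundle_section[OF B] by blast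
  have bound: "\<bar>orbit_length l (\<lambda>t. ?f (1, t)) n x - orbit_length l (\<lambda>t. ?f (0, t)) n x\<bar> \<le> M0 + M1" for n
  proof -
    let ?u = "l x (circle_point 0)" and ?c = "l ((T ^^ n) x)"
    have u: "?u \<in> fibre p B x" by (rule base_point[OF B l])
    note uB = fibre_subset_total[OF u]
    have cont: "continuous_on ?Z (\<lambda>z. (?f z ^^ n) ?u)"
    proof (induction n)
      case (Suc n)
      have m: "(?f z ^^ n) ?u \<in> total B" if "z \<in> ?Z" for z
        using fibre_family_funpow_total[OF fam, of "fst z" "snd z" ?u n] that uB by auto
      have "continuous_on ?Z (\<lambda>z. (z, (?f z ^^ n) ?u))" by (intro continuous_intros Suc)
      moreover have "(\<lambda>z. (z, (?f z ^^ n) ?u)) ` ?Z \<subseteq> ?Z \<times> total B" using m by blast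
      ultimately have "continuous_on ?Z (\<lambda>z. (\<lambda>(z, u). ?f z u) (z, (?f z ^^ n) ?u))"
        by (rule continuous_on_compose2[OF fc])
      then show ?case by simp
    qed simp
    have "algebraic_length ?c (\<lambda>t. (?f (1, t) ^^ n) ?u) - algebraic_length ?c (\<lambda>t. (?f (0, t) ^^ n) ?u)
      = algebraic_length ?c (\<lambda>s. (?f (s, 1) ^^ n) ?u) - algebraic_length ?c (\<lambda>s. (?f (s, 0) ^^ n) ?u)"
    proof (rule algebraic_length_square[OF circle_bundle_parametrization[OF B l]])
      show "continuous_on ({0..1} \<times> {0..1}) (\<lambda>(s, t). (?f (s, t) ^^ n) ?u)"
        using cont by (simp add: case_prod_unfold)
      show "(?f (s, t) ^^ n) ?u \<in> fibre p B ((T ^^ n) x)" if "s \<in> {0..1}" "t \<in> {0..1}" for s t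
        by (rule fibre_family_fibre[OF fibre_family_funpow[OF fam[OF that(1)]] that(2) u])
    qed
    moreover have "\<bar>algebraic_length ?c (\<lambda>s. (?f (s, 0) ^^ n) ?u)\<bar> \<le> M0" using M0[rule_format, OF u l] .
    moreover have "\<bar>algebraic_length ?c (\<lambda>s. (?f (s, 1) ^^ n) ?u)\<bar> \<le> M1" using M1[rule_format, OF u l] .
    ultimately show ?thesis unfolding orbit_length_def by linarith
  qed
  show ?thesis
    unfolding pb rotates_iff[OF B l fam, of 0, simplified] rotates_iff[OF B l fam, of 1, simplified]
    by (rule bounded_difference_averages(2)[symmetric]) (rule bound)
qed

lemma has_rotation_number_homotopic:
  assumes l: "unit_length_structure \<E> l" and \<phi>: "\<phi> \<in> Sk_paths p T \<E>" and \<psi>: "\<psi> \<in> Sk_paths p T \<E>"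
    and hom: "homotopic_with (\<lambda>\<gamma>. \<gamma> 0 = \<phi> 0 \<and> \<gamma> 1 = \<phi> 1) (top_of_set {0..1}) (Sk_topology p T \<E>) \<phi> \<psi>"
  shows "has_rotation_number p T l \<phi> x r \<longleftrightarrow> has_rotation_number p T l \<psi> x r"
proof -
  obtain \<Phi> where "continuous_map (prod_topology (top_of_set {0..1}) (top_of_set {0..1})) (Sk_topology p T \<E>) \<Phi>"
    and \<Phi>0: "\<forall>t. \<Phi> (0 :: real, t) = \<phi> t" and \<Phi>1: "\<forall>t. \<Phi> (1, t) = \<psi> t"
    and ends: "\<forall>s\<in>{0..1}. \<Phi> (s, 0) = \<phi> 0 \<and> \<Phi> (s, 1) = \<phi> 1"
    using hom unfolding homotopic_with_def by blast
  then have \<Phi>: "continuous_map (top_of_set ({0..1} \<times> {0..1})) (Sk_topology p T \<E>) \<Phi>"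
    by (simp add: prod_topology_subtopology_eu)
  let ?B = "fst (\<phi> 0)"
  have B: "oriented_circle_subbundle p ?B" by (rule bundles[OF SkD(1)[OF Sk_pathsD(1)[OF \<phi>]]]) simp
  have "continuous_map (top_of_set ({0..1} \<times> {0..1})) (bundle_topology p \<E>) (\<lambda>z. fst (\<Phi> z))"
    using continuous_map_compose[OF \<Phi> continuous_map_Sk_fst] by (simp add: comp_def)
  \<comment> \<open>The bundle is constant along the side \<open>t = 0\<close> since the homotopy
    fixes the extremities; this is what lets the transport over the square start from the
    identity.\<close>
  from transports_square[OF this, of ?B] obtain h where
    h: "transports p ({0..1} \<times> {0..1}) (\<lambda>z. fst (\<Phi> z)) ?B h" using ends by auto
  have t: "transports p {0..1} (\<lambda>t. fst (\<Phi> (s, t))) ?B (\<lambda>t. h (s, t))" if "s \<in> {0..1}" for s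
  proof -
    have "continuous_on {0..1} (\<lambda>t. (s, t))" by (intro continuous_intros)
    from transports_reparametrize[OF h this] that show ?thesis by (simp add: comp_def)
  qed
  have eq: "(\<lambda>t. \<Phi> (0, t)) = \<phi>" "(\<lambda>t. \<Phi> (1, t)) = \<psi>" using \<Phi>0 \<Phi>1 by auto
  have 0: "transports p {0..1} (\<lambda>t. fst (\<phi> t)) ?B (\<lambda>t. h (0, t))" using t[of 0] \<Phi>0 by simp
  have 1: "transports p {0..1} (\<lambda>t. fst (\<psi> t)) ?B (\<lambda>t. h (1, t))" using t[of 1] \<Phi>1 by simp
  show ?thesis
    unfolding has_rotation_number_iff[OF Sk_pathsD(2)[OF \<phi>] 0 B l] has_rotation_number_iff[OF Sk_pathsD(2)[OF \<psi>] 1 B l]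
    using rotates_homotopic[OF \<Phi> h B] ends unfolding eq by simp
qed

text \<open>Continuity of \<open>H\<close> at \<open>((e t, e t), h t u)\<close> gives a
  neighbourhood of \<open>(t, u)\<close> and a radius \<open>r\<close> that works throughout it.
  Compactness is needed only for the parameters \<open>(t, u)\<close>, not for the bundles
  \<open>F\<close>.\<close>

lemma transports_close:
  fixes e :: "real \<Rightarrow> ('x, 'g) oriented_bundle"
  assumes e: "continuous_map (top_of_set {0..1}) (bundle_topology p \<E>) e"
    and h: "transports p {0..1} e B h" and B: "oriented_circle_subbundle p B" and \<epsilon>: "\<epsilon> > 0"
  shows "\<exists>r>0. \<forall>t\<in>{0..1}. \<forall>F\<in>\<E>. \<forall>u\<in>total B. bundle_dist p (e t) F < ennreal r \<longrightarrow>
    dist (H (e t) F (h t u)) (H (e t) (e t) (h t u)) < \<epsilon>"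
proof -
  let ?K = "{0..1::real} \<times> total B"
  define near where "near = (\<lambda>x r. \<forall>F\<in>\<E>. bundle_dist p (e (fst x)) F < ennreal r \<longrightarrow>
    dist (H (e (fst x)) F (h (fst x) (snd x))) (H (e (fst x)) (e (fst x)) (h (fst x) (snd x))) < \<epsilon>)"
  have local: "\<exists>d>0. \<exists>r>0. \<forall>y\<in>?K. dist y x < d \<longrightarrow> near y r" if x: "x \<in> ?K" for x
  proof -
    obtain t u where tu: "x = (t, u)" "t \<in> {0..1}" "u \<in> total B" using x by blast
    let ?D = "{((E, F), u). bundle_dist p E F < ennreal \<alpha> \<and> u \<in> total E}"
    let ?P = "prod_topology (prod_topology (bundle_topology p \<E>) (bundle_topology p \<E>)) euclidean"
    let ?q = "((e t, e t), h t u)" and ?G = "\<lambda>((E, F), u). H E F u"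
    let ?b = "ball (H (e t) (e t) (h t u)) (\<epsilon> / 2)"
    have G: "continuous_map (subtopology ?P ?D) euclidean ?G"
      using good unfolding good_homeo_family_def by blast
    note et = bundle_continuousD(1)[OF e tu(2)]
    have hu: "h t u \<in> total (e t)" by (rule bundle_homeos_mem[OF transports_homeo[OF h tu(2)] tu(3)])
    have "openin (subtopology ?P ?D) {y \<in> topspace (subtopology ?P ?D). ?G y \<in> ?b}"
      by (rule openin_continuous_map_preimage[OF G]) simp
    then obtain W where W: "openin ?P W" "{y \<in> topspace (subtopology ?P ?D). ?G y \<in> ?b} = W \<inter> ?D"
      unfolding openin_subtopology by blast
    have "?q \<in> {y \<in> topspace (subtopology ?P ?D). ?G y \<in> ?b}"
      using et hu \<epsilon> \<alpha>_pos by (simp add: bundle_topology_def bundle_dist_self)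
    then have "?q \<in> W" unfolding W(2) by blast
    then obtain V V3 where V: "openin (prod_topology (bundle_topology p \<E>) (bundle_topology p \<E>)) V"
      "open V3" "(e t, e t) \<in> V" "h t u \<in> V3" "V \<times> V3 \<subseteq> W"
      using W(1) unfolding openin_prod_topology_alt[of _ euclidean] open_openin[symmetric] by meson
    obtain V1 V2 where V12: "openin (bundle_topology p \<E>) V1" "openin (bundle_topology p \<E>) V2"
      "e t \<in> V1" "e t \<in> V2" "V1 \<times> V2 \<subseteq> V"
      using V(1,3) unfolding openin_prod_topology_alt by meson
    have "openin (bundle_topology p \<E>) (V1 \<inter> V2)" using V12(1,2) by (rule openin_Int)
    then have "\<exists>r>0. \<forall>y\<in>\<E>. bundle_dist p (e t) y < r \<longrightarrow> y \<in> V1 \<inter> V2"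
      unfolding bundle_topology_def openin_dist_topology using V12(3,4) by blast
    then obtain r0 where r0: "r0 > 0" "\<And>y. y \<in> \<E> \<Longrightarrow> bundle_dist p (e t) y < r0 \<Longrightarrow> y \<in> V1 \<inter> V2" by blast
    obtain s where s: "s > 0" "ennreal s < r0" using ennreal_pos_real_below[OF r0(1)] by blast
    \<comment> \<open>One half of \<open>s\<close> pays for moving from \<open>e t\<close> to the
      bundle at a nearby time, the other for moving on to \<open>F\<close>; the bound by
      \<open>\<alpha>\<close> keeps the pairs in the domain of \<open>H\<close>.\<close>
    define r where "r = min (s / 2) (\<alpha> / 2)"
    have r: "r > 0" using s \<alpha>_pos by (simp add: r_def)
    obtain d1 where d1: "d1 > 0" "\<And>t'. t' \<in> {0..1} \<Longrightarrow> dist t' t < d1 \<Longrightarrow> bundle_dist p (e t) (e t') < ennreal r"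
      using bundle_continuousD(2)[OF e tu(2) r] by blast
    obtain d2 where d2: "d2 > 0" "\<And>y. y \<in> ?K \<Longrightarrow> dist y x < d2 \<Longrightarrow> h (fst y) (snd y) \<in> V3"
    proof -
      have hc: "continuous_map (top_of_set ?K) euclidean (\<lambda>y. h (fst y) (snd y))"
        using h by (simp add: transports_def case_prod_unfold)
      have "\<exists>d>0. \<forall>y\<in>?K. dist y x < d \<longrightarrow> h (fst y) (snd y) \<in> V3"
        by (rule continuous_map_dist_topologyD[OF hc x]) (use V(2,4) in \<open>simp_all add: tu(1)\<close>)
      then show thesis using that by metis
    qed
    have "near y r" if y: "y \<in> ?K" "dist y x < min d1 d2" for y
      unfolding near_def
    proof (intro ballI impI)
      fix F assume F: "F \<in> \<E>" "bundle_dist p (e (fst y)) F < ennreal r"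
      have y1: "fst y \<in> {0..1}" "snd y \<in> total B" using y(1) by auto
      have "dist (fst y) t < d1" using y(2) dist_fst_le[of y x] by (simp add: tu(1))
      then have dt: "bundle_dist p (e t) (e (fst y)) < ennreal r" by (rule d1(2)[OF y1(1)])
      have small: "bundle_dist p (e t) F' < r0" "bundle_dist p (e (fst y)) F' < ennreal \<alpha>"
        if F': "bundle_dist p (e (fst y)) F' < ennreal r" for F'
      proof -
        have "bundle_dist p (e t) F' \<le> ennreal (r + r)" by (rule bundle_dist_triangle_less[OF dt F'])
        also have "\<dots> \<le> ennreal s" by (rule ennreal_leI) (simp add: r_def)
        finally show "bundle_dist p (e t) F' < r0" using s(2) by (rule le_less_trans)
        have "ennreal r \<le> ennreal \<alpha>" by (rule ennreal_leI) (use \<alpha>_pos in \<open>simp add: r_def\<close>)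
        then show "bundle_dist p (e (fst y)) F' < ennreal \<alpha>" by (rule less_le_trans[OF F'])
      qed
      have self: "bundle_dist p (e (fst y)) (e (fst y)) < ennreal r" using r by (simp add: bundle_dist_self)
      have ey: "e (fst y) \<in> \<E>" by (rule bundle_continuousD(1)[OF e y1(1)])
      have hy: "h (fst y) (snd y) \<in> total (e (fst y))"
        by (rule bundle_homeos_mem[OF transports_homeo[OF h y1(1)] y1(2)])
      have inb: "H (e (fst y)) F' (h (fst y) (snd y)) \<in> ?b"
        if F': "F' \<in> \<E>" "bundle_dist p (e (fst y)) F' < ennreal r" for F'
      proof -
        have "e (fst y) \<in> V1" "F' \<in> V2" using r0(2)[OF ey small(1)[OF self]] r0(2)[OF F'(1) small(1)[OF F'(2)]] by auto
        then have "(e (fst y), F') \<in> V" using V12(5) by blast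
        moreover have "h (fst y) (snd y) \<in> V3" using d2(2)[OF y(1)] y(2) by simp
        ultimately have "((e (fst y), F'), h (fst y) (snd y)) \<in> W" using V(5) by blast
        moreover have "((e (fst y), F'), h (fst y) (snd y)) \<in> ?D" using small(2)[OF F'(2)] hy by simp
        ultimately have "((e (fst y), F'), h (fst y) (snd y)) \<in> W \<inter> ?D" by blast
        then show ?thesis unfolding W(2)[symmetric] by simp
      qed
      show "dist (H (e (fst y)) F (h (fst y) (snd y))) (H (e (fst y)) (e (fst y)) (h (fst y) (snd y))) < \<epsilon>"
        using inb[OF F] inb[OF ey self]
          dist_triangle_half_r[of "H (e t) (e t) (h t u)" "H (e (fst y)) F (h (fst y) (snd y))" \<epsilon>
            "H (e (fst y)) (e (fst y)) (h (fst y) (snd y))"] by simp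
    qed
    moreover have "min d1 d2 > 0" using d1(1) d2(1) by simp
    ultimately show ?thesis using r by blast
  qed
  then obtain d r where d: "\<And>x. x \<in> ?K \<Longrightarrow> d x > 0" and r: "\<And>x. x \<in> ?K \<Longrightarrow> r x > 0"
    and n: "\<And>x y. x \<in> ?K \<Longrightarrow> y \<in> ?K \<Longrightarrow> dist y x < d x \<Longrightarrow> near y (r x)" by metis
  have K: "compact ?K" by (intro compact_Times compact_Icc compact_total[OF B])
  obtain D where D: "D \<subseteq> ?K" "finite D" "?K \<subseteq> (\<Union>x\<in>D. ball x (d x))"
  proof (rule compactE_image[OF K, of ?K "\<lambda>x. ball x (d x)"])
    show "?K \<subseteq> (\<Union>x\<in>?K. ball x (d x))"
    proof
      fix x assume x: "x \<in> ?K"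
      then have "x \<in> ball x (d x)" using d by simp
      then show "x \<in> (\<Union>x\<in>?K. ball x (d x))" using x by (rule UN_I[rotated])
    qed
  qed auto
  define r' where "r' = Min (insert 1 (r ` D))"
  have r': "r' > 0" unfolding r'_def using D r by (subst Min_gr_iff) auto
  have "near y r'" if y: "y \<in> ?K" for y
  proof -
    obtain x where x: "x \<in> D" "y \<in> ball x (d x)" using D(3) y by blast
    have "near y (r x)" by (rule n) (use x y D(1) in \<open>auto simp: dist_commute\<close>)
    moreover have "ennreal r' \<le> ennreal (r x)" unfolding r'_def by (rule ennreal_leI) (use D(2) x(1) in simp)
    ultimately show ?thesis unfolding near_def by (meson less_le_trans)
  qed
  then show ?thesis using r' unfolding near_def by (intro exI[of _ r']) auto
qed

text \<open>
  Comparing with \<open>H (E t) (E t) \<circ> h t\<close> rather than with \<open>h t\<close> avoids any assumption on \<open>H E E\<close>.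
\<close>

lemma pull_back_close:
  assumes \<phi>: "\<phi> \<in> Sk_paths p T \<E>" and \<epsilon>: "\<epsilon> > 0"
    and h: "transports p {0..1} (\<lambda>t. fst (\<phi> t)) B h" and B: "oriented_circle_subbundle p B"
  shows "\<exists>r>0. \<forall>\<psi>\<in>Sk_paths p T \<E>. (\<forall>t\<in>{0..1}. Sk_dist p (\<phi> t) (\<psi> t) < ennreal r) \<longrightarrow>
    (\<exists>h0 k. transports p {0..1} (\<lambda>t. fst (\<phi> t)) B h0 \<and> transports p {0..1} (\<lambda>t. fst (\<psi> t)) B k \<and>
      h0 = (\<lambda>t. H (fst (\<phi> t)) (fst (\<phi> t)) \<circ> h t) \<and>
      (\<forall>t\<in>{0..1}. \<forall>u\<in>total B. dist (pull_back \<phi> B h0 t u) (pull_back \<psi> B k t u) < \<epsilon>))"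
proof -
  let ?e = "\<lambda>t. fst (\<phi> t)"
  note \<phi>c = Sk_pathsD(2)[OF \<phi>]
  have e: "continuous_map (top_of_set {0..1}) (bundle_topology p \<E>) ?e"
    using continuous_map_compose[OF \<phi>c continuous_map_Sk_fst] by (simp add: comp_def)
  define h0 where "h0 = (\<lambda>t. H (?e t) (?e t) \<circ> h t)"
  have h0: "transports p {0..1} ?e B h0"
    unfolding h0_def by (rule transports_step[OF e e _ h]) (simp add: bundle_dist_self \<alpha>_pos)
  let ?Y = "{(t, v). t \<in> {0..1} \<and> v \<in> total (?e t)}"
  have Y: "compact ?Y" by (rule transports_graph_compact[OF h0 _ compact_total[OF B]]) simp
  obtain d1 where d1: "d1 > 0" "\<And>y y'. y \<in> ?Y \<Longrightarrow> y' \<in> ?Y \<Longrightarrow> dist y' y < d1 \<Longrightarrow>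
      dist ((\<lambda>(t, v). inv_into (total B) (h0 t) v) y') ((\<lambda>(t, v). inv_into (total B) (h0 t) v) y) < \<epsilon>"
    using compact_uniformly_continuous[OF transports_inverse_continuous[OF h0 compact_Icc compact_total[OF B]] Y,
        unfolded uniformly_continuous_on_def, THEN spec, THEN mp, OF \<epsilon>] by blast
  obtain d2 where d2: "d2 > 0" "\<And>y y'. y \<in> ?Y \<Longrightarrow> y' \<in> ?Y \<Longrightarrow> dist y' y < d2 \<Longrightarrow>
      dist ((\<lambda>(t, v). snd (\<phi> t) v) y') ((\<lambda>(t, v). snd (\<phi> t) v) y) < d1 / 4"
    using compact_uniformly_continuous[OF Sk_evaluation_continuous[OF \<phi>c] Y,
        unfolded uniformly_continuous_on_def, THEN spec, THEN mp, of "d1 / 4"] d1(1) by auto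
  \<comment> \<open>\<open>d1\<close> is a modulus for the inverses of \<open>h0\<close>,
    \<open>d2\<close> one for the maps of \<open>\<phi>\<close> with target accuracy
    \<open>d1 / 4\<close>. Half of \<open>d2\<close> is left for the homeomorphism \<open>j\<close>
    below, and three quarters of \<open>d1\<close> for the distance of the image points.\<close>
  define \<eta> where "\<eta> = min (d1 / 4) (d2 / 2)"
  have \<eta>: "\<eta> > 0" using d1 d2 by (simp add: \<eta>_def)
  obtain r1 where r1: "r1 > 0" "\<And>t F u. t \<in> {0..1} \<Longrightarrow> F \<in> \<E> \<Longrightarrow> u \<in> total B \<Longrightarrow> bundle_dist p (?e t) F < ennreal r1 \<Longrightarrow>
      dist (H (?e t) F (h t u)) (H (?e t) (?e t) (h t u)) < \<eta>"
    using transports_close[OF e h B \<eta>] by blast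
  define r where "r = min (min r1 \<alpha>) (min (d1 / 8) (d2 / 2))"
  have r: "r > 0" using r1 d1 d2 \<alpha>_pos by (simp add: r_def)
  have "\<exists>k. transports p {0..1} (\<lambda>t. fst (\<psi> t)) B k \<and>
      (\<forall>t\<in>{0..1}. \<forall>u\<in>total B. dist (pull_back \<phi> B h0 t u) (pull_back \<psi> B k t u) < \<epsilon>)"
    if \<psi>: "\<psi> \<in> Sk_paths p T \<E>" and cl: "\<forall>t\<in>{0..1}. Sk_dist p (\<phi> t) (\<psi> t) < ennreal r" for \<psi>
  proof -
    let ?e' = "\<lambda>t. fst (\<psi> t)"
    have e': "continuous_map (top_of_set {0..1}) (bundle_topology p \<E>) ?e'"
      using continuous_map_compose[OF Sk_pathsD(2)[OF \<psi>] continuous_map_Sk_fst] by (simp add: comp_def)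
    have bd: "bundle_dist p (?e t) (?e' t) < ennreal s" if "t \<in> {0..1}" "r \<le> s" for t s
    proof -
      have "bundle_dist p (?e t) (?e' t) \<le> Sk_dist p (\<phi> t) (\<psi> t)" by (rule bundle_dist_le_Sk_dist)
      also have "\<dots> < ennreal r" using cl that by blast
      also have "\<dots> \<le> ennreal s" using that(2) by (rule ennreal_leI)
      finally show ?thesis .
    qed
    define k where "k = (\<lambda>t. H (?e t) (?e' t) \<circ> h t)"
    have k: "transports p {0..1} ?e' B k"
      unfolding k_def by (rule transports_step[OF e e' _ h]) (rule bd, auto simp: r_def)
    have kh: "dist (k t u) (h0 t u) < \<eta>" if "t \<in> {0..1}" "u \<in> total B" for t u
    proof -
      have "?e' t \<in> \<E>" by (rule bundle_continuousD(1)[OF e' that(1)])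
      from r1(2)[OF that(1) this that(2) bd[OF that(1)]] show ?thesis by (simp add: k_def h0_def r_def)
    qed
    \<comment> \<open>\<open>j\<close> brings \<open>k t u\<close> back to a point \<open>v\<close>
      of the bundle of \<open>\<phi>\<close> near \<open>h0 t u\<close>, so the images
      \<open>w\<close> and \<open>w'\<close> under the two maps are close. For \<open>a\<close> with
      \<open>k t a = w'\<close>, the point \<open>h0 t a\<close> is near \<open>w\<close>, and
      applying the inverse of \<open>h0 t\<close> compares the pull-backs.\<close>
    have "dist (pull_back \<phi> B h0 t u) (pull_back \<psi> B k t u) < \<epsilon>" if t: "t \<in> {0..1}" and u: "u \<in> total B" for t u
    proof -
      note S = Sk_pathsD(1)[OF \<phi> t] and S' = Sk_pathsD(1)[OF \<psi> t]
      let ?E = "total (?e t)"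
      obtain j where j: "j \<in> bundle_homeos p (?e t) (?e' t)" "\<And>v. v \<in> ?E \<Longrightarrow> dist v (j v) < r"
        "\<And>v. v \<in> ?E \<Longrightarrow> dist (snd (\<phi> t) v) (inv_into ?E j (snd (\<psi> t) (j v))) < r"
        using Sk_dist_lessD[OF cl[rule_format, OF t]] by blast
      note ht = transports_homeo[OF h0 t] and kt = transports_homeo[OF k t]
      have ku: "k t u \<in> total (?e' t)" by (rule bundle_homeos_mem[OF kt u])
      have hu: "h0 t u \<in> ?E" by (rule bundle_homeos_mem[OF ht u])
      define v where "v = inv_into ?E j (k t u)"
      have v: "v \<in> ?E" "j v = k t u"
        unfolding v_def by (rule bundle_homeos_inv_mem[OF j(1) ku], rule bundle_homeos_inv_right[OF j(1) ku])
      define w' where "w' = snd (\<psi> t) (k t u)"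
      have w'F: "w' \<in> total (?e' t)" unfolding w'_def by (rule SkD(2)[OF S' ku])
      define w where "w = snd (\<phi> t) (h0 t u)"
      have wE: "w \<in> ?E" unfolding w_def by (rule SkD(2)[OF S hu])
      define y where "y = inv_into ?E j w'"
      have y: "y \<in> ?E" "j y = w'"
        unfolding y_def by (rule bundle_homeos_inv_mem[OF j(1) w'F], rule bundle_homeos_inv_right[OF j(1) w'F])
      have "dist v (h0 t u) < d2"
        using j(2)[OF v(1)] kh[OF t u] dist_triangle[of v "h0 t u" "k t u"] unfolding v(2) r_def \<eta>_def by linarith
      then have "dist (snd (\<phi> t) v) w < d1 / 4"
        using d2(2)[of "(t, h0 t u)" "(t, v)"] t hu v(1) by (simp add: dist_Pair_Pair w_def)
      moreover have "dist (snd (\<phi> t) v) y < r" using j(3)[OF v(1)] unfolding v(2) y_def w'_def .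
      moreover have "dist y w' < r" using j(2)[OF y(1)] unfolding y(2) .
      moreover have "r \<le> d1 / 8" by (simp add: r_def)
      ultimately have ww': "dist w' w < 3 * d1 / 4"
        using dist_triangle[of w' w y] dist_triangle[of y w "snd (\<phi> t) v"]
          dist_commute[of w' y] dist_commute[of y "snd (\<phi> t) v"] d1(1) by linarith
      define a where "a = inv_into (total B) (k t) w'"
      have a: "a \<in> total B" "k t a = w'"
        unfolding a_def by (rule bundle_homeos_inv_mem[OF kt w'F], rule bundle_homeos_inv_right[OF kt w'F])
      have "dist (h0 t a) w < d1"
        using kh[OF t a(1)] ww' dist_triangle[of "h0 t a" w w'] dist_commute[of "h0 t a" w']
        unfolding a(2) \<eta>_def by linarith
      then have "dist (inv_into (total B) (h0 t) (h0 t a)) (inv_into (total B) (h0 t) w) < \<epsilon>"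
        using d1(2)[of "(t, w)" "(t, h0 t a)"] t wE bundle_homeos_mem[OF ht a(1)] by (simp add: dist_Pair_Pair)
      then have "dist a (inv_into (total B) (h0 t) w) < \<epsilon>" by (simp only: bundle_homeos_inv_left[OF ht a(1)])
      then show ?thesis unfolding pull_back_def a_def w_def w'_def by (simp add: dist_commute)
    qed
    then show ?thesis using k by blast
  qed
  then show ?thesis using r h0 unfolding h0_def by blast
qed

text \<open>Both paths are pulled back to the initial bundle of \<open>\<phi>\<close>, where
  \<open>rotates_close\<close> compares families on one fixed bundle.\<close>

lemma has_rotation_number_close:
  assumes l: "unit_length_structure \<E> l" and \<phi>: "\<phi> \<in> Sk_paths p T \<E>" and \<epsilon>: "\<epsilon> > 0"
  shows "\<exists>r>0. \<forall>\<psi>\<in>Sk_paths p T \<E>. (\<forall>t\<in>{0..1}. Sk_dist p (\<phi> t) (\<psi> t) < ennreal r) \<longrightarrow>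
    (\<forall>x \<rho> \<rho>'. has_rotation_number p T l \<phi> x \<rho> \<longrightarrow> has_rotation_number p T l \<psi> x \<rho>' \<longrightarrow> \<bar>\<rho> - \<rho>'\<bar> \<le> \<epsilon>)"
proof -
  let ?B = "fst (\<phi> 0)" and ?e = "\<lambda>t. fst (\<phi> t)"
  note \<phi>c = Sk_pathsD(2)[OF \<phi>]
  have B: "oriented_circle_subbundle p ?B" by (rule bundles[OF SkD(1)[OF Sk_pathsD(1)[OF \<phi>]]]) simp
  have e: "continuous_map (top_of_set {0..1}) (bundle_topology p \<E>) ?e"
    using continuous_map_compose[OF \<phi>c continuous_map_Sk_fst] by (simp add: comp_def)
  obtain h where h: "transports p {0..1} ?e ?B h" using transports_interval[OF e] by blast
  define h0 where "h0 = (\<lambda>t. H (?e t) (?e t) \<circ> h t)"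
  have h0: "transports p {0..1} ?e ?B h0"
    unfolding h0_def by (rule transports_step[OF e e _ h]) (simp add: bundle_dist_self \<alpha>_pos)
  note f = pull_back_fibre_family[OF \<phi>c h0 B]
  obtain \<eta> where \<eta>: "\<eta> > 0" "\<forall>f'. fibre_family p ?B ?B T f' \<longrightarrow>
    (\<forall>t\<in>{0..1}. \<forall>u\<in>total ?B. dist (pull_back \<phi> ?B h0 t u) (f' t u) < \<eta>) \<longrightarrow>
    (\<forall>x r r'. rotates p T ?B (pull_back \<phi> ?B h0) x r \<longrightarrow> rotates p T ?B f' x r' \<longrightarrow> \<bar>r - r'\<bar> \<le> \<epsilon>)"
    using rotates_close[OF B f \<epsilon>] by blast
  obtain r where r: "r > 0" "\<forall>\<psi>\<in>Sk_paths p T \<E>. (\<forall>t\<in>{0..1}. Sk_dist p (\<phi> t) (\<psi> t) < ennreal r) \<longrightarrow>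
    (\<exists>h1 k. transports p {0..1} ?e ?B h1 \<and> transports p {0..1} (\<lambda>t. fst (\<psi> t)) ?B k \<and>
      h1 = (\<lambda>t. H (?e t) (?e t) \<circ> h t) \<and>
      (\<forall>t\<in>{0..1}. \<forall>u\<in>total ?B. dist (pull_back \<phi> ?B h1 t u) (pull_back \<psi> ?B k t u) < \<eta>))"
    using pull_back_close[OF \<phi> \<eta>(1) h B] by blast
  have "\<bar>\<rho> - \<rho>'\<bar> \<le> \<epsilon>"
    if \<psi>: "\<psi> \<in> Sk_paths p T \<E>" and cl: "\<forall>t\<in>{0..1}. Sk_dist p (\<phi> t) (\<psi> t) < ennreal r"
      and \<rho>: "has_rotation_number p T l \<phi> x \<rho>" "has_rotation_number p T l \<psi> x \<rho>'" for \<psi> x \<rho> \<rho>'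
  proof -
    obtain k where k: "transports p {0..1} (\<lambda>t. fst (\<psi> t)) ?B k"
      "\<forall>t\<in>{0..1}. \<forall>u\<in>total ?B. dist (pull_back \<phi> ?B h0 t u) (pull_back \<psi> ?B k t u) < \<eta>"
      using r(2)[rule_format, OF \<psi> cl[rule_format]] unfolding h0_def by blast
    note \<psi>c = Sk_pathsD(2)[OF \<psi>]
    have 1: "rotates p T ?B (pull_back \<phi> ?B h0) x \<rho>" using \<rho>(1) has_rotation_number_iff[OF \<phi>c h0 B l] by simp
    have 2: "rotates p T ?B (pull_back \<psi> ?B k) x \<rho>'" using \<rho>(2) has_rotation_number_iff[OF \<psi>c k(1) B l] by simp
    show ?thesis
      using \<eta>(2)[THEN spec, THEN mp, OF pull_back_fibre_family[OF \<psi>c k(1) B], THEN mp, OF k(2)] 1 2 by blast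
  qed
  then show ?thesis using r(1) by blast
qed

lemma has_rotation_number_birkhoff:
  assumes l: "unit_length_structure \<E> l" and \<phi>: "\<phi> \<in> Sk_paths p T \<E>"
  shows "\<exists>b. continuous_on UNIV b \<and>
    (\<forall>x r. has_rotation_number p T l \<phi> x r \<longleftrightarrow> (\<lambda>n. birkhoff_sum T b n x / real n) \<longlonglongrightarrow> r)"
proof -
  note \<phi>c = Sk_pathsD(2)[OF \<phi>]
  have B: "oriented_circle_subbundle p (fst (\<phi> 0))" by (rule bundles[OF SkD(1)[OF Sk_pathsD(1)[OF \<phi>]]]) simp
  have e: "continuous_map (top_of_set {0..1}) (bundle_topology p \<E>) (\<lambda>t. fst (\<phi> t))"
    using continuous_map_compose[OF \<phi>c continuous_map_Sk_fst] by (simp add: comp_def)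
  obtain h where h: "transports p {0..1} (\<lambda>t. fst (\<phi> t)) (fst (\<phi> 0)) h" using transports_interval[OF e] by blast
  show ?thesis
    unfolding has_rotation_number_iff[OF \<phi>c h B l] by (rule rotates_birkhoff[OF B pull_back_fibre_family[OF \<phi>c h B]])
qed

end

section \<open>Mean rotation numbers\<close>

lemma weak_star_openin:
  fixes T :: "'x::topological_space \<Rightarrow> 'x"
  assumes "continuous_on UNIV g" "open V"
  shows "openin (weak_star_topology T) {\<nu> \<in> invariant_measures T. signed_integral \<nu> g \<in> V}"
  unfolding weak_star_topology_def by (rule topology_generated_by_Basis) (use assms in blast)

lemma topspace_weak_star: "topspace (weak_star_topology T) = invariant_measures T"
proof
  show "topspace (weak_star_topology T) \<subseteq> invariant_measures T"
    unfolding weak_star_topology_def topology_generated_by_topspace by blast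
  have "openin (weak_star_topology T) {\<nu> \<in> invariant_measures T. signed_integral \<nu> (\<lambda>_. 0) \<in> UNIV}"
    by (rule weak_star_openin) auto
  from openin_subset[OF this] show "invariant_measures T \<subseteq> topspace (weak_star_topology T)" by auto
qed

lemma topspace_Sk_paths_topology: "topspace (Sk_paths_topology p T \<E>) = Sk_paths p T \<E>"
  by (simp add: Sk_paths_topology_def)

lemma continuous_map_realI:
  assumes "\<And>x e. x \<in> topspace X \<Longrightarrow> e > 0 \<Longrightarrow> \<exists>U. openin X U \<and> x \<in> U \<and> (\<forall>y\<in>U. \<bar>f y - f x\<bar> < e)"
  shows "continuous_map X euclideanreal f"
  unfolding continuous_map_def
proof (intro conjI allI impI)
  fix V :: "real set" assume "openin euclideanreal V"
  then have V: "open V" by simp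
  show "openin X {x \<in> topspace X. f x \<in> V}"
  proof (subst openin_subopen, intro ballI)
    fix x assume "x \<in> {x \<in> topspace X. f x \<in> V}"
    then have x: "x \<in> topspace X" "f x \<in> V" by auto
    obtain e where e: "e > 0" "\<And>y. dist y (f x) < e \<Longrightarrow> y \<in> V" using V x(2) unfolding open_dist by blast
    obtain U where U: "openin X U" "x \<in> U" "\<forall>y\<in>U. \<bar>f y - f x\<bar> < e" using assms[OF x(1) e(1)] by blast
    have "U \<subseteq> {x \<in> topspace X. f x \<in> V}"
      using U(3) e(2) openin_subset[OF U(1)] by (auto simp: dist_real_def)
    then show "\<exists>U. openin X U \<and> x \<in> U \<and> U \<subseteq> {x \<in> topspace X. f x \<in> V}" using U(1,2) by blast
  qed
qed auto

section \<open>Integration of the rotation number\<close>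

context circle_bundle_space
begin

lemma T_borel: "T \<in> borel_measurable borel"
  by (rule borel_measurable_continuous_onI[OF T_continuous])

lemma invariant_signed: "\<mu> \<in> invariant_measures T \<Longrightarrow> \<mu> \<in> signed_measures"
  by (simp add: invariant_measures_def)

lemma continuous_borel_bounded:
  fixes b :: "'x \<Rightarrow> real"
  assumes "continuous_on UNIV b"
  shows "b \<in> borel_measurable borel" "\<exists>C\<ge>0. \<forall>x. \<bar>b x\<bar> \<le> C"
  by (rule borel_measurable_continuous_onI[OF assms], rule compact_UNIV_bounded[OF compact_base assms])

lemma rotation_birkhoff:
  assumes b: "\<And>x r. has_rotation_number p T l \<phi> x r \<longleftrightarrow> (\<lambda>n. birkhoff_sum T b n x / real n) \<longlonglongrightarrow> r"
  shows "x \<in> rotation_domain p T l \<phi> \<longleftrightarrow> birkhoff_converges T b x"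
    and "rotation_number p T l \<phi> = birkhoff_limit T b"
proof -
  show d: "x \<in> rotation_domain p T l \<phi> \<longleftrightarrow> birkhoff_converges T b x" for x
    by (simp add: rotation_domain_def b birkhoff_converges_def convergent_def)
  show "rotation_number p T l \<phi> = birkhoff_limit T b"
  proof
    fix x
    have "has_rotation_number p T l \<phi> x = (\<lambda>r. (\<lambda>n. birkhoff_sum T b n x / real n) \<longlonglongrightarrow> r)"
      by (rule ext) (rule b)
    then show "rotation_number p T l \<phi> x = birkhoff_limit T b x"
      by (simp add: rotation_number_def birkhoff_limit_def d lim_def)
  qed
qed

text \<open>The function \<open>b\<close> does not depend on \<open>\<mu>\<close>: a limit function
  that is merely measurable is replaced by a continuous test function for all invariant measures
  simultaneously. The ergodic theorem is applied to each Jordan part.\<close>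

lemma mean_rotation_number_birkhoff:
  assumes b: "continuous_on UNIV b"
    "\<And>x r. has_rotation_number p T l \<phi> x r \<longleftrightarrow> (\<lambda>n. birkhoff_sum T b n x / real n) \<longlonglongrightarrow> r"
    and \<mu>: "\<mu> \<in> invariant_measures T"
  shows "mean_rotation_number p T l \<mu> \<phi> = signed_integral \<mu> b"
proof -
  interpret P: invariant_finite_measure T "pos_part \<mu>" by (rule pos_part_invariant[OF T_borel \<mu>])
  interpret N: invariant_finite_measure T "neg_part \<mu>" by (rule neg_part_invariant[OF T_borel \<mu>])
  obtain C where C: "\<And>x. \<bar>b x\<bar> \<le> C" using continuous_borel_bounded(2)[OF b(1)] by blast
  show ?thesis
    unfolding mean_rotation_number_def rotation_birkhoff(2)[OF b(2)] signed_integral_def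
    using P.integral_birkhoff_limit[OF continuous_borel_bounded(1)[OF b(1)] C]
      N.integral_birkhoff_limit[OF continuous_borel_bounded(1)[OF b(1)] C] by simp
qed

context
  fixes l :: "('x, 'g) oriented_bundle \<Rightarrow> 'x \<Rightarrow> complex \<Rightarrow> 'g"
  assumes l: "unit_length_structure \<E> l"
begin

lemma rotation_number_AE:
  assumes \<phi>: "\<phi> \<in> Sk_paths p T \<E>" and \<mu>: "\<mu> \<in> invariant_measures T"
  shows "AE x in pos_part \<mu>. has_rotation_number p T l \<phi> x (rotation_number p T l \<phi> x)"
    "AE x in neg_part \<mu>. has_rotation_number p T l \<phi> x (rotation_number p T l \<phi> x)"
    "AE x in variation \<mu>. x \<in> rotation_domain p T l \<phi>"
proof -
  interpret P: invariant_finite_measure T "pos_part \<mu>" by (rule pos_part_invariant[OF T_borel \<mu>])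
  interpret N: invariant_finite_measure T "neg_part \<mu>" by (rule neg_part_invariant[OF T_borel \<mu>])
  obtain b where b: "continuous_on UNIV b"
    "\<And>x r. has_rotation_number p T l \<phi> x r \<longleftrightarrow> (\<lambda>n. birkhoff_sum T b n x / real n) \<longlonglongrightarrow> r"
    using has_rotation_number_birkhoff[OF l \<phi>] by blast
  obtain C where C: "\<And>x. \<bar>b x\<bar> \<le> C" using continuous_borel_bounded(2)[OF b(1)] by blast
  note R = rotation_birkhoff[OF b(2)] and m = continuous_borel_bounded(1)[OF b(1)]
  have lim: "has_rotation_number p T l \<phi> x (rotation_number p T l \<phi> x)" if "birkhoff_converges T b x" for x
    using that unfolding R(2) b(2) by (simp add: birkhoff_limit_def birkhoff_converges_def convergent_LIMSEQ_iff)
  show "AE x in pos_part \<mu>. has_rotation_number p T l \<phi> x (rotation_number p T l \<phi> x)"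
    using P.birkhoff_converges_AE[OF m C] by eventually_elim (rule lim)
  show "AE x in neg_part \<mu>. has_rotation_number p T l \<phi> x (rotation_number p T l \<phi> x)"
    using N.birkhoff_converges_AE[OF m C] by eventually_elim (rule lim)
  show "AE x in variation \<mu>. x \<in> rotation_domain p T l \<phi>"
    unfolding R(1)
    by (rule AE_variation[OF P.birkhoff_converges_AE[OF m C] N.birkhoff_converges_AE[OF m C] P.birkhoff_converges_sets[OF m]])
qed

lemma rotation_number_regular:
  assumes \<phi>: "\<phi> \<in> Sk_paths p T \<E>"
  shows "\<exists>B. \<forall>x. \<bar>rotation_number p T l \<phi> x\<bar> \<le> B"
    "T x \<in> rotation_domain p T l \<phi> \<longleftrightarrow> x \<in> rotation_domain p T l \<phi>"
    "rotation_number p T l \<phi> (T x) = rotation_number p T l \<phi> x"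
    "rotation_domain p T l \<phi> \<in> sets borel" "rotation_number p T l \<phi> \<in> borel_measurable borel"
proof -
  interpret borel_dynamics T by unfold_locales (rule T_borel)
  obtain b where b: "continuous_on UNIV b"
    "\<And>x r. has_rotation_number p T l \<phi> x r \<longleftrightarrow> (\<lambda>n. birkhoff_sum T b n x / real n) \<longlonglongrightarrow> r"
    using has_rotation_number_birkhoff[OF l \<phi>] by blast
  obtain C where C: "C \<ge> 0" "\<And>x. \<bar>b x\<bar> \<le> C" using continuous_borel_bounded(2)[OF b(1)] by blast
  note R = rotation_birkhoff[OF b(2)] and m = continuous_borel_bounded(1)[OF b(1)]
  have dom: "rotation_domain p T l \<phi> = {x. birkhoff_converges T b x}" using R(1) by auto
  show "\<exists>B. \<forall>x. \<bar>rotation_number p T l \<phi> x\<bar> \<le> B"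
    unfolding R(2) using birkhoff_limit_bound[of b C T] C by blast
  show "T x \<in> rotation_domain p T l \<phi> \<longleftrightarrow> x \<in> rotation_domain p T l \<phi>"
    unfolding R(1) by (rule birkhoff_limit_invariant(1)[OF C(2)])
  show "rotation_number p T l \<phi> (T x) = rotation_number p T l \<phi> x"
    unfolding R(2) by (rule birkhoff_limit_invariant(2)[OF C(2)])
  show "rotation_domain p T l \<phi> \<in> sets borel" unfolding dom by (rule birkhoff_converges_sets[OF m])
  show "rotation_number p T l \<phi> \<in> borel_measurable borel" unfolding R(2) by (rule birkhoff_limit_measurable[OF m])
qed

text \<open>The pointwise bound holds wherever both rotation numbers exist, hence almost everywhere
  for every invariant \<open>\<mu>\<close>. So \<open>U\<close> is independent of
  \<open>\<mu>\<close>, and only the total variation enters the estimate.\<close>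

lemma mean_rotation_number_close:
  assumes \<phi>: "\<phi> \<in> Sk_paths p T \<E>" and \<epsilon>: "\<epsilon> > 0"
  shows "\<exists>U. openin (Sk_paths_topology p T \<E>) U \<and> \<phi> \<in> U \<and> (\<forall>\<psi>\<in>U. \<forall>\<mu>\<in>invariant_measures T.
    \<bar>mean_rotation_number p T l \<mu> \<psi> - mean_rotation_number p T l \<mu> \<phi>\<bar> \<le> \<epsilon> * measure (variation \<mu>) UNIV)"
proof -
  obtain r where r: "r > 0" "\<And>\<psi> x \<rho> \<rho>'. \<psi> \<in> Sk_paths p T \<E> \<Longrightarrow> (\<forall>t\<in>{0..1}. Sk_dist p (\<phi> t) (\<psi> t) < ennreal r) \<Longrightarrow>
      has_rotation_number p T l \<phi> x \<rho> \<Longrightarrow> has_rotation_number p T l \<psi> x \<rho>' \<Longrightarrow> \<bar>\<rho> - \<rho>'\<bar> \<le> \<epsilon>"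
    using has_rotation_number_close[OF l \<phi> \<epsilon>] by blast
  obtain U where U: "openin (Sk_paths_topology p T \<E>) U" "\<phi> \<in> U"
    "\<And>\<psi>. \<psi> \<in> U \<Longrightarrow> \<forall>t\<in>{0..1}. Sk_dist p (\<phi> t) (\<psi> t) < ennreal r"
    using Sk_paths_topology_neighbourhood[OF \<phi>, of "ennreal r"] r(1) unfolding ennreal_less_zero_iff[symmetric] by blast
  have "\<bar>mean_rotation_number p T l \<mu> \<psi> - mean_rotation_number p T l \<mu> \<phi>\<bar> \<le> \<epsilon> * measure (variation \<mu>) UNIV"
    if \<psi>U: "\<psi> \<in> U" and \<mu>: "\<mu> \<in> invariant_measures T" for \<psi> \<mu>
  proof -
    have \<psi>: "\<psi> \<in> Sk_paths p T \<E>" using openin_subset[OF U(1)] \<psi>U topspace_Sk_paths_topology by blast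
    let ?f = "rotation_number p T l \<psi>" and ?g = "rotation_number p T l \<phi>"
    obtain A where A: "\<And>x. \<bar>?f x\<bar> \<le> A" using rotation_number_regular(1)[OF \<psi>] by blast
    obtain A' where A': "\<And>x. \<bar>?g x\<bar> \<le> A'" using rotation_number_regular(1)[OF \<phi>] by blast
    note m = rotation_number_regular(5)[OF \<psi>] rotation_number_regular(5)[OF \<phi>]
    have "mean_rotation_number p T l \<mu> \<psi> - mean_rotation_number p T l \<mu> \<phi> = signed_integral \<mu> (\<lambda>x. ?f x - ?g x)"
      unfolding mean_rotation_number_def
      by (rule signed_integral_diff[OF invariant_signed[OF \<mu>] m(1) A m(2) A', symmetric])
    also have "\<bar>\<dots>\<bar> \<le> \<epsilon> * measure (variation \<mu>) UNIV"
    proof (rule signed_integral_bound[OF invariant_signed[OF \<mu>]])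
      show "(\<lambda>x. ?f x - ?g x) \<in> borel_measurable borel" by (intro borel_measurable_diff m)
      show "AE x in pos_part \<mu>. \<bar>?f x - ?g x\<bar> \<le> \<epsilon>"
        using rotation_number_AE(1)[OF \<phi> \<mu>] rotation_number_AE(1)[OF \<psi> \<mu>]
        by eventually_elim (use r(2)[OF \<psi> U(3)[OF \<psi>U]] in \<open>simp add: abs_minus_commute\<close>)
      show "AE x in neg_part \<mu>. \<bar>?f x - ?g x\<bar> \<le> \<epsilon>"
        using rotation_number_AE(2)[OF \<phi> \<mu>] rotation_number_AE(2)[OF \<psi> \<mu>]
        by eventually_elim (use r(2)[OF \<psi> U(3)[OF \<psi>U]] in \<open>simp add: abs_minus_commute\<close>)
    qed
    finally show ?thesis .
  qed
  then show ?thesis using U(1,2) by blast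
qed

lemma mean_rotation_number_integral:
  assumes "\<phi> \<in> Sk_paths p T \<E>"
  shows "\<exists>b. continuous_on UNIV b \<and>
    (\<forall>\<mu>\<in>invariant_measures T. mean_rotation_number p T l \<mu> \<phi> = signed_integral \<mu> b)"
proof -
  obtain b where b: "continuous_on UNIV b"
    "\<And>x r. has_rotation_number p T l \<phi> x r \<longleftrightarrow> (\<lambda>n. birkhoff_sum T b n x / real n) \<longlonglongrightarrow> r"
    using has_rotation_number_birkhoff[OF l assms] by blast
  show ?thesis using b(1) mean_rotation_number_birkhoff[OF b] by blast
qed

lemma mean_rotation_number_continuous_measure:
  assumes \<phi>: "\<phi> \<in> Sk_paths p T \<E>"
  shows "continuous_map (weak_star_topology T) euclideanreal (\<lambda>\<mu>. mean_rotation_number p T l \<mu> \<phi>)"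
proof -
  obtain b where b: "continuous_on UNIV b"
    "\<And>\<mu>. \<mu> \<in> invariant_measures T \<Longrightarrow> mean_rotation_number p T l \<mu> \<phi> = signed_integral \<mu> b"
    using mean_rotation_number_integral[OF \<phi>] by blast
  have "continuous_map (weak_star_topology T) euclideanreal (\<lambda>\<mu>. signed_integral \<mu> b)"
    unfolding continuous_map_def topspace_weak_star using weak_star_openin[OF b(1)] by auto
  then show ?thesis by (rule continuous_map_eq) (simp add: topspace_weak_star b(2))
qed

lemma mean_rotation_number_continuous_path:
  assumes \<mu>: "\<mu> \<in> invariant_measures T"
  shows "continuous_map (Sk_paths_topology p T \<E>) euclideanreal (\<lambda>\<phi>. mean_rotation_number p T l \<mu> \<phi>)"
proof (rule continuous_map_realI)
  fix \<phi> and e :: real assume "\<phi> \<in> topspace (Sk_paths_topology p T \<E>)" and e: "e > 0"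
  then have \<phi>: "\<phi> \<in> Sk_paths p T \<E>" by (simp add: topspace_Sk_paths_topology)
  let ?V = "measure (variation \<mu>) UNIV"
  \<comment> \<open>Adding 1 avoids a division by zero when \<open>\<mu>\<close> vanishes.\<close>
  have pos: "?V + 1 > 0" using measure_nonneg[of "variation \<mu>" UNIV] by linarith
  then have e': "e / (?V + 1) > 0" using e by simp
  have lt: "e / (?V + 1) * ?V < e" using e pos by (simp add: field_simps)
  show "\<exists>U. openin (Sk_paths_topology p T \<E>) U \<and> \<phi> \<in> U \<and>
      (\<forall>\<psi>\<in>U. \<bar>mean_rotation_number p T l \<mu> \<psi> - mean_rotation_number p T l \<mu> \<phi>\<bar> < e)"
    using mean_rotation_number_close[OF \<phi> e'] \<mu> lt by (meson le_less_trans)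
qed

text \<open>The change from \<open>(\<mu>, \<phi>)\<close> to \<open>(\<nu>, \<psi>)\<close> passes
  through \<open>(\<nu>, \<phi>)\<close>: the change of path costs at most a multiple of the
  variation, bounded by \<open>R\<close>, and the change of measure is tested by one continuous
  function belonging to \<open>\<phi>\<close>.\<close>

lemma mean_rotation_number_continuous_bounded:
  "continuous_map
    (subtopology (prod_topology (weak_star_topology T) (Sk_paths_topology p T \<E>))
      {(\<mu>, \<phi>). emeasure (variation \<mu>) UNIV \<le> ennreal R})
    euclideanreal (\<lambda>(\<mu>, \<phi>). mean_rotation_number p T l \<mu> \<phi>)"
proof (rule continuous_map_realI)
  let ?S = "{(\<mu>, \<phi>). emeasure (variation \<mu>) UNIV \<le> ennreal R}"
  let ?X = "prod_topology (weak_star_topology T) (Sk_paths_topology p T \<E>)"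
  let ?m = "\<lambda>(\<mu>, \<phi>). mean_rotation_number p T l \<mu> \<phi>"
  fix x and e :: real assume x: "x \<in> topspace (subtopology ?X ?S)" and e: "e > 0"
  obtain \<mu> \<phi> where x': "x = (\<mu>, \<phi>)" by (cases x)
  have \<mu>: "\<mu> \<in> invariant_measures T" and \<phi>: "\<phi> \<in> Sk_paths p T \<E>" and xS: "x \<in> ?S"
    using x by (auto simp: x' topspace_weak_star topspace_Sk_paths_topology)
  obtain b where b: "continuous_on UNIV b"
    "\<And>\<mu>. \<mu> \<in> invariant_measures T \<Longrightarrow> mean_rotation_number p T l \<mu> \<phi> = signed_integral \<mu> b"
    using mean_rotation_number_integral[OF \<phi>] by blast
  define U1 where "U1 = {\<nu> \<in> invariant_measures T. signed_integral \<nu> b \<in> ball (signed_integral \<mu> b) (e / 2)}"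
  have U1: "openin (weak_star_topology T) U1" "\<mu> \<in> U1"
    unfolding U1_def by (rule weak_star_openin[OF b(1) open_ball]) (use \<mu> e in simp)
  define d where "d = e / (2 * (\<bar>R\<bar> + 1))"
  have d: "d > 0" using e by (simp add: d_def)
  have dR: "d * \<bar>R\<bar> < e / 2" using e by (simp add: d_def field_simps)
  obtain U2 where U2: "openin (Sk_paths_topology p T \<E>) U2" "\<phi> \<in> U2"
    "\<And>\<psi> \<nu>. \<psi> \<in> U2 \<Longrightarrow> \<nu> \<in> invariant_measures T \<Longrightarrow>
      \<bar>mean_rotation_number p T l \<nu> \<psi> - mean_rotation_number p T l \<nu> \<phi>\<bar> \<le> d * measure (variation \<nu>) UNIV"
    using mean_rotation_number_close[OF \<phi> d] by blast
  have "\<bar>?m y - ?m x\<bar> < e" if y: "y \<in> (U1 \<times> U2) \<inter> ?S" for y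
  proof -
    obtain \<nu> \<psi> where y': "y = (\<nu>, \<psi>)" "\<nu> \<in> U1" "\<psi> \<in> U2" "emeasure (variation \<nu>) UNIV \<le> ennreal R" using y by auto
    have \<nu>: "\<nu> \<in> invariant_measures T" using y'(2) by (simp add: U1_def)
    interpret V: finite_measure "variation \<nu>" by (rule finite_measure_variation[OF invariant_signed[OF \<nu>]])
    have "ennreal (measure (variation \<nu>) UNIV) \<le> ennreal R"
      using y'(4) by (simp add: V.emeasure_eq_measure)
    \<comment> \<open>For negative \<open>R\<close> the bound reads \<open>ennreal R = 0\<close>, so
      the absolute value covers both cases.\<close>
    then have "measure (variation \<nu>) UNIV \<le> \<bar>R\<bar>"
      by (cases "R \<ge> 0") (auto simp: ennreal_neg ennreal_le_iff)
    then have "d * measure (variation \<nu>) UNIV \<le> d * \<bar>R\<bar>" using d by (intro mult_left_mono) auto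
    then have "\<bar>mean_rotation_number p T l \<nu> \<psi> - mean_rotation_number p T l \<nu> \<phi>\<bar> < e / 2"
      using U2(3)[OF y'(3) \<nu>] dR by linarith
    moreover have "\<bar>mean_rotation_number p T l \<nu> \<phi> - mean_rotation_number p T l \<mu> \<phi>\<bar> < e / 2"
      using y'(2) unfolding b(2)[OF \<nu>] b(2)[OF \<mu>] U1_def by (simp add: dist_real_def abs_minus_commute)
    ultimately show ?thesis unfolding y'(1) x' prod.case by linarith
  qed
  moreover have "openin (subtopology ?X ?S) ((U1 \<times> U2) \<inter> ?S)"
    unfolding openin_subtopology using openin_prod_Times_iff U1(1) U2(1) by blast
  moreover have "x \<in> (U1 \<times> U2) \<inter> ?S" using xS U1(2) U2(2) by (simp add: x')
  ultimately show "\<exists>U. openin (subtopology ?X ?S) U \<and> x \<in> U \<and> (\<forall>y\<in>U. \<bar>?m y - ?m x\<bar> < e)" by blast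
qed

text \<open>The same splitting as for bounded variation; here the bound comes from the convergence
  itself, since convergent integrals of each test function are bounded and
  \<open>weak_star_bounded\<close> applies.\<close>

lemma mean_rotation_number_sequentially_continuous:
  assumes "limitin (prod_topology (weak_star_topology T) (Sk_paths_topology p T \<E>))
    (\<lambda>k. (\<mu>s k, \<phi>s k)) (\<mu>, \<phi>) sequentially"
  shows "(\<lambda>k. mean_rotation_number p T l (\<mu>s k) (\<phi>s k)) \<longlonglongrightarrow> mean_rotation_number p T l \<mu> \<phi>"
proof -
  have lim: "limitin (weak_star_topology T) \<mu>s \<mu> sequentially" "limitin (Sk_paths_topology p T \<E>) \<phi>s \<phi> sequentially"
    using assms unfolding limitin_pairwise by (simp_all add: comp_def)
  have \<mu>: "\<mu> \<in> invariant_measures T" and \<phi>: "\<phi> \<in> Sk_paths p T \<E>"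
    using limitin_topspace[OF lim(1)] limitin_topspace[OF lim(2)]
    by (simp_all add: topspace_weak_star topspace_Sk_paths_topology)
  \<comment> \<open>Convergence constrains the terms only eventually: the first ones need not even
    be signed measures, hence the shift by \<open>N\<close>.\<close>
  have "eventually (\<lambda>k. \<mu>s k \<in> topspace (weak_star_topology T)) sequentially"
    using lim(1) openin_topspace unfolding limitin_def by blast
  then obtain N where N: "\<And>k. k \<ge> N \<Longrightarrow> \<mu>s k \<in> invariant_measures T"
    unfolding eventually_sequentially topspace_weak_star by blast
  have conv: "(\<lambda>k. signed_integral (\<mu>s k) g) \<longlonglongrightarrow> signed_integral \<mu> g" if g: "continuous_on UNIV g" for g
  proof (rule topological_tendstoI)
    fix V :: "real set" assume "open V" "signed_integral \<mu> g \<in> V"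
    then have "openin (weak_star_topology T) {\<nu> \<in> invariant_measures T. signed_integral \<nu> g \<in> V}"
      "\<mu> \<in> {\<nu> \<in> invariant_measures T. signed_integral \<nu> g \<in> V}" using weak_star_openin[OF g] \<mu> by auto
    then have "eventually (\<lambda>k. \<mu>s k \<in> {\<nu> \<in> invariant_measures T. signed_integral \<nu> g \<in> V}) sequentially"
      using lim(1) unfolding limitin_def by blast
    then show "eventually (\<lambda>k. signed_integral (\<mu>s k) g \<in> V) sequentially" by (rule eventually_mono) simp
  qed
  have "\<exists>R. \<forall>k. measure (variation (\<mu>s (k + N))) UNIV \<le> R"
  proof (rule weak_star_bounded[OF compact_base])
    show "\<mu>s (k + N) \<in> signed_measures" for k by (rule invariant_signed[OF N]) simp
    fix g :: "'x \<Rightarrow> real" assume g: "continuous_on UNIV g"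
    have "Bseq (\<lambda>k. signed_integral (\<mu>s (k + N)) g)"
      using LIMSEQ_ignore_initial_segment[OF conv[OF g], of N] convergentI convergent_imp_Bseq by blast
    then show "\<exists>C. \<forall>k. \<bar>signed_integral (\<mu>s (k + N)) g\<bar> \<le> C" by (auto simp: Bseq_def)
  qed
  then obtain R where R: "\<And>k. measure (variation (\<mu>s (k + N))) UNIV \<le> R" by blast
  have R': "measure (variation (\<mu>s k)) UNIV \<le> R" if "k \<ge> N" for k using R[of "k - N"] that by simp
  have R0: "R \<ge> 0" using R[of 0] measure_nonneg order_trans by blast
  obtain b where b: "continuous_on UNIV b"
    "\<And>\<mu>. \<mu> \<in> invariant_measures T \<Longrightarrow> mean_rotation_number p T l \<mu> \<phi> = signed_integral \<mu> b"
    using mean_rotation_number_integral[OF \<phi>] by blast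
  show ?thesis
  proof (rule tendstoI)
    fix e :: real assume e: "e > 0"
    define d where "d = e / (2 * (R + 1))"
    have d: "d > 0" using e R0 by (simp add: d_def)
    have dR: "d * R < e / 2" using e R0 by (simp add: d_def field_simps)
    obtain U where U: "openin (Sk_paths_topology p T \<E>) U" "\<phi> \<in> U"
      "\<And>\<psi> \<nu>. \<psi> \<in> U \<Longrightarrow> \<nu> \<in> invariant_measures T \<Longrightarrow>
        \<bar>mean_rotation_number p T l \<nu> \<psi> - mean_rotation_number p T l \<nu> \<phi>\<bar> \<le> d * measure (variation \<nu>) UNIV"
      using mean_rotation_number_close[OF \<phi> d] by blast
    have "eventually (\<lambda>k. \<phi>s k \<in> U) sequentially" using lim(2) U(1,2) unfolding limitin_def by blast
    moreover have "eventually (\<lambda>k. dist (signed_integral (\<mu>s k) b) (signed_integral \<mu> b) < e / 2) sequentially"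
      using conv[OF b(1)] e by (intro tendstoD) auto
    moreover have "eventually (\<lambda>k. k \<ge> N) sequentially" by (rule eventually_ge_at_top)
    ultimately show "eventually (\<lambda>k. dist (mean_rotation_number p T l (\<mu>s k) (\<phi>s k)) (mean_rotation_number p T l \<mu> \<phi>) < e) sequentially"
    proof eventually_elim
      case (elim k)
      have "d * measure (variation (\<mu>s k)) UNIV \<le> d * R" using d R'[OF elim(3)] by (intro mult_left_mono) auto
      then have "\<bar>mean_rotation_number p T l (\<mu>s k) (\<phi>s k) - mean_rotation_number p T l (\<mu>s k) \<phi>\<bar> < e / 2"
        using U(3)[OF elim(1) N[OF elim(3)]] dR by linarith
      then show ?case using elim(2) unfolding b(2)[OF N[OF elim(3)]] b(2)[OF \<mu>] dist_real_def by linarith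
    qed
  qed
qed

end

end

theorem proposition4p3:
  fixes T :: "'x::metric_space \<Rightarrow> 'x"
    and p :: "'g::metric_space \<Rightarrow> 'x"
    and F\<^sub>0 :: "'f topology"
    and \<E> :: "('x, 'g) oriented_bundle set"
    and \<alpha> :: real
    and H :: "('x, 'g) oriented_bundle \<Rightarrow> ('x, 'g) oriented_bundle \<Rightarrow> 'g \<Rightarrow> 'g"
    and l :: "('x, 'g) oriented_bundle \<Rightarrow> 'x \<Rightarrow> complex \<Rightarrow> 'g"
  assumes "compact (UNIV :: 'x set)"
    and "continuous_on UNIV T"
    and "fibre_bundle F\<^sub>0 p"
    and "\<forall>E\<in>\<E>. oriented_circle_subbundle p E"
    and "\<alpha> > 0"
    and "good_homeo_family p \<E> \<alpha> H"
    and "unit_length_structure \<E> l"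
  shows
    "(\<forall>\<phi>\<in>Sk_paths p T \<E>. \<forall>\<mu>\<in>invariant_measures T.
        (AE x in variation \<mu>. x \<in> rotation_domain p T l \<phi>) \<and>
        (\<exists>B. \<forall>x\<in>rotation_domain p T l \<phi>. \<bar>rotation_number p T l \<phi> x\<bar> \<le> B) \<and>
        (\<forall>x. T x \<in> rotation_domain p T l \<phi> \<longleftrightarrow> x \<in> rotation_domain p T l \<phi>) \<and>
        (\<forall>x\<in>rotation_domain p T l \<phi>. rotation_number p T l \<phi> (T x) = rotation_number p T l \<phi> x) \<and>
        rotation_domain p T l \<phi> \<in> sets borel \<and>
        rotation_number p T l \<phi> \<in> borel_measurable borel) \<and>
     (\<forall>\<phi>\<in>Sk_paths p T \<E>. \<forall>\<psi>\<in>Sk_paths p T \<E>.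
        homotopic_with (\<lambda>\<gamma>. \<gamma> 0 = \<phi> 0 \<and> \<gamma> 1 = \<phi> 1) (top_of_set {0..1}) (Sk_topology p T \<E>) \<phi> \<psi> \<longrightarrow>
        (\<forall>x r. has_rotation_number p T l \<phi> x r \<longleftrightarrow> has_rotation_number p T l \<psi> x r)) \<and>
     (\<forall>\<mu>s \<phi>s \<mu> \<phi>.
        limitin (prod_topology (weak_star_topology T) (Sk_paths_topology p T \<E>))
          (\<lambda>k. (\<mu>s k, \<phi>s k)) (\<mu>, \<phi>) sequentially \<longrightarrow>
        (\<lambda>k. mean_rotation_number p T l (\<mu>s k) (\<phi>s k)) \<longlonglongrightarrow> mean_rotation_number p T l \<mu> \<phi>) \<and>
     (\<forall>R::real. continuous_map
        (subtopology (prod_topology (weak_star_topology T) (Sk_paths_topology p T \<E>))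
          {(\<mu>, \<phi>). emeasure (variation \<mu>) UNIV \<le> ennreal R})
        euclideanreal (\<lambda>(\<mu>, \<phi>). mean_rotation_number p T l \<mu> \<phi>)) \<and>
     (\<forall>\<phi>\<in>Sk_paths p T \<E>. continuous_map (weak_star_topology T) euclideanreal
        (\<lambda>\<mu>. mean_rotation_number p T l \<mu> \<phi>)) \<and>
     (\<forall>\<mu>\<in>invariant_measures T. continuous_map (Sk_paths_topology p T \<E>) euclideanreal
        (\<lambda>\<phi>. mean_rotation_number p T l \<mu> \<phi>))"
proof -
  interpret circle_bundle_space p T \<E> \<alpha> H
    by unfold_locales (use assms in \<open>auto simp: fibre_bundle_def\<close>)
  note l = assms(7)
  show ?thesis
    by (intro conjI allI impI ballI)
      (simp_all add: rotation_number_AE(3)[OF l] rotation_number_regular(2-5)[OF l]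
        has_rotation_number_homotopic[OF l] mean_rotation_number_sequentially_continuous[OF l]
        mean_rotation_number_continuous_bounded[OF l] mean_rotation_number_continuous_measure[OF l]
        mean_rotation_number_continuous_path[OF l], use rotation_number_regular(1)[OF l] in blast)
qed

end
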